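(* Assume that $0<\rho_1\le\rho_0\le\rho_2$ a.e. in $\Omega$, that $\mathbf{u}_0\in\mathbf{H}^1_0(\Omega)$ and that $\operatorname{div}\mathbf{u}_0=0$. Let $(\rho^n,\mathbf{u}^n,\hat{\mathbf{u}}^n,q^n,p^n,\boldsymbol\Sigma^n)_{0\le n\le N}$ be produced by the bi-projection scheme, and for each $0\le n\le N-1$ let $(\mathbf{u}^{n,k},\boldsymbol\Sigma^{n,k})_{k\ge0}$ be the fixed-point iterates (both described in the context). If $$4\theta+r\frac{(\alpha_2)^2}{\mu_1}\le4,$$ then, for all $0\le n\le N-1$, the sequence $(\mathbf{u}^{n,k},\boldsymbol\Sigma^{n,k})_k$ tends to $(\mathbf{u}^{n+1},\boldsymbol\Sigma^{n+1})$ in $L^2(\Omega)$ as $k\to\infty$. Moreover the convergence is geometric with common ratio $1-\theta$, i.e. there is a constant $C$ independent of $k$ such that $\|\mathbf{u}^{n,k}-\mathbf{u}^{n+1}\|\le C(1-\theta)^k$ and $\|\boldsymbol\Sigma^{n,k}-\boldsymbol\Sigma^{n+1}\|\le C(1-\theta)^k$ for all $k\ge0$.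
   Context: Setting: $T>0$, $\Omega$ is a bounded domain of $\mathbb{R}^3$ with boundary $\Gamma$ and unit outward normal $\mathbf{n}$. Bold function spaces are vector-valued. $\|\cdot\|$ is the $L^2(\Omega)$ norm. $\mathbf{D}\mathbf{u}=\frac12(\nabla\mathbf{u}+{}^T\nabla\mathbf{u})$. Tensor conventions: for $\boldsymbol\lambda\in\mathbb{R}^{3\times3}$, $|\boldsymbol\lambda|^2=\frac12\operatorname{tr}({}^T\boldsymbol\lambda\boldsymbol\lambda)$, and for tensor fields $\|\boldsymbol f\|^2=\int_\Omega|\boldsymbol f|^2$. $\Lambda=\{\boldsymbol\lambda\in\mathbb{R}^{3\times3}:|\boldsymbol\lambda|\le1,\ {}^T\boldsymbol\lambda=\boldsymbol\lambda,\ \operatorname{tr}\boldsymbol\lambda=0\}$ and $\mathbb{P}$ is the projection onto the closed convex set $\Lambda$, applied pointwise a.e. to tensor fields. $\boldsymbol\Lambda=\{\boldsymbol f\in L^2(\Omega)^{3\times3}: \boldsymbol f(x)\in\Lambda\text{ a.e.}\}$. Coefficients: the plastic viscosity $\mu$ and yield stress $\alpha$ are $\mathcal{C}^1$ functions of the density, $\mu$ positive and $\alpha$ non-negative; there are constants $\mu_1,\mu_2>0$, $\alpha_1,\alpha_2\ge0$ with $\mu_1\le\mu(s)\le\mu_2$ and $\alpha_1\le\alpha(s)\le\alpha_2$ for $s\in[\rho_1,\rho_2]$. (The discrete densities satisfy $\rho_1\le\rho^n\le\rho_2$ a.e.) Notation: $\tilde B(\mathbf{u},\mathbf{v})=(\mathbf{u}\cdot\nabla)\mathbf{v}+\frac{\mathbf{v}}2\operatorname{div}\mathbf{u}$.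 Bi-projection scheme: $N>0$ integer, $\delta t=T/N$, $t_n=n\,\delta t$, numerical parameters $r>0$, $\theta>0$. Initialization: $\rho^0=\rho_0$, $\mathbf{u}^0=\hat{\mathbf{u}}^0=\mathbf{u}_0$, $q^0=0$, with $p^0$ and $\boldsymbol\Sigma^0$ arbitrary (in the relevant spaces). For $0\le n\le N-1$: (1) $\rho^{n+1}$ is the viscosity solution of $\frac{\rho^{n+1}-\rho^n}{\delta t}+\hat{\mathbf{u}}^n\cdot\nabla\rho^{n+1}=0$, i.e. the limit as $\epsilon\to0$ (weak-$*$ in $L^\infty(\Omega)$) of the solutions $\rho_\epsilon^{n+1}\in H^1(\Omega)$ of $\frac{\rho_\epsilon^{n+1}-\rho^n}{\delta t}+\hat{\mathbf{u}}^n\cdot\nabla\rho_\epsilon^{n+1}-\epsilon\Delta\rho_\epsilon^{n+1}=0$, $\nabla\rho_\epsilon^{n+1}\cdot\mathbf{n}|_\Gamma=0$. Set $\mu^{n+1}=\mu(\rho^{n+1})$, $\alpha^{n+1}=\alpha(\rho^{n+1})$. (2) $(\mathbf{u}^{n+1},\boldsymbol\Sigma^{n+1})\in\mathbf{H}^1_0(\Omega)\times\boldsymbol\Lambda$ solves $$\tfrac1{\delta t}\big[\tfrac12(\rho^{n+1}+\rho^n)\mathbf{u}^{n+1}-\rho^n\mathbf{u}^n\big]+\tilde B(\rho^{n+1}\hat{\mathbf{u}}^n,\mathbf{u}^{n+1})-\operatorname{div}(2\mu^{n+1}\mathbf{D}\mathbf{u}^{n+1})+\nabla(p^n+q^n)=\operatorname{div}(\alpha^{n+1}\boldsymbol\Sigma^{n+1}),$$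 $$\boldsymbol\Sigma^{n+1}=\mathbb{P}\big(\boldsymbol\Sigma^{n+1}+r\alpha^{n+1}\mathbf{D}\mathbf{u}^{n+1}+\theta(\boldsymbol\Sigma^n-\boldsymbol\Sigma^{n+1})\big),\qquad \mathbf{u}^{n+1}|_\Gamma=0.$$ (3) $q^{n+1}$ solves $\Delta q^{n+1}=\frac{\rho_1}{\delta t}\operatorname{div}\mathbf{u}^{n+1}$, $\partial_{\mathbf{n}}q^{n+1}|_\Gamma=0$ (up to an irrelevant additive constant). (4) $p^{n+1}=p^n+q^{n+1}$ and $\hat{\mathbf{u}}^{n+1}=\mathbf{u}^{n+1}-\frac{\delta t}{\rho_1}\nabla q^{n+1}$. Fixed-point iteration for step (2): set $\boldsymbol\Sigma^{n,0}=\boldsymbol\Sigma^n$. For $k\ge0$, given $\boldsymbol\Sigma^{n,k}\in\boldsymbol\Lambda$, let $\mathbf{u}^{n,k}\in\mathbf{H}^1_0(\Omega)$ be the solution of $$\tfrac1{\delta t}\big[\tfrac12(\rho^{n+1}+\rho^n)\mathbf{u}^{n,k}-\rho^n\mathbf{u}^n\big]+\tilde B(\rho^{n+1}\hat{\mathbf{u}}^n,\mathbf{u}^{n,k})-\operatorname{div}(2\mu^{n+1}\mathbf{D}\mathbf{u}^{n,k})+\nabla(p^n+q^n)=\operatorname{div}(\alpha^{n+1}\boldsymbol\Sigma^{n,k}),\quad \mathbf{u}^{n,k}|_\Gamma=0,$$ and then set $\boldsymbol\Sigma^{n,k+1}=\mathbb{P}\big(\boldsymbol\Sigma^{n,k}+r\alpha^{n+1}\mathbf{D}\mathbf{u}^{n,k}+\theta(\boldsymbol\Sigma^n-\boldsymbol\Sigma^{n,k})\big)$.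 *)

theory Defs
  imports "HOL-Analysis.Analysis"
begin

section \<open>Tensors\<close>

text \<open>The tensor norm carries a factor 1/2 and hence differs from the library norm on
  \<^typ>\<open>real^3^3\<close>, which is the Frobenius norm. The inner product \<open>A \<bullet> B\<close> of \<^typ>\<open>real^3^3\<close>
  is the full contraction \<open>A : B\<close>, without the factor 1/2.\<close>

definition tensor_norm :: "real^3^3 \<Rightarrow> real" where
  "tensor_norm A = sqrt (trace (transpose A ** A) / 2)"

definition Lam :: "(real^3^3) set" where
  "Lam = {A. tensor_norm A \<le> 1 \<and> transpose A = A \<and> trace A = 0}"

text \<open>\<^const>\<open>closest_point\<close> uses the Frobenius distance; as this is a constant multiple of the
  distance given by \<open>tensor_norm\<close>, both give the same projection.\<close>

definition proj_Lam :: "real^3^3 \<Rightarrow> real^3^3" where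
  "proj_Lam A = closest_point Lam A"


section \<open>Test functions\<close>

definition partial :: "3 \<Rightarrow> (real^3 \<Rightarrow> real) \<Rightarrow> real^3 \<Rightarrow> real" where
  "partial i f x = frechet_derivative f (at x) (axis i 1)"

primrec Ck :: "nat \<Rightarrow> (real^3 \<Rightarrow> real) \<Rightarrow> bool" where
  "Ck 0 f \<longleftrightarrow> continuous_on UNIV f"
| "Ck (Suc k) f \<longleftrightarrow> (\<forall>x. f differentiable (at x)) \<and> (\<forall>i. Ck k (partial i f))"

definition test_fun :: "(real^3) set \<Rightarrow> (real^3 \<Rightarrow> real) set" where
  "test_fun \<Omega> = {\<phi>. (\<forall>k. Ck k \<phi>) \<and> compact (closure {x. \<phi> x \<noteq> 0}) \<and> closure {x. \<phi> x \<noteq> 0} \<subseteq> \<Omega>}"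

definition vtest_fun :: "(real^3) set \<Rightarrow> (real^3 \<Rightarrow> real^3) set" where
  "vtest_fun \<Omega> = {\<phi>. \<forall>i. (\<lambda>x. \<phi> x $ i) \<in> test_fun \<Omega>}"

definition jac :: "(real^3 \<Rightarrow> real^3) \<Rightarrow> real^3 \<Rightarrow> real^3^3" where
  "jac \<phi> x = (\<chi> i j. partial j (\<lambda>y. \<phi> y $ i) x)"


section \<open>Lebesgue and Sobolev spaces\<close>

text \<open>Elements of these spaces are representatives; equality almost everywhere is written out
  where it is meant. Using the completed measure \<^term>\<open>lebesgue_on \<Omega>\<close>, membership does not depend
  on the choice of the representative.\<close>

definition L2 :: "(real^3) set \<Rightarrow> (real^3 \<Rightarrow> 'b::euclidean_space) set" where
  "L2 \<Omega> = {f. f \<in> borel_measurable (lebesgue_on \<Omega>) \<and> integrable (lebesgue_on \<Omega>) (\<lambda>x. (norm (f x))\<^sup>2)}"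

definition Linf :: "(real^3) set \<Rightarrow> (real^3 \<Rightarrow> real) set" where
  "Linf \<Omega> = {f. f \<in> borel_measurable (lebesgue_on \<Omega>) \<and> (\<exists>C. AE x in lebesgue_on \<Omega>. \<bar>f x\<bar> \<le> C)}"

definition L2_norm :: "(real^3) set \<Rightarrow> (real^3 \<Rightarrow> 'b::euclidean_space) \<Rightarrow> real" where
  "L2_norm \<Omega> f = sqrt (LINT x|lebesgue_on \<Omega>. (norm (f x))\<^sup>2)"

definition tensor_L2_norm :: "(real^3) set \<Rightarrow> (real^3 \<Rightarrow> real^3^3) \<Rightarrow> real" where
  "tensor_L2_norm \<Omega> F = sqrt (LINT x|lebesgue_on \<Omega>. (tensor_norm (F x))\<^sup>2)"

definition weak_partial :: "(real^3) set \<Rightarrow> 3 \<Rightarrow> (real^3 \<Rightarrow> real) \<Rightarrow> (real^3 \<Rightarrow> real) \<Rightarrow> bool" where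
  "weak_partial \<Omega> i f g \<longleftrightarrow>
     (\<forall>\<phi>\<in>test_fun \<Omega>.
        (LINT x|lebesgue_on \<Omega>. f x * partial i \<phi> x) = - (LINT x|lebesgue_on \<Omega>. g x * \<phi> x))"

definition H1 :: "(real^3) set \<Rightarrow> (real^3 \<Rightarrow> real) set" where
  "H1 \<Omega> = {f \<in> L2 \<Omega>. \<forall>i. \<exists>g\<in>L2 \<Omega>. weak_partial \<Omega> i f g}"

text \<open>A representative of the weak partial derivative (unique up to null sets), meant for
  \<^term>\<open>f \<in> H1 \<Omega>\<close> only.\<close>

definition wpartial :: "(real^3) set \<Rightarrow> 3 \<Rightarrow> (real^3 \<Rightarrow> real) \<Rightarrow> real^3 \<Rightarrow> real" where
  "wpartial \<Omega> i f = (SOME g. g \<in> L2 \<Omega> \<and> weak_partial \<Omega> i f g)"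

definition wgrad :: "(real^3) set \<Rightarrow> (real^3 \<Rightarrow> real) \<Rightarrow> real^3 \<Rightarrow> real^3" where
  "wgrad \<Omega> f x = (\<chi> i. wpartial \<Omega> i f x)"

definition wjac :: "(real^3) set \<Rightarrow> (real^3 \<Rightarrow> real^3) \<Rightarrow> real^3 \<Rightarrow> real^3^3" where
  "wjac \<Omega> u x = (\<chi> i j. wpartial \<Omega> j (\<lambda>y. u y $ i) x)"

definition wdiv :: "(real^3) set \<Rightarrow> (real^3 \<Rightarrow> real^3) \<Rightarrow> real^3 \<Rightarrow> real" where
  "wdiv \<Omega> u x = trace (wjac \<Omega> u x)"

definition strain :: "(real^3) set \<Rightarrow> (real^3 \<Rightarrow> real^3) \<Rightarrow> real^3 \<Rightarrow> real^3^3" where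
  "strain \<Omega> u x = (1/2) *\<^sub>R (wjac \<Omega> u x + transpose (wjac \<Omega> u x))"

definition H1_norm :: "(real^3) set \<Rightarrow> (real^3 \<Rightarrow> real) \<Rightarrow> real" where
  "H1_norm \<Omega> f = sqrt ((L2_norm \<Omega> f)\<^sup>2 + (L2_norm \<Omega> (wgrad \<Omega> f))\<^sup>2)"

definition H10 :: "(real^3) set \<Rightarrow> (real^3 \<Rightarrow> real) set" where
  "H10 \<Omega> = {f \<in> H1 \<Omega>. \<forall>e>0. \<exists>\<phi>\<in>test_fun \<Omega>. H1_norm \<Omega> (\<lambda>x. f x - \<phi> x) < e}"

definition vH10 :: "(real^3) set \<Rightarrow> (real^3 \<Rightarrow> real^3) set" where
  "vH10 \<Omega> = {u. \<forall>i. (\<lambda>x. u x $ i) \<in> H10 \<Omega>}"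

definition Lam_fields :: "(real^3) set \<Rightarrow> (real^3 \<Rightarrow> real^3^3) set" where
  "Lam_fields \<Omega> = {F \<in> L2 \<Omega>. AE x in lebesgue_on \<Omega>. F x \<in> Lam}"

definition weak_star_Linf :: "(real^3) set \<Rightarrow> ('c \<Rightarrow> real^3 \<Rightarrow> real) \<Rightarrow> (real^3 \<Rightarrow> real) \<Rightarrow> 'c filter \<Rightarrow> bool" where
  "weak_star_Linf \<Omega> f l F \<longleftrightarrow>
     l \<in> Linf \<Omega> \<and> (\<forall>\<^sub>F \<epsilon> in F. f \<epsilon> \<in> Linf \<Omega>) \<and>
     (\<forall>g. integrable (lebesgue_on \<Omega>) g \<longrightarrow>
        ((\<lambda>\<epsilon>. LINT x|lebesgue_on \<Omega>. f \<epsilon> x * g x) \<longlongrightarrow> (LINT x|lebesgue_on \<Omega>. l x * g x)) F)"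


section \<open>The steps of the scheme\<close>

text \<open>Weak form of \<open>(\<sigma> - \<rho>) / dt + w \<cdot> \<nabla>\<sigma> - \<epsilon> \<Delta>\<sigma> = 0\<close> with the homogeneous Neumann condition, which
  is natural and therefore encoded by test functions that need not vanish on the boundary. They
  are bounded, as \<open>w\<close> is only square integrable.\<close>

definition viscous_density_eq ::
  "(real^3) set \<Rightarrow> real \<Rightarrow> (real^3 \<Rightarrow> real^3) \<Rightarrow> (real^3 \<Rightarrow> real) \<Rightarrow> real \<Rightarrow> (real^3 \<Rightarrow> real) \<Rightarrow> bool" where
  "viscous_density_eq \<Omega> dt w \<rho> \<epsilon> \<sigma> \<longleftrightarrow>
     \<sigma> \<in> H1 \<Omega> \<and>
     (\<forall>\<psi>\<in>H1 \<Omega> \<inter> Linf \<Omega>.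
        (LINT x|lebesgue_on \<Omega>. ((\<sigma> x - \<rho> x) / dt + w x \<bullet> wgrad \<Omega> \<sigma> x) * \<psi> x)
        + \<epsilon> * (LINT x|lebesgue_on \<Omega>. wgrad \<Omega> \<sigma> x \<bullet> wgrad \<Omega> \<psi> x) = 0)"

definition density_step ::
  "(real^3) set \<Rightarrow> real \<Rightarrow> (real^3 \<Rightarrow> real^3) \<Rightarrow> (real^3 \<Rightarrow> real) \<Rightarrow> (real^3 \<Rightarrow> real) \<Rightarrow> bool" where
  "density_step \<Omega> dt w \<rho> \<rho>' \<longleftrightarrow>
     (\<exists>\<sigma>. (\<forall>\<epsilon>>0. viscous_density_eq \<Omega> dt w \<rho> \<epsilon> (\<sigma> \<epsilon>)) \<and> weak_star_Linf \<Omega> \<sigma> \<rho>' (at_right 0))"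

text \<open>The pairing of \<open>B(w,u) = (w \<cdot> \<nabla>)u + (u/2) div w\<close> with a test function. In general
  \<open>div w\<close> is only a distribution, and its pairing with \<open>u \<cdot> \<phi>\<close> is \<open>- \<integral> w \<cdot> \<nabla>(u \<cdot> \<phi>)\<close>.\<close>

definition B_tilde ::
  "(real^3) set \<Rightarrow> (real^3 \<Rightarrow> real^3) \<Rightarrow> (real^3 \<Rightarrow> real^3) \<Rightarrow> (real^3 \<Rightarrow> real^3) \<Rightarrow> real" where
  "B_tilde \<Omega> w u \<phi> =
     (LINT x|lebesgue_on \<Omega>. (wjac \<Omega> u x *v w x) \<bullet> \<phi> x)
     - (1/2) * (LINT x|lebesgue_on \<Omega>. w x \<bullet> wgrad \<Omega> (\<lambda>y. u y \<bullet> \<phi> y) x)"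

text \<open>The momentum equation in the sense of distributions, for the unknown velocity \<open>u\<close>:
  \<open>\<rho>\<close>, \<open>\<rho>'\<close> are the old and the new density, \<open>m\<close>, \<open>a\<close> the viscosity and yield stress fields,
  \<open>v\<close> the old velocity, \<open>w\<close> the old projected velocity, \<open>\<pi>\<close> the pressure and \<open>S\<close> the plastic stress.\<close>

definition momentum_eq ::
  "(real^3) set \<Rightarrow> real \<Rightarrow> (real^3 \<Rightarrow> real) \<Rightarrow> (real^3 \<Rightarrow> real) \<Rightarrow> (real^3 \<Rightarrow> real) \<Rightarrow> (real^3 \<Rightarrow> real) \<Rightarrow>
   (real^3 \<Rightarrow> real^3) \<Rightarrow> (real^3 \<Rightarrow> real^3) \<Rightarrow> (real^3 \<Rightarrow> real) \<Rightarrow> (real^3 \<Rightarrow> real^3^3) \<Rightarrow>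
   (real^3 \<Rightarrow> real^3) \<Rightarrow> bool" where
  "momentum_eq \<Omega> dt \<rho> \<rho>' m a v w \<pi> S u \<longleftrightarrow>
     (\<forall>\<phi>\<in>vtest_fun \<Omega>.
        (1/dt) * (LINT x|lebesgue_on \<Omega>.
                   (((1/2) * (\<rho>' x + \<rho> x)) *\<^sub>R u x - \<rho> x *\<^sub>R v x) \<bullet> \<phi> x)
        + B_tilde \<Omega> (\<lambda>x. \<rho>' x *\<^sub>R w x) u \<phi>
        + (LINT x|lebesgue_on \<Omega>. ((2 * m x) *\<^sub>R strain \<Omega> u x) \<bullet> jac \<phi> x)
        - (LINT x|lebesgue_on \<Omega>. \<pi> x * trace (jac \<phi> x))
        = - (LINT x|lebesgue_on \<Omega>. (a x *\<^sub>R S x) \<bullet> jac \<phi> x))"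

definition stress_update ::
  "(real^3) set \<Rightarrow> real \<Rightarrow> real \<Rightarrow> (real^3 \<Rightarrow> real) \<Rightarrow> (real^3 \<Rightarrow> real^3) \<Rightarrow>
   (real^3 \<Rightarrow> real^3^3) \<Rightarrow> (real^3 \<Rightarrow> real^3^3) \<Rightarrow> real^3 \<Rightarrow> real^3^3" where
  "stress_update \<Omega> r \<theta> a u S0 S x =
     proj_Lam (S x + (r * a x) *\<^sub>R strain \<Omega> u x + \<theta> *\<^sub>R (S0 x - S x))"

text \<open>Weak form of the Neumann problem \<open>\<Delta>q = (\<rho>1/dt) div u\<close>; it fixes \<open>q\<close> up to a constant.\<close>

definition pressure_step ::
  "(real^3) set \<Rightarrow> real \<Rightarrow> real \<Rightarrow> (real^3 \<Rightarrow> real^3) \<Rightarrow> (real^3 \<Rightarrow> real) \<Rightarrow> bool" where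
  "pressure_step \<Omega> dt \<rho>1 u q \<longleftrightarrow>
     q \<in> H1 \<Omega> \<and>
     (\<forall>\<psi>\<in>H1 \<Omega>. - (LINT x|lebesgue_on \<Omega>. wgrad \<Omega> q x \<bullet> wgrad \<Omega> \<psi> x)
                = (LINT x|lebesgue_on \<Omega>. (\<rho>1/dt) * wdiv \<Omega> u x * \<psi> x))"

definition bi_projection_scheme ::
  "(real^3) set \<Rightarrow> real \<Rightarrow> nat \<Rightarrow> real \<Rightarrow> real \<Rightarrow> real \<Rightarrow> (real \<Rightarrow> real) \<Rightarrow> (real \<Rightarrow> real) \<Rightarrow>
   (real^3 \<Rightarrow> real) \<Rightarrow> (real^3 \<Rightarrow> real^3) \<Rightarrow>
   (nat \<Rightarrow> real^3 \<Rightarrow> real) \<Rightarrow> (nat \<Rightarrow> real^3 \<Rightarrow> real^3) \<Rightarrow> (nat \<Rightarrow> real^3 \<Rightarrow> real^3) \<Rightarrow>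
   (nat \<Rightarrow> real^3 \<Rightarrow> real) \<Rightarrow> (nat \<Rightarrow> real^3 \<Rightarrow> real) \<Rightarrow> (nat \<Rightarrow> real^3 \<Rightarrow> real^3^3) \<Rightarrow> bool" where
  "bi_projection_scheme \<Omega> T N r \<theta> \<rho>1 \<mu> \<alpha> \<rho>0 u0 \<rho> u uh q p S \<longleftrightarrow>
     (let dt = T / real N in
       \<rho> 0 = \<rho>0 \<and> u 0 = u0 \<and> uh 0 = u0 \<and> q 0 = (\<lambda>x. 0) \<and> p 0 \<in> L2 \<Omega> \<and> S 0 \<in> Lam_fields \<Omega> \<and>
       (\<forall>n<N.
          density_step \<Omega> dt (uh n) (\<rho> n) (\<rho> (Suc n)) \<and>
          u (Suc n) \<in> vH10 \<Omega> \<and> S (Suc n) \<in> Lam_fields \<Omega> \<and>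
          momentum_eq \<Omega> dt (\<rho> n) (\<rho> (Suc n)) (\<lambda>x. \<mu> (\<rho> (Suc n) x)) (\<lambda>x. \<alpha> (\<rho> (Suc n) x))
            (u n) (uh n) (\<lambda>x. p n x + q n x) (S (Suc n)) (u (Suc n)) \<and>
          (AE x in lebesgue_on \<Omega>. S (Suc n) x =
             stress_update \<Omega> r \<theta> (\<lambda>x. \<alpha> (\<rho> (Suc n) x)) (u (Suc n)) (S n) (S (Suc n)) x) \<and>
          pressure_step \<Omega> dt \<rho>1 (u (Suc n)) (q (Suc n)) \<and>
          (AE x in lebesgue_on \<Omega>. p (Suc n) x = p n x + q (Suc n) x) \<and>
          (AE x in lebesgue_on \<Omega>. uh (Suc n) x = u (Suc n) x - (dt / \<rho>1) *\<^sub>R wgrad \<Omega> (q (Suc n)) x)))"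

text \<open>The fixed-point iteration at one time step; \<open>S0\<close> is the stress at the old time level and the
  other data are as in \<^const>\<open>momentum_eq\<close>.\<close>

definition fixed_point_iterates ::
  "(real^3) set \<Rightarrow> real \<Rightarrow> real \<Rightarrow> real \<Rightarrow> (real^3 \<Rightarrow> real) \<Rightarrow> (real^3 \<Rightarrow> real) \<Rightarrow> (real^3 \<Rightarrow> real) \<Rightarrow>
   (real^3 \<Rightarrow> real) \<Rightarrow> (real^3 \<Rightarrow> real^3) \<Rightarrow> (real^3 \<Rightarrow> real^3) \<Rightarrow> (real^3 \<Rightarrow> real) \<Rightarrow> (real^3 \<Rightarrow> real^3^3) \<Rightarrow>
   (nat \<Rightarrow> real^3 \<Rightarrow> real^3) \<Rightarrow> (nat \<Rightarrow> real^3 \<Rightarrow> real^3^3) \<Rightarrow> bool" where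
  "fixed_point_iterates \<Omega> dt r \<theta> \<rho> \<rho>' m a v w \<pi> S0 uk Sk \<longleftrightarrow>
     Sk 0 = S0 \<and>
     (\<forall>k. Sk k \<in> Lam_fields \<Omega> \<and> uk k \<in> vH10 \<Omega> \<and>
          momentum_eq \<Omega> dt \<rho> \<rho>' m a v w \<pi> (Sk k) (uk k) \<and>
          (AE x in lebesgue_on \<Omega>. Sk (Suc k) x = stress_update \<Omega> r \<theta> a (uk k) S0 (Sk k) x))"

end

(* The errors of stress and velocity of the fixed-point iteration satisfy the energy identity of the
   momentum equation; combined with the nonexpansiveness of the projection, the smallness condition
   gives |E(k+1)|^2 + c |e(k)|^2 <= (1 - theta)^2 |E(k)|^2 for the L2 norms, hence geometric convergence.

   On an arbitrary bounded open set the projected velocity w is only square integrable, so the velocity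
   error e is not an admissible test field. The momentum equation is tested with e / (1 + delta |e|^2)^2
   instead, which is bounded and for which the transport term is the gradient of a function of e;
   then delta tends to 0. The transport term is controlled by the weak form of
   (rho' - rho) / dt + div (rho' w) = 0, obtained from the viscous density equation.

   The bounds rho1 <= rho <= rho2 come from testing the viscous density equation with the odd powers of
   sigma - (rho1 + rho2) / 2 and letting the exponent tend to infinity; this only needs the product rule
   for bounded functions with weak derivatives. *)

theory Submission
  imports Defs
begin

section \<open>Smooth functions and test functions\<close>

text \<open>The smallness condition is
  \<open>r * \<alpha>2^2 \<le> 4 * (1 - \<theta>) * \<mu>1\<close> rearranged. With E and D the
  errors of stress and strain, nonexpansiveness leaves the square of (1 - \<theta>) E + r a D. The
  energy identity bounds the integral of a E : D by minus that of 2 m |D|^2, so the cross term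
  supplies - 4 r (1 - \<theta>) m |D|^2, and the condition says that this absorbs r^2 a^2 |D|^2. For
  \<theta> = 1 it forces \<open>\<alpha>2 = 0\<close>, and the velocity error is then zero. The half
  divergence in \<open>B_tilde\<close> is what makes the energy identity close: transporting e
  yields half of div (rho' w), which cancels against it, and only the mean of the two densities
  remains, which is at least \<open>\<rho>1\<close>. The exponent two in the test field comes from v
  / (1 + \<delta> |v|^2)^2 being the gradient in v of |v|^2 / (2 (1 + \<delta> |v|^2)). Composed
  with a test field this scalar is a test function, so the weak continuity equation applies to it
  directly, with a classical chain rule. As the boundary of \<Omega> has no regularity, all
  approximation is either interior or within \<open>H10\<close>, whose elements are limits of test
  functions by definition.\<close>

definition smooth :: "(real^3 \<Rightarrow> real) \<Rightarrow> bool" where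
  "smooth f \<longleftrightarrow> (\<forall>k. Ck k f)"

lemma partial_eqI:
  assumes "(f has_derivative f') (at x)"
  shows "partial i f x = f' (axis i 1)"
  unfolding partial_def using frechet_derivative_at[OF assms] by simp

text \<open>Not immediate from the recursion: \<open>Ck (Suc k)\<close> asks only for pointwise
  differentiability at the top level, and the continuity demanded by \<open>Ck 0\<close> has to be
  derived from it.\<close>

lemma Ck_Suc_D: "Ck (Suc k) f \<Longrightarrow> Ck k f"
proof (induction k arbitrary: f)
  case 0
  then show ?case
    by (auto simp: continuous_on_eq_continuous_at dest: differentiable_imp_continuous_within)
next
  case (Suc k)
  then show ?case by (metis Ck.simps(2))
qed

lemma smooth_unfold: "smooth f \<longleftrightarrow> (\<forall>x. f differentiable (at x)) \<and> (\<forall>i. smooth (partial i f))"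
  unfolding smooth_def using Ck_Suc_D by (metis Ck.simps(2))

lemma smooth_has_derivative: "smooth f \<Longrightarrow> (f has_derivative frechet_derivative f (at x)) (at x)"
  using smooth_unfold frechet_derivative_works by blast

lemma smooth_partial: "smooth f \<Longrightarrow> smooth (partial i f)"
  using smooth_unfold by blast

lemma smooth_continuous: "smooth f \<Longrightarrow> continuous_on A f"
  unfolding smooth_def by (metis Ck.simps(1) continuous_on_subset subset_UNIV)

lemma smooth_differentiable: "smooth f \<Longrightarrow> f differentiable (at x)"
  using smooth_unfold by blast

lemma smooth_borel [measurable_dest]: "smooth f \<Longrightarrow> f \<in> borel_measurable borel"
  by (rule borel_measurable_continuous_onI) (rule smooth_continuous)

lemma partial_const: "partial i (\<lambda>x. c) = (\<lambda>x. 0)"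
  by (rule ext) (subst partial_eqI, auto intro!: derivative_eq_intros)

lemma partial_add:
  assumes "f differentiable (at x)" "g differentiable (at x)"
  shows "partial i (\<lambda>x. f x + g x) x = partial i f x + partial i g x"
  using assms[unfolded frechet_derivative_works]
  by (subst partial_eqI, auto simp: partial_def intro!: derivative_eq_intros)

lemma partial_mult:
  assumes "f differentiable (at x)" "g differentiable (at x)"
  shows "partial i (\<lambda>x. f x * g x) x = partial i f x * g x + f x * partial i g x"
  using assms[unfolded frechet_derivative_works]
  by (subst partial_eqI, auto simp: partial_def intro!: derivative_eq_intros)

lemma partial_compose:
  assumes "f differentiable (at x)" "(h has_real_derivative h') (at (f x))"
  shows "partial i (\<lambda>x. h (f x)) x = h' * partial i f x"
proof -
  have "((\<lambda>x. h (f x)) has_derivative (\<lambda>v. h' * frechet_derivative f (at x) v)) (at x)"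
    using has_derivative_compose[OF assms(1)[unfolded frechet_derivative_works]
      assms(2)[unfolded has_field_derivative_def]] by simp
  then show ?thesis by (subst partial_eqI) (auto simp: partial_def)
qed

lemma partial_inverse:
  assumes "f differentiable (at x)" "f x \<noteq> 0"
  shows "partial i (\<lambda>x. inverse (f x)) x = - (partial i f x * (inverse (f x) * inverse (f x)))"
  using partial_compose[OF assms(1) DERIV_inverse[OF assms(2)]]
  by (simp add: power2_eq_square)

lemma Ck_const: "Ck k (\<lambda>x. c)"
  by (induction k arbitrary: c) (auto simp: partial_const)

lemma Ck_add: "Ck k f \<Longrightarrow> Ck k g \<Longrightarrow> Ck k (\<lambda>x. f x + g x)"
proof (induction k arbitrary: f g)
  case 0
  then show ?case by (auto intro: continuous_intros)
next
  case (Suc k)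
  have "partial i (\<lambda>x. f x + g x) = (\<lambda>x. partial i f x + partial i g x)" for i
    using Suc.prems by (auto simp: partial_add)
  with Suc show ?case by (auto intro: derivative_intros)
qed

lemma Ck_mult: "Ck k f \<Longrightarrow> Ck k g \<Longrightarrow> Ck k (\<lambda>x. f x * g x)"
proof (induction k arbitrary: f g)
  case 0
  then show ?case by (auto intro: continuous_intros)
next
  case (Suc k)
  have "partial i (\<lambda>x. f x * g x) = (\<lambda>x. partial i f x * g x + f x * partial i g x)" for i
    using Suc.prems by (auto simp: partial_mult)
  moreover have "Ck k f" "Ck k g" using Suc.prems Ck_Suc_D by auto
  ultimately show ?case using Suc by (auto intro!: derivative_intros Ck_add)
qed

lemma Ck_inverse: "Ck k f \<Longrightarrow> (\<And>x. f x \<noteq> 0) \<Longrightarrow> Ck k (\<lambda>x. inverse (f x))"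
proof (induction k arbitrary: f)
  case 0
  then show ?case by (auto intro: continuous_intros)
next
  case (Suc k)
  have "partial i (\<lambda>x. inverse (f x)) = (\<lambda>x. (-1) * (partial i f x * (inverse (f x) * inverse (f x))))" for i
    using Suc.prems by (auto simp: partial_inverse)
  then have "Ck k (partial i (\<lambda>x. inverse (f x)))" for i
    using Suc Ck_Suc_D[OF Suc.prems(1)] by (simp only:) (intro Ck_mult Ck_const; simp)
  then show ?case using Suc by (auto intro!: derivative_intros)
qed

lemma smooth_const [intro!]: "smooth (\<lambda>x. c)"
  and smooth_add [intro!]: "smooth f \<Longrightarrow> smooth g \<Longrightarrow> smooth (\<lambda>x. f x + g x)"
  and smooth_mult [intro!]: "smooth f \<Longrightarrow> smooth g \<Longrightarrow> smooth (\<lambda>x. f x * g x)"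
  and smooth_inverse: "smooth f \<Longrightarrow> (\<And>x. f x \<noteq> 0) \<Longrightarrow> smooth (\<lambda>x. inverse (f x))"
  by (auto simp: smooth_def Ck_const Ck_add Ck_mult Ck_inverse)

lemma smooth_sum [intro!]: "(\<And>i. i \<in> I \<Longrightarrow> smooth (f i)) \<Longrightarrow> smooth (\<lambda>x. \<Sum>i\<in>I. f i x)"
  by (induction I rule: infinite_finite_induct) auto

lemma smooth_prod: "(\<And>i. i \<in> I \<Longrightarrow> smooth (f i)) \<Longrightarrow> smooth (\<lambda>x. \<Prod>i\<in>I. f i x)"
  by (induction I rule: infinite_finite_induct) auto

lemma partial_minus: "f differentiable (at x) \<Longrightarrow> partial i (\<lambda>x. - f x) x = - partial i f x"
  using partial_mult[of "\<lambda>x. -1" x f] by (simp add: partial_const)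

lemma partial_diff:
  "f differentiable (at x) \<Longrightarrow> g differentiable (at x) \<Longrightarrow>
     partial i (\<lambda>x. f x - g x) x = partial i f x - partial i g x"
  using partial_add[of f x "\<lambda>x. - g x"] by (simp add: partial_minus)

lemma partial_sum:
  "(\<And>j. j \<in> I \<Longrightarrow> f j differentiable (at x)) \<Longrightarrow>
     partial i (\<lambda>x. \<Sum>j\<in>I. f j x) x = (\<Sum>j\<in>I. partial i (f j) x)"
  by (induction I rule: infinite_finite_induct) (auto simp: partial_const partial_add)

text \<open>Applied with c = 1 and c = -1, to the translates and reflections of a mollifier.\<close>

lemma partial_affine:
  fixes f :: "real^3 \<Rightarrow> real"
  assumes "f differentiable (at (c *\<^sub>R x + a))"
  shows "partial i (\<lambda>x. f (c *\<^sub>R x + a)) x = c * partial i f (c *\<^sub>R x + a)"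
proof -
  let ?D = "frechet_derivative f (at (c *\<^sub>R x + a))"
  have D: "(f has_derivative ?D) (at (c *\<^sub>R x + a))"
    using assms by (simp add: frechet_derivative_works)
  have "((\<lambda>x. f (c *\<^sub>R x + a)) has_derivative (\<lambda>v. ?D (c *\<^sub>R v))) (at x)"
    by (rule has_derivative_compose[where f = "\<lambda>x. c *\<^sub>R x + a", OF _ D])
       (auto intro!: derivative_eq_intros)
  then show ?thesis
    using linear_cmul[OF has_derivative_linear[OF D]] by (subst partial_eqI) (auto simp: partial_def)
qed

lemma differentiable_affine:
  fixes f :: "real^3 \<Rightarrow> real"
  assumes "\<And>x. f differentiable (at x)"
  shows "(\<lambda>x. f (c *\<^sub>R x + a)) differentiable (at x)"
proof -
  have "f \<circ> (\<lambda>x. c *\<^sub>R x + a) differentiable (at x)"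
    by (rule differentiable_chain_at) (auto intro!: derivative_intros assms)
  then show ?thesis by (simp add: o_def)
qed

lemma smooth_affine:
  assumes "smooth f" shows "smooth (\<lambda>x. f (c *\<^sub>R x + a))"
proof -
  have "Ck k f \<Longrightarrow> Ck k (\<lambda>x. f (c *\<^sub>R x + a))" for k
  proof (induction k arbitrary: f)
    case 0
    then show ?case by (auto intro!: continuous_intros continuous_on_compose2[of UNIV f])
  next
    case (Suc k)
    have "partial i (\<lambda>x. f (c *\<^sub>R x + a)) = (\<lambda>x. c * partial i f (c *\<^sub>R x + a))" for i
      using Suc.prems by (auto simp: partial_affine)
    then show ?case using Suc by (auto intro!: Ck_mult Ck_const differentiable_affine)
  qed
  with assms show ?thesis by (simp add: smooth_def)
qed

section \<open>Test functions: closure properties, bounds and integrals\<close>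

lemma test_fun_iff:
  "\<phi> \<in> test_fun \<Omega> \<longleftrightarrow> smooth \<phi> \<and> (\<exists>K. compact K \<and> K \<subseteq> \<Omega> \<and> (\<forall>x. x \<notin> K \<longrightarrow> \<phi> x = 0))"
proof
  assume "\<phi> \<in> test_fun \<Omega>"
  then show "smooth \<phi> \<and> (\<exists>K. compact K \<and> K \<subseteq> \<Omega> \<and> (\<forall>x. x \<notin> K \<longrightarrow> \<phi> x = 0))"
    unfolding test_fun_def smooth_def
    using closure_subset[of "{x. \<phi> x \<noteq> 0}"]
    by (intro conjI exI[of _ "closure {x. \<phi> x \<noteq> 0}"]) blast+
next
  assume "smooth \<phi> \<and> (\<exists>K. compact K \<and> K \<subseteq> \<Omega> \<and> (\<forall>x. x \<notin> K \<longrightarrow> \<phi> x = 0))"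
  then obtain K where K: "smooth \<phi>" "compact K" "K \<subseteq> \<Omega>" "\<And>x. x \<notin> K \<Longrightarrow> \<phi> x = 0" by blast
  then have "closure {x. \<phi> x \<noteq> 0} \<subseteq> K"
    by (intro closure_minimal compact_imp_closed) auto
  with K show "\<phi> \<in> test_fun \<Omega>"
    unfolding test_fun_def smooth_def
    using compact_closure[of "{x. \<phi> x \<noteq> 0}"] bounded_subset[OF compact_imp_bounded[OF K(2)]]
      closure_subset[of "{x. \<phi> x \<noteq> 0}"] by blast
qed

lemma test_funI: "smooth \<phi> \<Longrightarrow> compact K \<Longrightarrow> K \<subseteq> \<Omega> \<Longrightarrow> (\<And>x. x \<notin> K \<Longrightarrow> \<phi> x = 0) \<Longrightarrow> \<phi> \<in> test_fun \<Omega>"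
  unfolding test_fun_iff by blast

lemma test_fun_smooth: "\<phi> \<in> test_fun \<Omega> \<Longrightarrow> smooth \<phi>"
  unfolding test_fun_iff by blast

lemma test_fun_mult: "\<phi> \<in> test_fun \<Omega> \<Longrightarrow> smooth \<psi> \<Longrightarrow> (\<lambda>x. \<psi> x * \<phi> x) \<in> test_fun \<Omega>"
  unfolding test_fun_iff by (metis mult_zero_right smooth_mult)

lemma test_fun_mono: "\<Omega> \<subseteq> \<Omega>' \<Longrightarrow> \<phi> \<in> test_fun \<Omega> \<Longrightarrow> \<phi> \<in> test_fun \<Omega>'"
  unfolding test_fun_iff by blast

lemma test_fun_add:
  assumes "\<phi> \<in> test_fun \<Omega>" "\<psi> \<in> test_fun \<Omega>" shows "(\<lambda>x. \<phi> x + \<psi> x) \<in> test_fun \<Omega>"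
proof -
  obtain K where "smooth \<phi>" "compact K" "K \<subseteq> \<Omega>" "\<And>x. x \<notin> K \<Longrightarrow> \<phi> x = 0"
    using assms(1) unfolding test_fun_iff by blast
  moreover obtain L where "smooth \<psi>" "compact L" "L \<subseteq> \<Omega>" "\<And>x. x \<notin> L \<Longrightarrow> \<psi> x = 0"
    using assms(2) unfolding test_fun_iff by blast
  ultimately show ?thesis by (intro test_funI[of _ "K \<union> L"]) auto
qed

lemma test_fun_zero: "(\<lambda>x. 0) \<in> test_fun \<Omega>"
  by (rule test_funI[of _ "{}"]) auto

lemma test_fun_sum: "(\<And>i. i \<in> I \<Longrightarrow> f i \<in> test_fun \<Omega>) \<Longrightarrow> (\<lambda>x. \<Sum>i\<in>I. f i x) \<in> test_fun \<Omega>"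
  by (induction I rule: infinite_finite_induct) (auto intro: test_fun_add test_fun_zero)

lemma partial_outside:
  assumes "closed K" "\<And>x. x \<notin> K \<Longrightarrow> \<phi> x = 0" "x \<notin> K"
  shows "partial i \<phi> x = 0"
proof -
  have "((\<lambda>x. 0) has_derivative (\<lambda>v. 0)) (at x)" by (rule has_derivative_const)
  then have "(\<phi> has_derivative (\<lambda>v. 0)) (at x)"
    by (rule has_derivative_transform_within_open[where s = "- K" and f = "\<lambda>x. 0"]) (use assms in auto)
  then show ?thesis by (subst partial_eqI) auto
qed

lemma test_fun_partial: "\<phi> \<in> test_fun \<Omega> \<Longrightarrow> partial i \<phi> \<in> test_fun \<Omega>"
  unfolding test_fun_iff using smooth_partial partial_outside compact_imp_closed by metis

lemma test_fun_bounded: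
  assumes "\<phi> \<in> test_fun \<Omega>" obtains C where "C \<ge> 0" "\<And>x. \<bar>\<phi> x\<bar> \<le> C"
proof -
  obtain K where K: "smooth \<phi>" "compact K" "\<And>x. x \<notin> K \<Longrightarrow> \<phi> x = 0"
    using assms unfolding test_fun_iff by blast
  have "bounded (\<phi> ` K)"
    by (intro compact_imp_bounded compact_continuous_image smooth_continuous K)
  then obtain C where "\<And>x. x \<in> K \<Longrightarrow> \<bar>\<phi> x\<bar> \<le> C" unfolding bounded_iff by auto
  with K have "\<bar>\<phi> x\<bar> \<le> max C 0" for x by (cases "x \<in> K") (auto simp: le_max_iff_disj)
  then show ?thesis using that[of "max C 0"] by auto
qed

lemma test_fun_integrable:
  assumes "\<phi> \<in> test_fun \<Omega>" shows "integrable lborel \<phi>"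
proof -
  obtain K where K: "smooth \<phi>" "compact K" "\<And>x. x \<notin> K \<Longrightarrow> \<phi> x = 0"
    using assms unfolding test_fun_iff by blast
  have "integrable lborel (\<lambda>x. indicator K x *\<^sub>R \<phi> x)"
    by (rule borel_integrable_compact) (auto intro: K smooth_continuous)
  moreover have "(\<lambda>x. indicator K x *\<^sub>R \<phi> x) = \<phi>"
    using K(3) by (auto simp: indicator_def fun_eq_iff)
  ultimately show ?thesis by simp
qed

lemma smooth_line_derivative:
  assumes "smooth \<phi>"
  shows "((\<lambda>r. \<phi> (x + r *\<^sub>R axis i 1)) has_real_derivative partial i \<phi> (x + r *\<^sub>R axis i 1)) (at r)"
proof -
  let ?D = "frechet_derivative \<phi> (at (x + r *\<^sub>R axis i 1))"
  have D: "(\<phi> has_derivative ?D) (at (x + r *\<^sub>R axis i 1))"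
    using assms by (rule smooth_has_derivative)
  have "((\<lambda>r. \<phi> (x + r *\<^sub>R axis i 1)) has_derivative (\<lambda>s. ?D (s *\<^sub>R axis i 1))) (at r)"
    by (rule has_derivative_compose[where f = "\<lambda>r. x + r *\<^sub>R axis i 1", OF _ D])
       (auto intro!: derivative_eq_intros)
  moreover have "(\<lambda>s. ?D (s *\<^sub>R axis i 1)) = (*) (partial i \<phi> (x + r *\<^sub>R axis i 1))"
    using linear_cmul[OF has_derivative_linear[OF D]] by (auto simp: partial_def)
  ultimately show ?thesis by (simp add: has_field_derivative_def)
qed

lemma integral_translate:
  fixes f :: "real^3 \<Rightarrow> real"
  assumes [measurable]: "f \<in> borel_measurable borel"
  shows "(LINT x|lborel. f (a + x)) = (LINT x|lborel. f x)"
proof -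
  have "(LINT x|lborel. f x) = (LINT x|distr lborel borel ((+) a). f x)"
    by (simp add: lborel_distr_plus)
  also have "\<dots> = (LINT x|lborel. f (a + x))" by (subst integral_distr) auto
  finally show ?thesis by simp
qed

lemma integrable_translate:
  fixes f :: "real^3 \<Rightarrow> real"
  assumes f: "integrable lborel f"
  shows "integrable lborel (\<lambda>x. f (a + x))"
proof -
  have "integrable (distr lborel borel ((+) a)) f" using f by (simp add: lborel_distr_plus)
  then show ?thesis by (rule integrable_distr[rotated]) auto
qed

text \<open>By translation invariance every difference quotient in direction i has integral zero,
  and the quotients converge to the partial derivative under a common integrable bound. This takes
  the place of iterated one-dimensional integration.\<close>

lemma integral_partial_test_fun:
  assumes "\<phi> \<in> test_fun \<Omega>"
  shows "(LINT x|lborel. partial i \<phi> x) = 0"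
proof -
  obtain K where K: "smooth \<phi>" "compact K" "\<And>x. x \<notin> K \<Longrightarrow> \<phi> x = 0"
    using assms unfolding test_fun_iff by blast
  obtain R where R: "\<And>x. x \<in> K \<Longrightarrow> norm x \<le> R"
    using compact_imp_bounded[OF K(2)] unfolding bounded_iff by blast
  obtain C where C: "C \<ge> 0" "\<And>x. \<bar>partial i \<phi> x\<bar> \<le> C"
    using test_fun_bounded[OF test_fun_partial[OF assms]] by blast
  define e :: "real^3" where "e = axis i 1"
  have e: "norm e = 1" by (simp add: e_def)
  define t :: "nat \<Rightarrow> real" where "t n = inverse (real (Suc n))" for n
  have t: "0 < t n" "t n \<le> 1" for n by (auto simp: t_def field_simps)
  have t0: "t \<longlonglongrightarrow> 0" unfolding t_def by (rule LIMSEQ_inverse_real_of_nat)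
  define s where "s n x = (\<phi> (x + t n *\<^sub>R e) - \<phi> x) / t n" for n x
  note [measurable] = smooth_borel[OF K(1)] smooth_borel[OF smooth_partial[OF K(1)]]
  have sm: "s n \<in> borel_measurable lborel" for n unfolding s_def[abs_def] by measurable
  have s0: "(LINT x|lborel. s n x) = 0" for n
  proof -
    have "integrable lborel \<phi>" using assms by (rule test_fun_integrable)
    moreover from this have "integrable lborel (\<lambda>x. \<phi> (t n *\<^sub>R e + x))" by (rule integrable_translate)
    ultimately have "(LINT x|lborel. s n x)
        = ((LINT x|lborel. \<phi> (t n *\<^sub>R e + x)) - (LINT x|lborel. \<phi> x)) / t n"
      unfolding s_def by (simp add: add.commute)
    then show ?thesis by (simp add: integral_translate)
  qed
  have lim: "(\<lambda>n. s n x) \<longlonglongrightarrow> partial i \<phi> x" for x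
  proof -
    have "((\<lambda>h. (\<phi> (x + (0 + h) *\<^sub>R e) - \<phi> (x + 0 *\<^sub>R e)) / h) \<longlongrightarrow> partial i \<phi> x) (at 0)"
      using smooth_line_derivative[OF K(1), of x i 0] by (simp add: DERIV_def e_def)
    moreover have "filterlim t (at 0) sequentially"
      unfolding filterlim_at using t0 t by (auto intro!: always_eventually simp: less_imp_neq[symmetric])
    ultimately show ?thesis unfolding s_def using filterlim_compose by force
  qed
  \<comment> \<open>Inside the larger ball the mean value theorem turns the quotient into a
    derivative at an intermediate point. Outside it both sample points miss K, because the step
    \<open>t n\<close> is at most 1.\<close>
  have bd: "norm (s n x) \<le> C * indicator (cball 0 (R + 1)) x" for n x
  proof (cases "x \<in> cball 0 (R + 1)")
    case True
    have "\<exists>z. 0 < z \<and> z < t n \<and> \<phi> (x + t n *\<^sub>R e) - \<phi> (x + 0 *\<^sub>R e)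
        = (t n - 0) * partial i \<phi> (x + z *\<^sub>R e)"
      unfolding e_def by (rule MVT2[OF t(1)]) (rule smooth_line_derivative[OF K(1)])
    then obtain z where "\<phi> (x + t n *\<^sub>R e) - \<phi> x = t n * partial i \<phi> (x + z *\<^sub>R e)" by auto
    then have "s n x = partial i \<phi> (x + z *\<^sub>R e)" unfolding s_def using t(1)[of n] by simp
    then show ?thesis using C True by simp
  next
    case False
    then have nx: "norm x > R + 1" by simp
    then have "x \<notin> K" using R[of x] by auto
    moreover have "x + t n *\<^sub>R e \<notin> K"
    proof
      assume "x + t n *\<^sub>R e \<in> K"
      from R[OF this] have "norm (x + t n *\<^sub>R e) \<le> R" .
      moreover have "norm x - norm (t n *\<^sub>R e) \<le> norm (x + t n *\<^sub>R e)"
        by (metis norm_diff_ineq)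
      ultimately show False using nx t[of n] e by simp
    qed
    ultimately show ?thesis using K(3) False by (simp add: s_def)
  qed
  have "(\<lambda>n. LINT x|lborel. s n x) \<longlonglongrightarrow> (LINT x|lborel. partial i \<phi> x)"
  proof (rule integral_dominated_convergence)
    show "integrable lborel (\<lambda>x :: real^3. C * indicator (cball 0 (R + 1)) x)"
      using emeasure_lborel_cball_finite[of "0::real^3" "R + 1"]
      by (intro integrable_mult_right integrable_real_indicator) simp_all
  qed (use sm lim bd in auto)
  then show ?thesis by (simp add: s0 LIMSEQ_const_iff)
qed

section \<open>Bump functions\<close>

text \<open>The classical exp (-1/t), divided by a power of t and extended by 0. The index m makes
  the family closed under differentiation up to linear combinations, so that smoothness becomes an
  induction on the order with m generalised.\<close>

definition flat :: "nat \<Rightarrow> real \<Rightarrow> real" where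
  "flat m t = (if t > 0 then exp (- inverse t) * inverse t ^ m else 0)"

text \<open>For t > 0 the bound is a single term of the exponential series at 1/t, the one of degree
  m + 2. Quadratic smallness is what makes the derivative at 0 exist and vanish.\<close>

lemma flat_le:
  "\<bar>flat m t\<bar> \<le> fact (m + 2) * t\<^sup>2"
proof (cases "t > 0")
  case True
  define y where "y = inverse t"
  have y: "y > 0" using True by (simp add: y_def)
  have "y ^ (m + 2) / fact (m + 2) \<le> exp y"
  proof -
    have "(\<Sum>k\<in>{m+2}. y ^ k /\<^sub>R fact k) \<le> (\<Sum>k. y ^ k /\<^sub>R fact k)"
      by (rule sum_le_suminf) (use y summable_exp_generic[of y] in auto)
    then show ?thesis by (simp add: exp_def divide_inverse mult.commute)
  qed
  then have "exp (- y) * y ^ (m + 2) \<le> fact (m + 2)"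
    by (simp add: exp_minus divide_simps mult.commute del: fact_Suc power_Suc add_2_eq_Suc')
  then have "exp (- y) * y ^ (m + 2) * t\<^sup>2 \<le> fact (m + 2) * t\<^sup>2"
    by (rule mult_right_mono) simp
  moreover have "exp (- y) * y ^ (m + 2) * t\<^sup>2 = flat m t"
  proof -
    have "y ^ (m + 2) * t\<^sup>2 = y ^ m * (y * t)\<^sup>2" by (simp add: power_add power2_eq_square)
    then show ?thesis using True by (simp add: flat_def y_def mult.assoc)
  qed
  moreover have "flat m t \<ge> 0" by (simp add: flat_def)
  ultimately show ?thesis by simp
next
  case False
  then show ?thesis by (simp add: flat_def)
qed

lemma flat_derivative:
  "(flat m has_real_derivative flat (m + 2) t - m * flat (m + 1) t) (at t)"
proof -
  consider "t > 0" | "t < 0" | "t = 0" by linarith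
  then show ?thesis
  proof cases
    case 1
    have "((\<lambda>t. exp (- inverse t) * inverse t ^ m) has_real_derivative
        flat (m + 2) t - m * flat (m + 1) t) (at t)"
      using 1 by (auto intro!: derivative_eq_intros simp: flat_def power2_eq_square algebra_simps)
         (cases m; simp add: algebra_simps)
    then show ?thesis
      by (rule has_field_derivative_transform_within_open[where S = "{0<..}"]) (use 1 in \<open>auto simp: flat_def\<close>)
  next
    case 2
    have "((\<lambda>t. 0) has_real_derivative flat (m + 2) t - m * flat (m + 1) t) (at t)"
      using 2 by (auto simp: flat_def)
    then show ?thesis
      by (rule has_field_derivative_transform_within_open[where S = "{..<0}"]) (use 2 in \<open>auto simp: flat_def\<close>)
  next
    case 3
    have "((\<lambda>h. flat m h / h) \<longlongrightarrow> 0) (at 0)"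
    proof (rule Lim_null_comparison)
      show "\<forall>\<^sub>F h in at 0. norm (flat m h / h) \<le> fact (m + 2) * \<bar>h\<bar>"
        unfolding eventually_at_filter
      proof (intro always_eventually allI impI)
        fix h :: real assume "h \<noteq> 0"
        moreover have "\<bar>flat m h\<bar> \<le> fact (m + 2) * \<bar>h\<bar> * \<bar>h\<bar>"
          using flat_le[of m h] by (simp add: power2_eq_square mult.assoc del: fact_Suc add_2_eq_Suc')
        ultimately show "norm (flat m h / h) \<le> fact (m + 2) * \<bar>h\<bar>"
          by (simp add: pos_divide_le_eq del: fact_Suc add_2_eq_Suc')
      qed
      show "((\<lambda>h. fact (m + 2) * \<bar>h\<bar>) \<longlongrightarrow> 0) (at (0::real))"
        by (rule tendsto_mult_right_zero) (auto intro!: tendsto_eq_intros)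
    qed
    then show ?thesis using 3 by (simp add: DERIV_def flat_def[of _ 0])
  qed
qed

lemma smooth_flat: "smooth (\<lambda>x. flat m (c * x $ j + d))"
proof -
  have *: "((\<lambda>x. flat m (c * x $ j + d)) has_derivative
      (\<lambda>v. (flat (m + 2) (c * x $ j + d) - m * flat (m + 1) (c * x $ j + d)) * (c * v $ j))) (at x)"
    for m and x :: "real^3"
    by (rule has_derivative_compose[where f = "\<lambda>x. c * x $ j + d", OF _
          flat_derivative[unfolded has_field_derivative_def]])
       (auto intro!: derivative_eq_intros bounded_linear_imp_has_derivative bounded_linear_vec_nth)
  have "partial i (\<lambda>x. flat m (c * x $ j + d)) =
      (\<lambda>x. (flat (m + 2) (c * x $ j + d) + (- real m) * flat (m + 1) (c * x $ j + d)) * (c * axis i 1 $ j))"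
    for m i
    by (rule ext, subst partial_eqI[OF *]) simp
  moreover have "(\<lambda>x. flat m (c * x $ j + d)) differentiable (at x)" for m and x :: "real^3"
    using * differentiable_def by blast
  ultimately have "Ck k (\<lambda>x. flat m (c * x $ j + d))" for k
  proof (induction k arbitrary: m)
    case 0
    then show ?case
      by (simp add: continuous_on_eq_continuous_at differentiable_imp_continuous_within)
  next
    case (Suc k)
    show ?case unfolding Ck.simps Suc.prems(1)
      using Suc by (intro conjI allI Ck_mult Ck_add Ck_const) auto
  qed
  then show ?thesis by (simp add: smooth_def)
qed

text \<open>The number n steepens the profile: \<open>flat 0 (n * s)\<close> tends to 1 for s > 0,
  so these bumps approximate the indicator of the box while staying between 0 and 1.\<close>

definition box_bump :: "nat \<Rightarrow> real^3 \<Rightarrow> real^3 \<Rightarrow> real^3 \<Rightarrow> real" where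
  "box_bump n a b x = (\<Prod>j\<in>UNIV. flat 0 (real n * x $ j + - real n * a $ j) * flat 0 (- real n * x $ j + real n * b $ j))"

lemma smooth_box_bump: "smooth (box_bump n a b)"
  unfolding box_bump_def[abs_def] by (intro smooth_prod smooth_mult smooth_flat)

lemma flat0_bounds: "0 \<le> flat 0 t" "flat 0 t \<le> 1"
  by (auto simp: flat_def)

lemma box_bump_bounds: "0 \<le> box_bump n a b x" "box_bump n a b x \<le> 1"
  unfolding box_bump_def
  by (auto intro!: prod_nonneg prod_le_1 mult_nonneg_nonneg mult_le_one flat0_bounds)

lemma box_bump_pos: "n > 0 \<Longrightarrow> x \<in> box a b \<Longrightarrow> box_bump n a b x > 0"
  unfolding box_bump_def
  by (intro prod_pos) (auto simp: flat_def mem_box_cart algebra_simps intro!: mult_pos_pos)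

lemma box_bump_outside: "x \<notin> box a b \<Longrightarrow> box_bump n a b x = 0"
proof -
  assume "x \<notin> box a b"
  then obtain j where j: "\<not> a $ j < x $ j \<or> \<not> x $ j < b $ j" by (auto simp: mem_box_cart)
  have "flat 0 (real n * x $ j + - real n * a $ j) * flat 0 (- real n * x $ j + real n * b $ j) = 0"
    using j mult_left_mono[of "x $ j" "a $ j" "real n"] mult_left_mono[of "b $ j" "x $ j" "real n"]
    by (auto simp: flat_def not_less)
  then show ?thesis unfolding box_bump_def by (intro prod_zero) auto
qed

lemma box_bump_test_fun: "cbox a b \<subseteq> \<Omega> \<Longrightarrow> box_bump n a b \<in> test_fun \<Omega>"
  by (rule test_funI[OF smooth_box_bump compact_cbox])
     (auto intro!: box_bump_outside dest: subsetD[OF box_subset_cbox])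

lemma box_bump_tendsto: "(\<lambda>n. box_bump n a b x) \<longlonglongrightarrow> indicator (box a b) x"
proof (cases "x \<in> box a b")
  case True
  have f: "(\<lambda>n. flat 0 (real n * c)) \<longlonglongrightarrow> 1" if "c > 0" for c
  proof -
    have "(\<lambda>n. exp (- (inverse (real n) * inverse c))) \<longlonglongrightarrow> exp (- (0 * inverse c))"
      by (intro tendsto_intros tendsto_inverse_0_at_top filterlim_real_sequentially)
    then have "(\<lambda>n. exp (- (inverse (real n) * inverse c))) \<longlonglongrightarrow> 1" by simp
    then show ?thesis
    proof (rule Lim_transform_eventually)
      show "\<forall>\<^sub>F n in sequentially. exp (- (inverse (real n) * inverse c)) = flat 0 (real n * c)"
        using eventually_gt_at_top[of 0] by eventually_elim (use that in \<open>simp add: flat_def\<close>)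
    qed
  qed
  have "(\<lambda>n. \<Prod>j\<in>UNIV. flat 0 (real n * (x $ j - a $ j)) * flat 0 (real n * (b $ j - x $ j)))
      \<longlonglongrightarrow> (\<Prod>j\<in>(UNIV :: 3 set). 1 * 1)"
    by (intro tendsto_prod tendsto_mult f) (use True in \<open>auto simp: mem_box_cart\<close>)
  then show ?thesis using True by (simp add: box_bump_def[abs_def] algebra_simps)
qed (simp add: box_bump_outside)

section \<open>The fundamental lemma of the calculus of variations\<close>

text \<open>A Dynkin argument: open boxes are stable under intersection and generate the Borel sets,
  and vanishing of the integral passes to complements and to countable disjoint unions. A density
  with zero integral over every measurable set is zero.\<close>

lemma AE_zero_if_box_integrals_zero:
  fixes F :: "'a::euclidean_space \<Rightarrow> real"
  assumes F: "integrable lborel F" and box0: "\<And>a b. (LINT x|lborel. indicator (box a b) x * F x) = 0"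
  shows "AE x in lborel. F x = 0"
proof (rule sigma_finite_measure.density_zero[OF sigma_finite_lborel F])
  fix A :: "'a set" assume "A \<in> sets lborel"
  then have A: "A \<in> sigma_sets UNIV (range (\<lambda>(a, b). box a b))"
    by (simp add: borel_eq_box)
  have [measurable]: "F \<in> borel_measurable borel" using F by auto
  have int: "integrable lborel (\<lambda>x. indicator B x * F x)" if "B \<in> sets borel" for B :: "'a set"
    using that F integrable_real_mult_indicator[of B lborel F] by (simp add: mult.commute)
  \<comment> \<open>The complement step needs the integral over the whole space, which is not a box
    and is reached by exhausting it with growing cubes.\<close>
  have UNIV0: "(LINT x|lborel. F x) = 0"
  proof -
    have "(\<lambda>n. LINT x|lborel. indicator (box (- (real n *\<^sub>R One)) (real n *\<^sub>R One)) x * F x)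
        \<longlonglongrightarrow> (LINT x|lborel. F x)"
    proof (rule integral_dominated_convergence)
      show "integrable lborel (\<lambda>x. norm (F x))" using F by simp
      show "AE x in lborel. (\<lambda>n. indicator (box (- (real n *\<^sub>R One)) (real n *\<^sub>R One)) x * F x) \<longlonglongrightarrow> F x"
      proof (rule AE_I2)
        fix x :: 'a
        obtain N :: nat where N: "norm x < real N" using reals_Archimedean2 by blast
        have "\<forall>\<^sub>F n in sequentially. indicator (box (- (real n *\<^sub>R One)) (real n *\<^sub>R One)) x * F x = F x"
          using eventually_ge_at_top[of N]
        proof eventually_elim
          case (elim n)
          have "\<bar>x \<bullet> i\<bar> < real n" if "i \<in> Basis" for i
            using Basis_le_norm[OF that, of x] N elim by linarith
          then have "x \<in> box (- (real n *\<^sub>R One)) (real n *\<^sub>R One)"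
            by (auto simp: mem_box abs_less_iff minus_less_iff)
          then show ?case by simp
        qed
        then show "(\<lambda>n. indicator (box (- (real n *\<^sub>R One)) (real n *\<^sub>R One)) x * F x) \<longlonglongrightarrow> F x"
          by (rule tendsto_eventually)
      qed
    qed (auto simp: indicator_def)
    then show ?thesis by (simp add: box0 LIMSEQ_const_iff)
  qed
  have "Int_stable (range (\<lambda>(a, b). box a b :: 'a set))"
    unfolding Int_stable_def
  proof safe
    fix a b c d :: 'a
    show "box a b \<inter> box c d \<in> range (\<lambda>(a, b). box a b)"
      unfolding box_Int_box by (rule range_eqI[where x = "(_, _)"]) simp
  qed
  moreover have "range (\<lambda>(a, b). box a b) \<subseteq> Pow (UNIV :: 'a set)" by simp
  ultimately have "(LINT x|lborel. indicator A x * F x) = 0"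
    using A
  proof (induction rule: sigma_sets_induct_disjoint[consumes 3])
    case (compl B)
    then have [measurable]: "B \<in> sets borel" by (simp add: borel_eq_box)
    have "(\<lambda>x. indicator (UNIV - B) x * F x) = (\<lambda>x. F x - indicator B x * F x)"
      by (auto simp: indicator_def)
    then show ?case using compl F int[of B] UNIV0 by simp
  next
    case (union B)
    then have [measurable]: "B n \<in> sets borel" for n by (auto simp: borel_eq_box)
    have "(\<lambda>n. LINT x|lborel. indicator (\<Union>i<n. B i) x * F x)
        \<longlonglongrightarrow> (LINT x|lborel. indicator (\<Union>i. B i) x * F x)"
    proof (rule integral_dominated_convergence)
      show "integrable lborel (\<lambda>x. norm (F x))" using F by simp
      show "AE x in lborel. (\<lambda>n. indicator (\<Union>i<n. B i) x * F x) \<longlonglongrightarrow> indicator (\<Union>i. B i) x * F x"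
        by (intro AE_I2 tendsto_mult tendsto_const LIMSEQ_indicator_UN)
    qed (auto simp: indicator_def)
    moreover have "(LINT x|lborel. indicator (\<Union>i<n. B i) x * F x) = 0" for n
    proof -
      have "(\<lambda>x. indicator (\<Union>i<n. B i) x * F x) = (\<lambda>x. \<Sum>i<n. indicator (B i) x * F x)"
      proof
        fix x
        have "indicator (\<Union>i<n. B i) x = (\<Sum>i<n. indicator (B i) x :: real)"
          using union(1) by (intro indicator_UN_disjoint) (auto simp: disjoint_family_on_def)
        then show "indicator (\<Union>i<n. B i) x * F x = (\<Sum>i<n. indicator (B i) x * F x)"
          by (simp add: sum_distrib_right)
      qed
      then have "(LINT x|lborel. indicator (\<Union>i<n. B i) x * F x) = (LINT x|lborel. (\<Sum>i<n. indicator (B i) x * F x))"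
        by (rule arg_cong)
      also have "\<dots> = 0" using int union(3) by (subst Bochner_Integration.integral_sum) auto
      finally show ?thesis .
    qed
    ultimately show ?case by (simp add: LIMSEQ_const_iff)
  qed (use box0 in auto)
  then show "set_lebesgue_integral lborel A F = 0"
    by (simp add: set_lebesgue_integral_def)
qed

text \<open>Bumps turn test functions into indicators of boxes whose closure lies in \<Omega>.
  Restricting F to one such box reduces the claim to the preceding lemma, and countably many boxes
  cover \<Omega>.\<close>

lemma AE_zero_if_test_integrals_zero:
  fixes F :: "real^3 \<Rightarrow> real"
  assumes F: "integrable lborel F" and \<Omega>: "open \<Omega>"
    and test0: "\<And>\<phi>. \<phi> \<in> test_fun \<Omega> \<Longrightarrow> (LINT x|lborel. F x * \<phi> x) = 0"
  shows "AE x in lborel. x \<in> \<Omega> \<longrightarrow> F x = 0"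
proof -
  have box0: "(LINT x|lborel. indicator (box a b) x * F x) = 0" if "cbox a b \<subseteq> \<Omega>" for a b
  proof -
    have [measurable]: "F \<in> borel_measurable borel" using F by auto
    note [measurable] = smooth_borel[OF smooth_box_bump]
    have "(\<lambda>n. LINT x|lborel. F x * box_bump n a b x) \<longlonglongrightarrow> (LINT x|lborel. F x * indicator (box a b) x)"
    proof (rule integral_dominated_convergence)
      show "integrable lborel (\<lambda>x. norm (F x))" using F by simp
      show "AE x in lborel. norm (F x * box_bump n a b x) \<le> norm (F x)" for n
        using box_bump_bounds[of n a b] by (auto simp: abs_mult intro!: mult_left_le)
    qed (auto intro!: tendsto_mult tendsto_const box_bump_tendsto)
    then show ?thesis
      using test0[OF box_bump_test_fun[OF that]] by (simp add: LIMSEQ_const_iff mult.commute)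
  qed
  have loc: "AE x in lborel. x \<in> box a b \<longrightarrow> F x = 0" if "cbox a b \<subseteq> \<Omega>" for a b
  proof -
    have "AE x in lborel. indicator (box a b) x * F x = 0"
    proof (rule AE_zero_if_box_integrals_zero)
      show "integrable lborel (\<lambda>x. indicator (box a b) x * F x)"
        using F integrable_real_mult_indicator[of "box a b" lborel F] by (simp add: mult.commute)
      fix c d :: "real^3"
      \<comment> \<open>An arbitrary box need not lie in \<Omega>, but its intersection with the
        fixed one is a box again, and if nonempty its closure stays inside \<open>cbox a b\<close>,
        so that \<open>box0\<close> applies.\<close>
      obtain a' b' where ab: "box c d \<inter> box a b = box a' b'" using box_Int_box by blast
      have "(\<lambda>x. indicator (box c d) x * (indicator (box a b) x * F x)) = (\<lambda>x. indicator (box a' b') x * F x)"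
        unfolding ab[symmetric] by (auto simp: indicator_def)
      moreover have "(LINT x|lborel. indicator (box a' b') x * F x) = 0"
      proof (cases "box a' b' = {}")
        case False
        have "cbox a' b' \<subseteq> cbox a b"
          using closure_mono[of "box a' b'" "box a b"] ab False
          by (metis closure_box inf_le2 box_eq_empty(1) subset_empty)
        with that show ?thesis by (intro box0) auto
      qed simp
      ultimately show "(LINT x|lborel. indicator (box c d) x * (indicator (box a b) x * F x)) = 0"
        by simp
    qed
    then show ?thesis by eventually_elim (auto simp: indicator_def)
  qed
  \<comment> \<open>The countable cover of an open set used below consists of closed boxes, while
    \<open>loc\<close> concerns open ones; the difference is the negligible frontier.\<close>
  have loc': "AE x in lborel. x \<in> X \<longrightarrow> F x = 0" if X: "X \<subseteq> \<Omega>" "\<exists>a b. X = cbox a b" for X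
  proof -
    obtain a b where ab: "X = cbox a b" using X by blast
    have "cbox a b - box a b \<in> null_sets lborel"
      using negligible_frontier_interval[of a b] by (simp add: negligible_iff_null_sets null_sets_completion_iff)
    then have "AE x in lborel. x \<notin> cbox a b - box a b" by (rule AE_not_in)
    moreover have "AE x in lborel. x \<in> box a b \<longrightarrow> F x = 0" using loc X ab by simp
    ultimately show ?thesis by eventually_elim (auto simp: ab)
  qed
  obtain D where D: "countable D" "D \<subseteq> Pow \<Omega>" "\<And>X. X \<in> D \<Longrightarrow> \<exists>a b. X = cbox a b" "\<Union>D = \<Omega>"
    using open_countable_Union_open_cbox[OF \<Omega>] by blast
  have "AE x in lborel. \<forall>X\<in>D. x \<in> X \<longrightarrow> F x = 0"
    using D loc' by (subst AE_ball_countable) auto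
  then show ?thesis by eventually_elim (use D(4) in blast)
qed

section \<open>Mollification\<close>

lemma mollifier_exists:
  assumes "e > 0"
  obtains \<eta> where "\<eta> \<in> test_fun (cball 0 e)" "\<And>x. 0 \<le> \<eta> x" "\<And>x. \<eta> (- x) = \<eta> x"
    "(LINT x|lborel. \<eta> x) = 1"
proof -
  \<comment> \<open>Half width e / 3, because the Euclidean norm is at most the sum of the three
    absolute coordinates. The box is centred at 0, which makes the bump even.\<close>
  define b :: "real^3" where "b = (\<chi> i. e / 3)"
  define f where "f = box_bump 1 (- b) b"
  have sub: "cbox (- b) b \<subseteq> cball 0 e"
  proof
    fix x assume x: "x \<in> cbox (- b) b"
    have "\<bar>x $ i\<bar> \<le> e / 3" for i
      using x by (auto simp: mem_box_cart b_def abs_le_iff dest!: spec[of _ i])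
    then have "(\<Sum>i\<in>UNIV. \<bar>x $ i\<bar>) \<le> (\<Sum>i\<in>(UNIV :: 3 set). e / 3)" by (intro sum_mono) auto
    then show "x \<in> cball 0 e" using norm_le_l1_cart[of x] by simp
  qed
  have f: "f \<in> test_fun (cball 0 e)" unfolding f_def by (rule box_bump_test_fun[OF sub])
  have int: "integrable lborel f" by (rule test_fun_integrable[OF f])
  have nn: "0 \<le> f x" for x by (simp add: f_def box_bump_bounds)
  have "(LINT x|lborel. f x) \<noteq> 0"
  proof
    assume "(LINT x|lborel. f x) = 0"
    then have "AE x in lborel. f x = 0"
      using integral_nonneg_eq_0_iff_AE[OF int] nn by auto
    then have "AE x in lborel. x \<notin> box (- b) b"
      by eventually_elim (use box_bump_pos[of 1 _ "- b" b] in \<open>force simp: f_def\<close>)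
    then have "emeasure lborel (box (- b) b) = 0"
      by (subst (asm) AE_iff_measurable[OF _ refl]) auto
    moreover have "emeasure lborel (box (- b) b) = (\<Prod>i\<in>Basis. (b - (- b)) \<bullet> i)"
      by (rule emeasure_lborel_box) (use assms in \<open>auto simp: b_def Basis_vec_def inner_axis\<close>)
    moreover have "(\<Prod>i\<in>Basis. (b - (- b)) \<bullet> i) > 0"
      by (rule prod_pos) (use assms in \<open>auto simp: b_def Basis_vec_def inner_axis\<close>)
    ultimately show False by (metis ennreal_eq_0_iff not_le)
  qed
  moreover have "(LINT x|lborel. f x) \<ge> 0" using nn by simp
  ultimately have pos: "(LINT x|lborel. f x) > 0" by simp
  have even: "f (- x) = f x" for x
    unfolding f_def box_bump_def by (intro prod.cong) (auto simp: algebra_simps)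
  show thesis
  proof (rule that[of "\<lambda>x. inverse (LINT x|lborel. f x) * f x"])
    show "(\<lambda>x. inverse (LINT x|lborel. f x) * f x) \<in> test_fun (cball 0 e)"
      by (rule test_fun_mult[OF f smooth_const])
  qed (use pos nn even in \<open>auto intro!: mult_nonneg_nonneg\<close>)
qed

text \<open>The pairing of G with the convolution of \<eta> and F. It is kept as a double integral,
  so that every manipulation is an exchange of integrals or a derivative of the kernel.\<close>

definition smear :: "(real^3 \<Rightarrow> real) \<Rightarrow> (real^3 \<Rightarrow> real) \<Rightarrow> (real^3 \<Rightarrow> real) \<Rightarrow> real" where
  "smear \<eta> F G = (LINT x|lborel. LINT y|lborel. F y * \<eta> (x - y) * G x)"

lemma kernel_integrable:
  assumes F: "integrable lborel F" and G: "integrable lborel G" and \<eta>: "\<eta> \<in> test_fun A"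
  shows "integrable (lborel \<Otimes>\<^sub>M lborel) (\<lambda>(x, y). F y * \<eta> (x - y) * G x)"
proof -
  obtain C where C: "C \<ge> 0" "\<And>x. \<bar>\<eta> x\<bar> \<le> C" using test_fun_bounded[OF \<eta>] by blast
  note [measurable] = smooth_borel[OF test_fun_smooth[OF \<eta>]]
  have [measurable]: "F \<in> borel_measurable borel" "G \<in> borel_measurable borel" using F G by auto
  have "integrable (lborel \<Otimes>\<^sub>M lborel) (\<lambda>(x, y). C * (\<bar>G x\<bar> * \<bar>F y\<bar>))"
  proof (rule lborel_pair.Fubini_integrable)
    show "AE x in lborel. integrable lborel (\<lambda>y. case (x, y) of (x, y) \<Rightarrow> C * (\<bar>G x\<bar> * \<bar>F y\<bar>))"
      using F by simp
    show "integrable lborel (\<lambda>x. LINT y|lborel. norm (case (x, y) of (x, y) \<Rightarrow> C * (\<bar>G x\<bar> * \<bar>F y\<bar>)))"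
      using G by (simp add: abs_mult)
  qed simp
  then show ?thesis
  proof (rule Bochner_Integration.integrable_bound)
    have "\<bar>F y * \<eta> (x - y) * G x\<bar> \<le> C * (\<bar>G x\<bar> * \<bar>F y\<bar>)" for x y
    proof -
      have "\<bar>F y * \<eta> (x - y) * G x\<bar> = \<bar>\<eta> (x - y)\<bar> * (\<bar>G x\<bar> * \<bar>F y\<bar>)" by (simp add: abs_mult)
      also have "\<dots> \<le> C * (\<bar>G x\<bar> * \<bar>F y\<bar>)" using C by (intro mult_right_mono) auto
      finally show ?thesis .
    qed
    then show "AE z in lborel \<Otimes>\<^sub>M lborel. norm (case z of (x, y) \<Rightarrow> F y * \<eta> (x - y) * G x)
        \<le> norm (case z of (x, y) \<Rightarrow> C * (\<bar>G x\<bar> * \<bar>F y\<bar>))"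
      using C by (auto intro!: AE_I2 simp: abs_mult)
  qed simp
qed

lemma smear_swap:
  assumes F: "integrable lborel F" and G: "integrable lborel G" and \<eta>: "\<eta> \<in> test_fun A"
  shows "smear \<eta> F G = (LINT y|lborel. F y * (LINT x|lborel. \<eta> (x - y) * G x))"
  unfolding smear_def
  using lborel_pair.Fubini_integral[OF kernel_integrable[OF assms]]
  by (simp add: mult.assoc)

lemma smear_fst:
  assumes "integrable lborel F" "integrable lborel G" "\<eta> \<in> test_fun A"
  shows "integrable lborel (\<lambda>x. LINT y|lborel. F y * \<eta> (x - y) * G x)"
  using lborel_pair.integrable_fst'[OF kernel_integrable[OF assms]] by simp

lemma smear_snd:
  assumes "integrable lborel F" "integrable lborel G" "\<eta> \<in> test_fun A"
  shows "integrable lborel (\<lambda>y. F y * (LINT x|lborel. \<eta> (x - y) * G x))"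
proof -
  have "integrable (lborel \<Otimes>\<^sub>M lborel) (\<lambda>(y, x). F y * \<eta> (x - y) * G x)"
    using lborel_pair.integrable_product_swap[OF kernel_integrable[OF assms]] by (simp add: case_prod_beta')
  from lborel_pair.integrable_fst'[OF this] show ?thesis by (simp add: mult.assoc)
qed

text \<open>\<open>smear_tendsto\<close> wants its second argument bounded. In the term with G2 of
  the product rule the bounded factor F1 stands first, so the two have to be exchanged.\<close>

lemma smear_even:
  assumes "integrable lborel F" "integrable lborel G" "\<eta> \<in> test_fun A" "\<And>x. \<eta> (- x) = \<eta> x"
  shows "smear \<eta> F G = smear \<eta> G F"
proof -
  have "\<eta> (x - y) = \<eta> (y - x)" for x y using assms(4)[of "y - x"] by simp
  then have "F y * (LINT x|lborel. \<eta> (x - y) * G x) = (LINT x|lborel. G x * \<eta> (y - x) * F y)" for y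
    by (simp add: mult.commute)
  then show ?thesis
    unfolding smear_swap[OF assms(1-3)] unfolding smear_def
    by (intro Bochner_Integration.integral_cong refl)
qed

lemma test_fun_mult_integrable:
  assumes F: "integrable lborel F" and \<eta>: "\<eta> \<in> test_fun A"
  shows "integrable lborel (\<lambda>x. F x * \<eta> x)"
proof -
  obtain C where C: "C \<ge> 0" "\<And>x. \<bar>\<eta> x\<bar> \<le> C" using test_fun_bounded[OF \<eta>] by blast
  note [measurable] = smooth_borel[OF test_fun_smooth[OF \<eta>]]
  have "integrable lborel (\<lambda>x. C * \<bar>F x\<bar>)" using F by simp
  then show ?thesis
    by (rule Bochner_Integration.integrable_bound)
       (use F C in \<open>auto simp: abs_mult mult.commute[of C] intro!: AE_I2 mult_left_mono\<close>)
qed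

lemma test_fun_reflect:
  assumes "\<eta> \<in> test_fun (cball 0 e)" "cball x e \<subseteq> \<Omega>"
  shows "(\<lambda>y. \<eta> (x - y)) \<in> test_fun \<Omega>"
proof (rule test_fun_mono[OF assms(2)], rule test_funI[of _ "cball x e"])
  show "smooth (\<lambda>y. \<eta> (x - y))"
    using smooth_affine[OF test_fun_smooth[OF assms(1)], of "-1" x] by simp
  fix y assume "y \<notin> cball x e"
  then have "x - y \<notin> cball 0 e" by (simp add: dist_norm norm_minus_commute)
  then show "\<eta> (x - y) = 0" using assms(1) unfolding test_fun_iff by blast
qed auto

lemma partial_reflect:
  assumes "smooth \<eta>"
  shows "partial i (\<lambda>y. \<eta> (x - y)) y = - partial i \<eta> (x - y)"
  using partial_affine[of \<eta> "-1" y x i] smooth_differentiable[OF assms] by simp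

lemma partial_translate:
  assumes "smooth \<eta>"
  shows "partial i (\<lambda>x. \<eta> (x - y)) x = partial i \<eta> (x - y)"
  using partial_affine[of \<eta> "1" x "- y" i] smooth_differentiable[OF assms] by simp

lemma smooth_translate: "smooth \<eta> \<Longrightarrow> smooth (\<lambda>x. \<eta> (x - y))"
  using smooth_affine[of \<eta> 1 "- y"] by simp

text \<open>Doubling the variables: the kernel is differentiated in both variables, and the two
  derivatives cancel, so no derivative of a mollified function is needed.\<close>

lemma smear_product_rule:
  assumes F1: "integrable lborel F1" and F2: "integrable lborel F2"
    and G1: "integrable lborel G1" and G2: "integrable lborel G2"
    and W1: "\<And>\<phi>. \<phi> \<in> test_fun \<Omega> \<Longrightarrow> (LINT x|lborel. F1 x * partial i \<phi> x) = - (LINT x|lborel. G1 x * \<phi> x)"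
    and W2: "\<And>\<phi>. \<phi> \<in> test_fun \<Omega> \<Longrightarrow> (LINT x|lborel. F2 x * partial i \<phi> x) = - (LINT x|lborel. G2 x * \<phi> x)"
    and \<phi>: "\<phi> \<in> test_fun \<Omega>" and \<eta>: "\<eta> \<in> test_fun (cball 0 e)"
    and K: "\<And>x. \<phi> x \<noteq> 0 \<Longrightarrow> cball x e \<subseteq> \<Omega>"
  shows "smear \<eta> F1 (\<lambda>x. F2 x * partial i \<phi> x) =
    - smear \<eta> F1 (\<lambda>x. G2 x * \<phi> x) - smear \<eta> G1 (\<lambda>x. F2 x * \<phi> x)"
proof -
  note s\<eta> = test_fun_smooth[OF \<eta>] and s\<phi> = test_fun_smooth[OF \<phi>]
  note [measurable] = smooth_borel[OF s\<eta>] smooth_borel[OF s\<phi>]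
    smooth_borel[OF smooth_partial[OF s\<eta>]] smooth_borel[OF smooth_partial[OF s\<phi>]]
  note d\<phi> = test_fun_partial[OF \<phi>, of i] and d\<eta> = test_fun_partial[OF \<eta>, of i]
  note int = test_fun_mult_integrable
  \<comment> \<open>The weak derivative of F2, tested in x with the shifted mollifier times
    \<open>\<phi>\<close>; here y is a mere parameter.\<close>
  have inner: "(LINT x|lborel. \<eta> (x - y) * (F2 x * partial i \<phi> x)) =
      - (LINT x|lborel. \<eta> (x - y) * (G2 x * \<phi> x)) - (LINT x|lborel. partial i \<eta> (x - y) * (F2 x * \<phi> x))" for y
  proof -
    have \<psi>: "(\<lambda>x. \<eta> (x - y) * \<phi> x) \<in> test_fun \<Omega>"
      by (rule test_fun_mult[OF \<phi> smooth_translate[OF s\<eta>]])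
    have p: "partial i (\<lambda>x. \<eta> (x - y) * \<phi> x) x = partial i \<eta> (x - y) * \<phi> x + \<eta> (x - y) * partial i \<phi> x" for x
      using smooth_differentiable[OF smooth_translate[OF s\<eta>]] smooth_differentiable[OF s\<phi>]
      by (simp add: partial_mult partial_translate[OF s\<eta>])
    have i1: "integrable lborel (\<lambda>x. F2 x * (partial i \<eta> (x - y) * \<phi> x))"
      by (rule int[OF F2 test_fun_mult[OF \<phi> smooth_translate[OF smooth_partial[OF s\<eta>]]]])
    have i2: "integrable lborel (\<lambda>x. F2 x * (\<eta> (x - y) * partial i \<phi> x))"
      by (rule int[OF F2 test_fun_mult[OF d\<phi> smooth_translate[OF s\<eta>]]])
    have "(LINT x|lborel. F2 x * (partial i \<eta> (x - y) * \<phi> x)) + (LINT x|lborel. F2 x * (\<eta> (x - y) * partial i \<phi> x))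
      = - (LINT x|lborel. G2 x * (\<eta> (x - y) * \<phi> x))"
      using W2[OF \<psi>] i1 i2 by (simp add: p distrib_left)
    then show ?thesis by (simp add: algebra_simps)
  qed
  \<comment> \<open>Now y is the variable. The reflected mollifier is an admissible test function as
    long as its ball stays in \<Omega>, which K grants where \<open>\<phi>\<close> is nonzero;
    elsewhere the factor \<open>\<phi> x\<close> kills the integrand. The sign of the reflection
    cancels that of the weak derivative.\<close>
  have outer: "(LINT y|lborel. F1 y * partial i \<eta> (x - y)) = (LINT y|lborel. G1 y * \<eta> (x - y))"
    if "\<phi> x \<noteq> 0" for x
    using W1[OF test_fun_reflect[OF \<eta> K[OF that]]] by (simp add: partial_reflect[OF s\<eta>])
  have "smear \<eta> F1 (\<lambda>x. F2 x * partial i \<phi> x) =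
      (LINT y|lborel. - (F1 y * (LINT x|lborel. \<eta> (x - y) * (G2 x * \<phi> x)))
         - F1 y * (LINT x|lborel. partial i \<eta> (x - y) * (F2 x * \<phi> x)))"
    unfolding smear_swap[OF F1 int[OF F2 d\<phi>] \<eta>] inner by (simp add: algebra_simps)
  also have "\<dots> = - smear \<eta> F1 (\<lambda>x. G2 x * \<phi> x) - smear (partial i \<eta>) F1 (\<lambda>x. F2 x * \<phi> x)"
    using smear_snd[OF F1 int[OF G2 \<phi>] \<eta>] smear_snd[OF F1 int[OF F2 \<phi>] d\<eta>]
    by (simp add: smear_swap[OF F1 int[OF G2 \<phi>] \<eta>] smear_swap[OF F1 int[OF F2 \<phi>] d\<eta>])
  also have "smear (partial i \<eta>) F1 (\<lambda>x. F2 x * \<phi> x) = smear \<eta> G1 (\<lambda>x. F2 x * \<phi> x)"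
    unfolding smear_def
  proof (rule Bochner_Integration.integral_cong[OF refl])
    fix x
    show "(LINT y|lborel. F1 y * partial i \<eta> (x - y) * (F2 x * \<phi> x)) =
        (LINT y|lborel. G1 y * \<eta> (x - y) * (F2 x * \<phi> x))"
      using outer[of x] by (cases "\<phi> x = 0") simp_all
  qed
  finally show ?thesis .
qed

text \<open>F is clipped at a height M at small cost in L1. The clipped function is an almost
  everywhere limit of continuous functions, which may be clipped at the same height; on a ball this
  gives a constant as integrable bound.\<close>

lemma L1_continuous_approx:
  fixes F :: "'a::euclidean_space \<Rightarrow> real"
  assumes F: "integrable lborel F" and e: "e > 0"
  obtains g where "continuous_on UNIV g" "(LINT x|lborel. indicator (cball 0 R) x * \<bar>F x - g x\<bar>) < e"
proof -
  have [measurable]: "F \<in> borel_measurable borel" using F by auto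
  define cl where "cl M t = max (- M) (min M t)" for M t :: real
  have cl[measurable]: "cl M \<in> borel_measurable borel" for M
    unfolding cl_def[abs_def] by measurable
  have "(\<lambda>n. LINT x|lborel. \<bar>F x - cl (real n) (F x)\<bar>) \<longlonglongrightarrow> (LINT x|(lborel :: 'a measure). 0)"
  proof (rule integral_dominated_convergence)
    show "integrable lborel (\<lambda>x. \<bar>F x\<bar>)" using F by simp
    show "AE x in lborel. (\<lambda>n. \<bar>F x - cl (real n) (F x)\<bar>) \<longlonglongrightarrow> 0"
    proof (intro AE_I2 tendsto_eventually)
      fix x
      obtain N :: nat where N: "\<bar>F x\<bar> < real N" using reals_Archimedean2 by blast
      show "\<forall>\<^sub>F n in sequentially. \<bar>F x - cl (real n) (F x)\<bar> = 0"
        using eventually_ge_at_top[of N] by eventually_elim (use N in \<open>auto simp: cl_def\<close>)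
    qed
  qed (auto simp: cl_def)
  then have "\<forall>\<^sub>F n in sequentially. (LINT x|lborel. \<bar>F x - cl (real n) (F x)\<bar>) < e / 2"
    using e by (intro order_tendstoD(2)[of _ 0]) auto
  then obtain M :: nat where M: "(LINT x|lborel. \<bar>F x - cl (real M) (F x)\<bar>) < e / 2"
    by (auto simp: eventually_sequentially)
  define H where "H x = cl (real M) (F x)" for x
  have [measurable]: "H \<in> borel_measurable borel" unfolding H_def[abs_def] by measurable
  have "H measurable_on UNIV" by (rule lebesgue_measurable_imp_measurable_on) (auto intro: measurable_completion)
  then obtain N g where N: "negligible N" and g: "\<And>n. continuous_on UNIV (g n)"
    and lim: "\<And>x. x \<notin> N \<Longrightarrow> (\<lambda>n. g n x) \<longlonglongrightarrow> H x"
    unfolding measurable_on_def by auto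
  define k where "k n x = cl (real M) (g n x)" for n x
  have k: "continuous_on UNIV (k n)" for n
    unfolding k_def cl_def by (intro continuous_intros g)
  note [measurable] = borel_measurable_continuous_onI[OF k]
  have bd: "\<bar>k n x\<bar> \<le> M" "\<bar>H x\<bar> \<le> M" for n x by (auto simp: k_def H_def cl_def)
  have AEN: "AE x in lborel. x \<notin> N"
    using N unfolding negligible_iff_null_sets by (rule AE_not_in[THEN AE_completion_iff[THEN iffD1]])
  have "(\<lambda>n. LINT x|lborel. indicator (cball 0 R) x * \<bar>H x - k n x\<bar>) \<longlonglongrightarrow> (LINT x|(lborel :: 'a measure). 0)"
  proof (rule integral_dominated_convergence)
    show "integrable lborel (\<lambda>x :: 'a. indicator (cball 0 R) x * (2 * real M))"
      using emeasure_lborel_cball_finite[where c = "0::'a" and r = R]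
      by (intro integrable_mult_left integrable_real_indicator) simp_all
    show "AE x in lborel. (\<lambda>n. indicator (cball 0 R) x * \<bar>H x - k n x\<bar>) \<longlonglongrightarrow> 0"
      using AEN
    proof eventually_elim
      case (elim x)
      have "(\<lambda>n. k n x) \<longlonglongrightarrow> cl (real M) (H x)"
        unfolding k_def cl_def by (intro tendsto_intros lim elim)
      moreover have "cl (real M) (H x) = H x" by (auto simp: H_def cl_def)
      ultimately have "(\<lambda>n. indicator (cball 0 R) x * \<bar>H x - k n x\<bar>) \<longlonglongrightarrow> indicator (cball 0 R) x * \<bar>H x - H x\<bar>"
        by (intro tendsto_intros) simp
      then show ?case by simp
    qed
    show "AE x in lborel. norm (indicator (cball 0 R) x * \<bar>H x - k n x\<bar>) \<le> indicator (cball 0 R) x * (2 * real M)" for n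
    proof (rule AE_I2)
      fix x
      show "norm (indicator (cball 0 R) x * \<bar>H x - k n x\<bar>) \<le> indicator (cball 0 R) x * (2 * real M)"
        using bd(1)[of n x] bd(2)[of x] by (auto simp: indicator_def)
    qed
    show "(\<lambda>x. indicator (cball 0 R) x * \<bar>H x - k n x\<bar>) \<in> borel_measurable lborel" for n
      using borel_measurable_continuous_onI[OF k, of n]
      by (intro borel_measurable_times borel_measurable_indicator borel_measurable_abs borel_measurable_diff) auto
  qed auto
  then have "\<forall>\<^sub>F n in sequentially. (LINT x|lborel. indicator (cball 0 R) x * \<bar>H x - k n x\<bar>) < e / 2"
    using e by (intro order_tendstoD(2)[of _ 0]) auto
  then obtain n where n: "(LINT x|lborel. indicator (cball 0 R) x * \<bar>H x - k n x\<bar>) < e / 2"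
    by (auto simp: eventually_sequentially)
  have iF: "integrable lborel (\<lambda>x. \<bar>F x - H x\<bar>)"
    by (rule Bochner_Integration.integrable_bound[of _ "\<lambda>x. \<bar>F x\<bar>"]) (use F in \<open>auto simp: H_def cl_def\<close>)
  have iH: "integrable lborel (\<lambda>x. indicator (cball 0 R) x * \<bar>H x - k n x\<bar>)"
  proof (rule Bochner_Integration.integrable_bound)
    show "integrable lborel (\<lambda>x :: 'a. indicator (cball 0 R) x * (2 * real M))"
      using emeasure_lborel_cball_finite[where c = "0::'a" and r = R]
      by (intro integrable_mult_left integrable_real_indicator) simp_all
    show "AE x in lborel. norm (indicator (cball 0 R) x * \<bar>H x - k n x\<bar>) \<le> norm (indicator (cball 0 R) x * (2 * real M))"
    proof (rule AE_I2)
      fix x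
      show "norm (indicator (cball 0 R) x * \<bar>H x - k n x\<bar>) \<le> norm (indicator (cball 0 R) x * (2 * real M))"
        using bd(1)[of n x] bd(2)[of x] by (auto simp: indicator_def)
    qed
    show "(\<lambda>x. indicator (cball 0 R) x * \<bar>H x - k n x\<bar>) \<in> borel_measurable lborel"
      using borel_measurable_continuous_onI[OF k, of n]
      by (intro borel_measurable_times borel_measurable_indicator borel_measurable_abs borel_measurable_diff) auto
  qed
  have "(LINT x|lborel. indicator (cball 0 R) x * \<bar>F x - k n x\<bar>)
      \<le> (LINT x|lborel. \<bar>F x - H x\<bar> + indicator (cball 0 R) x * \<bar>H x - k n x\<bar>)"
    by (rule integral_mono') (use iF iH in \<open>auto simp: indicator_def\<close>)
  also have "\<dots> < e" using iF iH M n by (simp add: H_def)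
  finally show thesis using that k by blast
qed

text \<open>The kernel is nonnegative with integral one, so integrating over x first averages G and
  keeps its bound C. The estimate does not depend on the width of \<eta>.\<close>

lemma smear_le:
  assumes H: "integrable lborel H" and G: "integrable lborel G" and \<eta>: "\<eta> \<in> test_fun A"
    and nn: "\<And>x. 0 \<le> \<eta> x" and one: "(LINT x|lborel. \<eta> x) = 1" and C: "\<And>x. \<bar>G x\<bar> \<le> C"
  shows "\<bar>smear \<eta> H G\<bar> \<le> C * (LINT x|lborel. \<bar>H x\<bar>)"
proof -
  note [measurable] = smooth_borel[OF test_fun_smooth[OF \<eta>]]
  have tr: "integrable lborel (\<lambda>x. \<eta> (x - y))" "(LINT x|lborel. \<eta> (x - y)) = 1" for y
    using integrable_translate[OF test_fun_integrable[OF \<eta>], of "- y"] integral_translate[of \<eta> "- y"] one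
    by simp_all
  have "\<bar>LINT x|lborel. \<eta> (x - y) * G x\<bar> \<le> C" for y
  proof -
    have "\<bar>LINT x|lborel. \<eta> (x - y) * G x\<bar> \<le> (LINT x|lborel. \<bar>\<eta> (x - y) * G x\<bar>)"
      by (rule integral_abs_bound)
    also have "\<dots> \<le> (LINT x|lborel. C * \<eta> (x - y))"
      by (rule integral_mono')
         (use tr nn C order_trans[OF abs_ge_zero C] in \<open>auto simp: abs_mult mult.commute[of C] intro!: mult_left_mono mult_nonneg_nonneg\<close>)
    finally show ?thesis using tr by simp
  qed
  then have le: "\<bar>H y * (LINT x|lborel. \<eta> (x - y) * G x)\<bar> \<le> C * \<bar>H y\<bar>" for y
    by (simp add: abs_mult mult.commute[of C] mult_left_mono)
  have "\<bar>smear \<eta> H G\<bar> \<le> (LINT y|lborel. \<bar>H y * (LINT x|lborel. \<eta> (x - y) * G x)\<bar>)"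
    unfolding smear_swap[OF H G \<eta>] by (rule integral_abs_bound)
  also have "\<dots> \<le> (LINT y|lborel. C * \<bar>H y\<bar>)"
    by (rule integral_mono') (use H le order_trans[OF abs_ge_zero C] in \<open>auto intro!: mult_nonneg_nonneg\<close>)
  finally show ?thesis by simp
qed

text \<open>By \<open>smear_le\<close> and the bound on G, replacing F by a function close to it in
  L1 costs little on both sides, uniformly in n. For a function that is continuous on a large ball,
  uniform continuity gives the convergence.\<close>

lemma smear_tendsto:
  assumes F: "integrable lborel F" and G: "integrable lborel G" and C: "\<And>x. \<bar>G x\<bar> \<le> C"
    and B: "bounded B" "\<And>x. x \<notin> B \<Longrightarrow> F x = 0" "\<And>x. x \<notin> B \<Longrightarrow> G x = 0"
    and \<eta>: "\<And>n. \<eta> n \<in> test_fun (cball 0 (d n))" "\<And>n x. 0 \<le> \<eta> n x" "\<And>n. (LINT x|lborel. \<eta> n x) = 1"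
    and even: "\<And>n x. \<eta> n (- x) = \<eta> n x" and d: "d \<longlonglongrightarrow> 0"
  shows "(\<lambda>n. smear (\<eta> n) F G) \<longlonglongrightarrow> (LINT x|lborel. F x * G x)"
proof (rule LIMSEQ_I)
  fix e :: real assume e: "e > 0"
  have [measurable]: "F \<in> borel_measurable borel" "G \<in> borel_measurable borel" using F G by auto
  define I where "I = (LINT x|lborel. \<bar>G x\<bar>)"
  have "C \<ge> 0" using C[of 0] by simp
  have "I \<ge> 0" by (simp add: I_def)
  \<comment> \<open>Three errors are summed: \<open>C * e'\<close> for the replacement inside
    \<open>smear\<close>, \<open>C * e'\<close> for the one inside the plain integral, and
    \<open>e' * I\<close> from uniform continuity. The 1 makes the final inequality strict and the
    denominator positive.\<close>
  define e' where "e' = e / (2 * C + I + 1)"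
  have e': "e' > 0" using e \<open>C \<ge> 0\<close> \<open>I \<ge> 0\<close> by (simp add: e'_def)
  obtain R0 where R0: "\<And>x. x \<in> B \<Longrightarrow> norm x \<le> R0" using B(1) unfolding bounded_iff by blast
  \<comment> \<open>The margin 1 keeps points y with \<open>norm (x - y) \<le> d n < 1\<close> and x
    in B inside the ball on which g is uniformly continuous.\<close>
  define R where "R = R0 + 1"
  obtain g where g: "continuous_on UNIV g" and ge: "(LINT x|lborel. indicator (cball 0 R) x * \<bar>F x - g x\<bar>) < e'"
    using L1_continuous_approx[OF F e'] by blast
  note [measurable] = borel_measurable_continuous_onI[OF g]
  define f where "f x = indicator (cball 0 R) x * g x" for x
  have f: "integrable lborel f"
    using borel_integrable_compact[of "cball 0 R" g] g
    by (auto simp: f_def[abs_def] intro: continuous_on_subset)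
  have H: "integrable lborel (\<lambda>x. F x - f x)" using F f by simp
  have "\<bar>F x - f x\<bar> = indicator (cball 0 R) x * \<bar>F x - g x\<bar>" for x
    using B(2)[of x] R0[of x] by (cases "x \<in> B") (auto simp: f_def R_def indicator_def)
  then have Hle: "(LINT x|lborel. \<bar>F x - f x\<bar>) < e'" using ge by simp
  have "uniformly_continuous_on (cball 0 R) g"
    by (rule compact_uniformly_continuous) (use g in \<open>auto intro: continuous_on_subset\<close>)
  then obtain \<delta> where \<delta>: "\<delta> > 0"
    "\<And>x y. x \<in> cball 0 R \<Longrightarrow> y \<in> cball 0 R \<Longrightarrow> dist y x < \<delta> \<Longrightarrow> dist (g y) (g x) < e'"
    unfolding uniformly_continuous_on_def using e' by metis
  have "\<forall>\<^sub>F n in sequentially. d n < min \<delta> 1"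
    using d \<delta>(1) by (intro order_tendstoD(2)) auto
  then obtain N where N: "\<And>n. n \<ge> N \<Longrightarrow> d n < min \<delta> 1" by (auto simp: eventually_sequentially)
  have "norm (smear (\<eta> n) F G - (LINT x|lborel. F x * G x)) < e" if "n \<ge> N" for n
  proof -
    note [measurable] = smooth_borel[OF test_fun_smooth[OF \<eta>(1)[of n]]]
    note \<eta>n = \<eta>(1)[of n] \<eta>(2)[of n] \<eta>(3)[of n]
    have bG: "integrable lborel (\<lambda>x. K x * G x)" if K: "integrable lborel K" for K
    proof (rule Bochner_Integration.integrable_bound)
      show "integrable lborel (\<lambda>x. C * \<bar>K x\<bar>)" using K by simp
      show "AE x in lborel. norm (K x * G x) \<le> norm (C * \<bar>K x\<bar>)"
        using C \<open>C \<ge> 0\<close> by (auto simp: abs_mult mult.commute[of C] intro!: mult_left_mono)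
    qed (use K in auto)
    have lin: "smear (\<eta> n) (\<lambda>x. F x - f x) G = smear (\<eta> n) F G - smear (\<eta> n) f G"
      using smear_snd[OF F G \<eta>n(1)] smear_snd[OF f G \<eta>n(1)]
      by (simp add: smear_swap[OF F G \<eta>n(1)] smear_swap[OF f G \<eta>n(1)] smear_swap[OF H G \<eta>n(1)] left_diff_distrib)
    have 1: "\<bar>smear (\<eta> n) F G - smear (\<eta> n) f G\<bar> \<le> C * e'"
      using smear_le[OF H G \<eta>n C] Hle mult_left_mono[OF less_imp_le[OF Hle] \<open>C \<ge> 0\<close>] lin by simp
    have 2: "\<bar>(LINT x|lborel. f x * G x) - (LINT x|lborel. F x * G x)\<bar> \<le> C * e'"
    proof -
      have "(LINT x|lborel. f x * G x) - (LINT x|lborel. F x * G x) = (LINT x|lborel. (f x - F x) * G x)"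
        using bG[OF f] bG[OF F] by (simp add: left_diff_distrib)
      also have "\<bar>\<dots>\<bar> \<le> (LINT x|lborel. \<bar>(f x - F x) * G x\<bar>)" by (rule integral_abs_bound)
      also have "\<dots> \<le> (LINT x|lborel. C * \<bar>F x - f x\<bar>)"
        by (rule integral_mono')
           (use H C \<open>C \<ge> 0\<close> in \<open>auto simp: abs_mult mult.commute[of C] abs_minus_commute intro!: mult_left_mono\<close>)
      also have "\<dots> \<le> C * e'" using mult_left_mono[OF less_imp_le[OF Hle] \<open>C \<ge> 0\<close>] by simp
      finally show ?thesis .
    qed
    have 3: "\<bar>smear (\<eta> n) f G - (LINT x|lborel. f x * G x)\<bar> \<le> e' * I"
    proof -
      have tr: "integrable lborel (\<lambda>y. \<eta> n (x - y))" "(LINT y|lborel. \<eta> n (x - y)) = 1" for x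
      proof -
        have "(\<lambda>y. \<eta> n (x - y)) = (\<lambda>y. \<eta> n (- x + y))"
          using even[of n "- x + _"] by (intro ext) simp
        then show "integrable lborel (\<lambda>y. \<eta> n (x - y))" "(LINT y|lborel. \<eta> n (x - y)) = 1"
          using integrable_translate[OF test_fun_integrable[OF \<eta>n(1)], of "- x"]
            integral_translate[of "\<eta> n" "- x"] \<eta>n(3) by simp_all
      qed
      have fi: "integrable lborel (\<lambda>y. f y * \<eta> n (x - y))" for x
        by (rule test_fun_mult_integrable[OF f test_fun_reflect[OF \<eta>n(1), of x UNIV]]) simp
      have pt: "\<bar>(LINT y|lborel. f y * \<eta> n (x - y) * G x) - f x * G x\<bar> \<le> e' * \<bar>G x\<bar>" for x
      proof (cases "x \<in> B")
        case True
        then have x: "norm x \<le> R0" by (rule R0)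
        have "(LINT y|lborel. f y * \<eta> n (x - y)) - f x = (LINT y|lborel. (f y - f x) * \<eta> n (x - y))"
          using fi[of x] tr[of x] by (simp add: left_diff_distrib)
        also have "\<bar>\<dots>\<bar> \<le> (LINT y|lborel. \<bar>(f y - f x) * \<eta> n (x - y)\<bar>)" by (rule integral_abs_bound)
        also have "\<dots> \<le> (LINT y|lborel. e' * \<eta> n (x - y))"
        proof (rule integral_mono')
          fix y
          show "\<bar>(f y - f x) * \<eta> n (x - y)\<bar> \<le> e' * \<eta> n (x - y)"
          proof (cases "x - y \<in> cball 0 (d n)")
            case True
            then have xy: "norm (x - y) \<le> d n" by simp
            then have "norm y \<le> R" "norm x \<le> R"
              using x N[OF that] norm_triangle_ineq3[of x y] norm_triangle_ineq2[of y x] by (auto simp: R_def norm_minus_commute)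
            moreover from this have "dist (g y) (g x) < e'"
              using xy N[OF that] by (intro \<delta>) (auto simp: dist_norm norm_minus_commute)
            ultimately have "\<bar>f y - f x\<bar> \<le> e'" by (auto simp: f_def dist_real_def)
            then show ?thesis using \<eta>n(2)[of "x - y"] by (simp add: abs_mult mult_right_mono)
          next
            case False
            then have "\<eta> n (x - y) = 0" using \<eta>n(1) unfolding test_fun_iff by blast
            then show ?thesis by simp
          qed
        qed (use tr \<eta>n(2) e' in auto)
        finally have "\<bar>(LINT y|lborel. f y * \<eta> n (x - y)) - f x\<bar> \<le> e'" using tr by simp
        then have "\<bar>((LINT y|lborel. f y * \<eta> n (x - y)) - f x) * G x\<bar> \<le> e' * \<bar>G x\<bar>"
          by (simp add: abs_mult mult_right_mono)
        then show ?thesis by (simp add: left_diff_distrib)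
      qed (simp add: B)
      have "smear (\<eta> n) f G - (LINT x|lborel. f x * G x) =
          (LINT x|lborel. (LINT y|lborel. f y * \<eta> n (x - y) * G x) - f x * G x)"
        unfolding smear_def using smear_fst[OF f G \<eta>n(1)] bG[OF f]
        by (intro Bochner_Integration.integral_diff[symmetric])
      also have "\<bar>\<dots>\<bar> \<le> (LINT x|lborel. \<bar>(LINT y|lborel. f y * \<eta> n (x - y) * G x) - f x * G x\<bar>)"
        by (rule integral_abs_bound)
      also have "\<dots> \<le> (LINT x|lborel. e' * \<bar>G x\<bar>)"
        by (rule integral_mono') (use G pt e' in auto)
      finally show ?thesis by (simp add: I_def)
    qed
    have "\<bar>smear (\<eta> n) F G - (LINT x|lborel. F x * G x)\<bar> \<le> e' * (2 * C + I)"
      using 1 2 3 by (simp add: algebra_simps)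
    also have "\<dots> < e' * (2 * C + I + 1)" using e' by simp
    also have "\<dots> = e" using \<open>C \<ge> 0\<close> \<open>I \<ge> 0\<close> by (simp add: e'_def)
    finally show ?thesis by simp
  qed
  then show "\<exists>no. \<forall>n\<ge>no. norm (smear (\<eta> n) F G - (LINT x|lborel. F x * G x)) < e" by blast
qed

text \<open>\<open>smear_product_rule\<close> is applied with mollifiers of shrinking radius. Each
  of the three terms pairs an integrable factor with a bounded one, so \<open>smear_tendsto\<close>
  identifies all limits.\<close>

lemma weak_product_rule:
  assumes \<Omega>: "open \<Omega>" "bounded \<Omega>"
    and F1: "integrable lborel F1" "\<And>x. \<bar>F1 x\<bar> \<le> C1" "\<And>x. x \<notin> \<Omega> \<Longrightarrow> F1 x = 0"
    and F2: "integrable lborel F2" "\<And>x. \<bar>F2 x\<bar> \<le> C2" "\<And>x. x \<notin> \<Omega> \<Longrightarrow> F2 x = 0"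
    and G1: "integrable lborel G1" "\<And>x. x \<notin> \<Omega> \<Longrightarrow> G1 x = 0"
    and G2: "integrable lborel G2" "\<And>x. x \<notin> \<Omega> \<Longrightarrow> G2 x = 0"
    and W1: "\<And>\<phi>. \<phi> \<in> test_fun \<Omega> \<Longrightarrow> (LINT x|lborel. F1 x * partial i \<phi> x) = - (LINT x|lborel. G1 x * \<phi> x)"
    and W2: "\<And>\<phi>. \<phi> \<in> test_fun \<Omega> \<Longrightarrow> (LINT x|lborel. F2 x * partial i \<phi> x) = - (LINT x|lborel. G2 x * \<phi> x)"
    and \<phi>: "\<phi> \<in> test_fun \<Omega>"
  shows "(LINT x|lborel. F1 x * F2 x * partial i \<phi> x) = - (LINT x|lborel. (F1 x * G2 x + G1 x * F2 x) * \<phi> x)"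
proof -
  obtain K where K: "compact K" "K \<subseteq> \<Omega>" "\<And>x. x \<notin> K \<Longrightarrow> \<phi> x = 0"
    using \<phi> unfolding test_fun_iff by blast
  obtain r where r: "r > 0" "(\<Union>x\<in>K. cball x r) \<subseteq> \<Omega>"
    using compact_subset_open_imp_cball_epsilon_subset[OF K(1) \<Omega>(1) K(2)] by blast
  \<comment> \<open>Capping by r keeps every ball around a point of the support of
    \<open>\<phi>\<close> inside \<Omega>, as the product rule for \<open>smear\<close>
    demands.\<close>
  define d where "d n = min r (inverse (real (Suc n)))" for n
  have "\<forall>n. \<exists>\<eta>. \<eta> \<in> test_fun (cball 0 (d n)) \<and> (\<forall>x. 0 \<le> \<eta> x) \<and> (\<forall>x. \<eta> (- x) = \<eta> x) \<and> (LINT x|lborel. \<eta> x) = 1"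
  proof
    fix n
    have "d n > 0" using r(1) by (simp add: d_def)
    from mollifier_exists[OF this] show "\<exists>\<eta>. \<eta> \<in> test_fun (cball 0 (d n)) \<and> (\<forall>x. 0 \<le> \<eta> x)
      \<and> (\<forall>x. \<eta> (- x) = \<eta> x) \<and> (LINT x|lborel. \<eta> x) = 1" by metis
  qed
  then obtain \<eta> where \<eta>: "\<And>n. \<eta> n \<in> test_fun (cball 0 (d n))" "\<And>n x. 0 \<le> \<eta> n x"
    "\<And>n x. \<eta> n (- x) = \<eta> n x" "\<And>n. (LINT x|lborel. \<eta> n x) = 1" by metis
  have "(\<lambda>n. min r (inverse (real (Suc n)))) \<longlonglongrightarrow> min r 0"
    by (intro tendsto_min tendsto_const LIMSEQ_inverse_real_of_nat)
  then have d: "d \<longlonglongrightarrow> 0" using r(1) by (simp add: d_def[abs_def])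
  obtain Cp where Cp: "Cp \<ge> 0" "\<And>x. \<bar>partial i \<phi> x\<bar> \<le> Cp"
    using test_fun_bounded[OF test_fun_partial[OF \<phi>]] by blast
  obtain C\<phi> where C\<phi>: "C\<phi> \<ge> 0" "\<And>x. \<bar>\<phi> x\<bar> \<le> C\<phi>"
    using test_fun_bounded[OF \<phi>] by blast
  note int = test_fun_mult_integrable
  have b1: "\<bar>F2 x * partial i \<phi> x\<bar> \<le> C2 * Cp" for x
    unfolding abs_mult by (intro mult_mono F2(2) Cp order_trans[OF abs_ge_zero F2(2)] abs_ge_zero)
  have b2: "\<bar>F2 x * \<phi> x\<bar> \<le> C2 * C\<phi>" for x
    unfolding abs_mult by (intro mult_mono F2(2) C\<phi> order_trans[OF abs_ge_zero F2(2)] abs_ge_zero)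
  have 1: "(\<lambda>n. smear (\<eta> n) F1 (\<lambda>x. F2 x * partial i \<phi> x)) \<longlonglongrightarrow> (LINT x|lborel. F1 x * (F2 x * partial i \<phi> x))"
    by (rule smear_tendsto[OF F1(1) int[OF F2(1) test_fun_partial[OF \<phi>]] b1 \<Omega>(2) F1(3) _ \<eta>(1,2,4) \<eta>(3) d])
       (auto simp: F2)
  have 2: "(\<lambda>n. smear (\<eta> n) (\<lambda>x. G2 x * \<phi> x) F1) \<longlonglongrightarrow> (LINT x|lborel. (G2 x * \<phi> x) * F1 x)"
    by (rule smear_tendsto[OF int[OF G2(1) \<phi>] F1(1) F1(2) \<Omega>(2) _ F1(3) \<eta>(1,2,4) \<eta>(3) d]) (auto simp: G2)
  have 3: "(\<lambda>n. smear (\<eta> n) G1 (\<lambda>x. F2 x * \<phi> x)) \<longlonglongrightarrow> (LINT x|lborel. G1 x * (F2 x * \<phi> x))"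
    by (rule smear_tendsto[OF G1(1) int[OF F2(1) \<phi>] b2 \<Omega>(2) G1(2) _ \<eta>(1,2,4) \<eta>(3) d]) (auto simp: F2)
  have eq: "smear (\<eta> n) F1 (\<lambda>x. F2 x * partial i \<phi> x) =
      - smear (\<eta> n) (\<lambda>x. G2 x * \<phi> x) F1 - smear (\<eta> n) G1 (\<lambda>x. F2 x * \<phi> x)" for n
  proof -
    have "cball x (d n) \<subseteq> \<Omega>" if "\<phi> x \<noteq> 0" for x
    proof -
      have "x \<in> K" using that K(3) by blast
      moreover have "cball x (d n) \<subseteq> cball x r" by (rule subset_cball) (simp add: d_def)
      ultimately show ?thesis using r(2) by blast
    qed
    from smear_product_rule[OF F1(1) F2(1) G1(1) G2(1) W1 W2 \<phi> \<eta>(1) this] show ?thesis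
      by (simp add: smear_even[OF F1(1) int[OF G2(1) \<phi>] \<eta>(1) \<eta>(3)])
  qed
  have "(LINT x|lborel. F1 x * (F2 x * partial i \<phi> x)) =
      - (LINT x|lborel. (G2 x * \<phi> x) * F1 x) - (LINT x|lborel. G1 x * (F2 x * \<phi> x))"
    using LIMSEQ_unique[OF 1] tendsto_diff[OF tendsto_minus[OF 2] 3] unfolding eq by blast
  moreover have "integrable lborel (\<lambda>x. (G2 x * \<phi> x) * F1 x)"
  proof (rule Bochner_Integration.integrable_bound)
    show "integrable lborel (\<lambda>x. C1 * \<bar>G2 x * \<phi> x\<bar>)" using int[OF G2(1) \<phi>] by simp
    show "AE x in lborel. norm (G2 x * \<phi> x * F1 x) \<le> norm (C1 * \<bar>G2 x * \<phi> x\<bar>)"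
      using F1(2) order_trans[OF abs_ge_zero F1(2)]
      by (auto simp: abs_mult mult.commute[of C1] intro!: mult_left_mono)
  qed (use int[OF G2(1) \<phi>] F1(1) in auto)
  moreover have "integrable lborel (\<lambda>x. G1 x * (F2 x * \<phi> x))"
  proof (rule Bochner_Integration.integrable_bound)
    show "integrable lborel (\<lambda>x. (C2 * C\<phi>) * \<bar>G1 x\<bar>)" using G1 by simp
    show "AE x in lborel. norm (G1 x * (F2 x * \<phi> x)) \<le> norm ((C2 * C\<phi>) * \<bar>G1 x\<bar>)"
      using b2 order_trans[OF abs_ge_zero b2]
      by (auto simp: abs_mult[of "G1 _"] mult.commute[of _ "\<bar>G1 _\<bar>"] intro!: AE_I2 mult_left_mono)
  qed (use int[OF F2(1) \<phi>] G1(1) in auto)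
  ultimately show ?thesis by (simp add: algebra_simps)
qed

section \<open>Square integrable functions\<close>

locale bounded_open =
  fixes \<Omega> :: "(real^3) set"
  assumes open_dom: "open \<Omega>" and bounded_dom: "bounded \<Omega>"
begin

abbreviation M :: "(real^3) measure" where "M \<equiv> lebesgue_on \<Omega>"

lemma dom_sets [measurable]: "\<Omega> \<in> sets borel"
  using open_dom by auto

lemma dom_lmeasurable: "\<Omega> \<in> lmeasurable"
  using bounded_dom open_dom by (rule lmeasurable_open)

sublocale finite_measure M
  by (rule finite_measure_lebesgue_on[OF dom_lmeasurable])

lemma dom_lebesgue: "\<Omega> \<inter> space lebesgue \<in> sets lebesgue"
  using dom_lmeasurable by (simp add: fmeasurable_def)

lemma borel_imp_M: "f \<in> borel_measurable borel \<Longrightarrow> f \<in> borel_measurable M"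
  by (intro measurable_restrict_space1 measurable_completion) simp

lemma smooth_M: "smooth f \<Longrightarrow> f \<in> borel_measurable M"
  by (intro borel_imp_M smooth_borel)

lemma AE_M_iff: "(AE x in M. P x) \<longleftrightarrow> (AE x in lborel. x \<in> \<Omega> \<longrightarrow> P x)"
  by (simp add: AE_restrict_space_iff[OF dom_lebesgue] AE_completion_iff)

text \<open>This rests on the completeness of Lebesgue measure; extension by zero reduces it to
  functions on the whole space.\<close>

lemma AE_measurable:
  fixes f g :: "real^3 \<Rightarrow> 'b::euclidean_space"
  assumes f: "f \<in> borel_measurable M" and ae: "AE x in M. f x = g x"
  shows "g \<in> borel_measurable M"
proof (rule borel_measurable_if_D, rule borel_measurable_AE)
  show "(\<lambda>x. if x \<in> \<Omega> then f x else 0) \<in> borel_measurable lebesgue"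
    using f dom_lebesgue by (intro borel_measurable_if_I) auto
  show "AE x in lebesgue. (if x \<in> \<Omega> then f x else 0) = (if x \<in> \<Omega> then g x else 0)"
    using ae unfolding AE_restrict_space_iff[OF dom_lebesgue] by eventually_elim auto
qed

lemma integrable_M_lborel:
  fixes H :: "real^3 \<Rightarrow> real"
  assumes [measurable]: "H \<in> borel_measurable borel" and out: "\<And>x. x \<notin> \<Omega> \<Longrightarrow> H x = 0"
  shows "integrable M H \<longleftrightarrow> integrable lborel H" "(LINT x|M. H x) = (LINT x|lborel. H x)"
proof -
  have eq: "(\<lambda>x. indicator \<Omega> x *\<^sub>R H x) = H" using out by (auto simp: indicator_def fun_eq_iff)
  show "integrable M H \<longleftrightarrow> integrable lborel H"
    unfolding integrable_restrict_space[OF dom_lebesgue] eq by (rule integrable_completion) simp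
  show "(LINT x|M. H x) = (LINT x|lborel. H x)"
    unfolding integral_restrict_space[OF dom_lebesgue] eq by (rule integral_completion) simp
qed

text \<open>The bridge to the mollification results, which are stated for Borel functions on the
  whole space that vanish outside \<Omega>.\<close>

lemma borel_representative:
  fixes f :: "real^3 \<Rightarrow> real"
  assumes f: "f \<in> borel_measurable M"
  obtains F where "F \<in> borel_measurable borel" "\<And>x. x \<notin> \<Omega> \<Longrightarrow> F x = 0" "AE x in M. F x = f x"
proof -
  have "(\<lambda>x. if x \<in> \<Omega> then f x else 0) \<in> borel_measurable lebesgue"
    using f dom_lebesgue by (intro borel_measurable_if_I) auto
  from completion_ex_borel_measurable_real[OF this] obtain F where
    F[measurable]: "F \<in> borel_measurable borel" and ae: "AE x in lborel. (if x \<in> \<Omega> then f x else 0) = F x"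
    by auto
  show thesis
  proof
    show "(\<lambda>x. indicator \<Omega> x * F x) \<in> borel_measurable borel" by measurable
    show "AE x in M. indicator \<Omega> x * F x = f x"
      unfolding AE_M_iff using ae by eventually_elim auto
  qed auto
qed

lemma integrable_mult_bounded:
  fixes f g :: "real^3 \<Rightarrow> real"
  assumes f: "integrable M f" and g: "g \<in> borel_measurable M" and C: "AE x in M. \<bar>g x\<bar> \<le> C"
  shows "integrable M (\<lambda>x. f x * g x)"
proof (rule Bochner_Integration.integrable_bound)
  show "integrable M (\<lambda>x. C * \<bar>f x\<bar>)" using f by simp
  show "AE x in M. norm (f x * g x) \<le> norm (C * \<bar>f x\<bar>)"
    using C
  proof eventually_elim
    case (elim x)
    have "\<bar>f x\<bar> * \<bar>g x\<bar> \<le> \<bar>f x\<bar> * C" using elim by (intro mult_left_mono) auto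
    also have "\<dots> \<le> \<bar>C * \<bar>f x\<bar>\<bar>" by (simp add: mult.commute)
    finally show ?case by (simp add: abs_mult)
  qed
qed (use f g in auto)

lemma L2_measurable: "f \<in> L2 \<Omega> \<Longrightarrow> f \<in> borel_measurable M"
  by (simp add: L2_def)

lemma L2_sq: "f \<in> L2 \<Omega> \<Longrightarrow> integrable M (\<lambda>x. (norm (f x))\<^sup>2)"
  by (simp add: L2_def)

lemma L2_bound:
  fixes f :: "real^3 \<Rightarrow> 'b::euclidean_space"
  assumes f: "f \<in> borel_measurable M" and g: "integrable M g" and le: "AE x in M. (norm (f x))\<^sup>2 \<le> g x"
  shows "f \<in> L2 \<Omega>"
  unfolding L2_def
proof (intro CollectI conjI f)
  show "integrable M (\<lambda>x. (norm (f x))\<^sup>2)"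
    by (rule Bochner_Integration.integrable_bound[OF g]) (use f le in \<open>auto elim: eventually_mono\<close>)
qed

lemma L2_cong_AE:
  assumes f: "f \<in> L2 \<Omega>" and ae: "AE x in M. f x = g x" shows "g \<in> L2 \<Omega>"
  by (rule L2_bound[OF AE_measurable[OF L2_measurable[OF f] ae] L2_sq[OF f]])
     (use ae in \<open>eventually_elim; simp\<close>)

lemma bounded_L2:
  fixes f :: "real^3 \<Rightarrow> 'b::euclidean_space"
  assumes "f \<in> borel_measurable M" "AE x in M. norm (f x) \<le> C"
  shows "f \<in> L2 \<Omega>"
  by (rule L2_bound[OF assms(1), of "\<lambda>x. C\<^sup>2"])
     (use assms(2) in \<open>auto elim!: eventually_mono intro: power_mono\<close>)

lemma L2_add:
  fixes f g :: "real^3 \<Rightarrow> 'b::euclidean_space"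
  assumes "f \<in> L2 \<Omega>" "g \<in> L2 \<Omega>" shows "(\<lambda>x. f x + g x) \<in> L2 \<Omega>"
proof (rule L2_bound)
  show "(\<lambda>x. f x + g x) \<in> borel_measurable M" using assms by (auto simp: L2_def)
  show "integrable M (\<lambda>x. 2 * (norm (f x))\<^sup>2 + 2 * (norm (g x))\<^sup>2)"
    using L2_sq[OF assms(1)] L2_sq[OF assms(2)] by simp
  have "(norm (f x + g x))\<^sup>2 \<le> 2 * (norm (f x))\<^sup>2 + 2 * (norm (g x))\<^sup>2" for x
  proof -
    have "(norm (f x + g x))\<^sup>2 \<le> (norm (f x) + norm (g x))\<^sup>2" by (intro power_mono norm_triangle_ineq) simp
    also have "\<dots> \<le> 2 * (norm (f x))\<^sup>2 + 2 * (norm (g x))\<^sup>2"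
      using sum_squares_bound[of "norm (f x)" "norm (g x)"] by (simp add: power2_sum)
    finally show ?thesis .
  qed
  then show "AE x in M. (norm (f x + g x))\<^sup>2 \<le> 2 * (norm (f x))\<^sup>2 + 2 * (norm (g x))\<^sup>2" by simp
qed

lemma L2_scaleR: 
  fixes f :: "real^3 \<Rightarrow> 'b::euclidean_space"
  assumes f: "f \<in> L2 \<Omega>" and h: "h \<in> borel_measurable M" and C: "AE x in M. \<bar>h x\<bar> \<le> C"
  shows "(\<lambda>x. h x *\<^sub>R f x) \<in> L2 \<Omega>"
proof (rule L2_bound)
  show "(\<lambda>x. h x *\<^sub>R f x) \<in> borel_measurable M" using f h by (auto simp: L2_def)
  show "integrable M (\<lambda>x. C\<^sup>2 * (norm (f x))\<^sup>2)" using L2_sq[OF f] by simp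
  show "AE x in M. (norm (h x *\<^sub>R f x))\<^sup>2 \<le> C\<^sup>2 * (norm (f x))\<^sup>2"
    using C
  proof eventually_elim
    case (elim x)
    then have "\<bar>h x\<bar>\<^sup>2 \<le> C\<^sup>2" by (intro power_mono) auto
    then show ?case by (simp add: power_mult_distrib mult_right_mono)
  qed
qed

lemma L2_cmult: 
  fixes f :: "real^3 \<Rightarrow> 'b::euclidean_space"
  shows "f \<in> L2 \<Omega> \<Longrightarrow> (\<lambda>x. c *\<^sub>R f x) \<in> L2 \<Omega>"
  by (rule L2_scaleR[where C = "\<bar>c\<bar>"]) auto

lemma L2_diff:
  fixes f g :: "real^3 \<Rightarrow> 'b::euclidean_space"
  assumes "f \<in> L2 \<Omega>" "g \<in> L2 \<Omega>" shows "(\<lambda>x. f x - g x) \<in> L2 \<Omega>"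
  using L2_add[OF assms(1) L2_cmult[OF assms(2), of "-1"]] by simp

lemma L2_sum:
  fixes f :: "'i \<Rightarrow> real^3 \<Rightarrow> 'b::euclidean_space"
  assumes "\<And>i. i \<in> I \<Longrightarrow> f i \<in> L2 \<Omega>" shows "(\<lambda>x. \<Sum>i\<in>I. f i x) \<in> L2 \<Omega>"
  using assms
proof (induction I rule: infinite_finite_induct)
  case (insert i I)
  then show ?case using L2_add[of "f i" "\<lambda>x. \<Sum>i\<in>I. f i x"] by simp
qed (simp_all add: L2_def)

lemma L2_inner_integrable:
  fixes f g :: "real^3 \<Rightarrow> 'b::euclidean_space"
  assumes f: "f \<in> L2 \<Omega>" and g: "g \<in> L2 \<Omega>"
  shows "integrable M (\<lambda>x. f x \<bullet> g x)"
proof (rule Bochner_Integration.integrable_bound)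
  show "integrable M (\<lambda>x. (norm (f x))\<^sup>2 + (norm (g x))\<^sup>2)"
    using L2_sq[OF f] L2_sq[OF g] by simp
  have "\<bar>f x \<bullet> g x\<bar> \<le> (norm (f x))\<^sup>2 + (norm (g x))\<^sup>2" for x
    using Cauchy_Schwarz_ineq2[of "f x" "g x"] sum_squares_bound[of "norm (f x)" "norm (g x)"]
      zero_le_power2[of "norm (f x)"] zero_le_power2[of "norm (g x)"]
      mult_nonneg_nonneg[OF norm_ge_zero[of "f x"] norm_ge_zero[of "g x"]]
    by linarith
  then show "AE x in M. norm (f x \<bullet> g x) \<le> norm ((norm (f x))\<^sup>2 + (norm (g x))\<^sup>2)" by simp
qed (use f g in \<open>auto simp: L2_def\<close>)

lemma L2_norm_mult_integrable:
  fixes f :: "real^3 \<Rightarrow> 'b::euclidean_space" and g :: "real^3 \<Rightarrow> 'c::euclidean_space"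
  assumes f: "f \<in> L2 \<Omega>" and g: "g \<in> L2 \<Omega>"
  shows "integrable M (\<lambda>x. norm (f x) * norm (g x))"
proof -
  have "(\<lambda>x. norm (f x)) \<in> L2 \<Omega>" "(\<lambda>x. norm (g x)) \<in> L2 \<Omega>" using f g by (auto simp: L2_def)
  from L2_inner_integrable[OF this] show ?thesis by simp
qed

lemma L2_mult_integrable:
  fixes f g :: "real^3 \<Rightarrow> real"
  assumes f: "f \<in> L2 \<Omega>" and g: "g \<in> L2 \<Omega>"
  shows "integrable M (\<lambda>x. f x * g x)"
  using L2_inner_integrable[OF assms] by simp

lemma L2_const: "(\<lambda>x. c :: 'b::euclidean_space) \<in> L2 \<Omega>"
  by (rule bounded_L2[where C = "norm c"]) auto

lemma L2_integrable: "f \<in> L2 \<Omega> \<Longrightarrow> integrable M (f :: real^3 \<Rightarrow> real)"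
  using L2_mult_integrable[OF _ L2_const[of 1]] by simp

lemma L2_vec: 
  fixes f :: "real^3 \<Rightarrow> 'b::euclidean_space^'n"
  shows "f \<in> L2 \<Omega> \<longleftrightarrow> (\<forall>i. (\<lambda>x. f x $ i) \<in> L2 \<Omega>)"
proof
  assume f: "f \<in> L2 \<Omega>"
  show "\<forall>i. (\<lambda>x. f x $ i) \<in> L2 \<Omega>"
  proof
    fix i
    show "(\<lambda>x. f x $ i) \<in> L2 \<Omega>"
    proof (rule L2_bound[OF _ L2_sq[OF f]])
      show "(\<lambda>x. f x $ i) \<in> borel_measurable M"
        using L2_measurable[OF f] by (rule measurable_compose) (intro borel_measurable_continuous_onI continuous_intros)
    qed (auto intro!: power_mono Finite_Cartesian_Product.norm_nth_le)
  qed
next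
  assume f: "\<forall>i. (\<lambda>x. f x $ i) \<in> L2 \<Omega>"
  have "(\<lambda>x. \<Sum>i\<in>UNIV. axis i (f x $ i)) \<in> borel_measurable M"
  proof (rule borel_measurable_sum)
    fix i
    have "(\<lambda>y. axis i y :: 'b^'n) \<in> borel_measurable borel"
    proof (intro borel_measurable_continuous_onI linear_continuous_on)
      show "bounded_linear (\<lambda>y. axis i y :: 'b^'n)"
        unfolding linear_conv_bounded_linear[symmetric]
        by (rule linearI) (auto simp: axis_def vec_eq_iff)
    qed
    with f show "(\<lambda>x. axis i (f x $ i)) \<in> borel_measurable M"
      by (intro measurable_compose[OF _ \<open>(\<lambda>y. axis i y :: 'b^'n) \<in> borel_measurable borel\<close>]) (auto simp: L2_def)
  qed
  moreover have "(\<lambda>x. \<Sum>i\<in>UNIV. axis i (f x $ i)) = f"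
    by (auto simp: fun_eq_iff vec_eq_iff axis_def if_distrib sum.delta cong: if_cong)
  ultimately show "f \<in> L2 \<Omega>"
  proof (intro L2_bound)
    show "integrable M (\<lambda>x. \<Sum>i\<in>UNIV. (norm (f x $ i))\<^sup>2)" using f by (auto simp: L2_def)
    show "AE x in M. (norm (f x))\<^sup>2 \<le> (\<Sum>i\<in>UNIV. (norm (f x $ i))\<^sup>2)"
      by (simp add: norm_vec_def L2_set_def sum_nonneg)
  qed simp
qed

section \<open>Weak derivatives\<close>

lemma test_bounded: "\<phi> \<in> test_fun \<Omega> \<Longrightarrow> \<exists>C. AE x in M. \<bar>\<phi> x\<bar> \<le> C"
  using test_fun_bounded by (metis AE_I2)

lemma test_M: "\<phi> \<in> test_fun \<Omega> \<Longrightarrow> \<phi> \<in> borel_measurable M"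
  by (intro smooth_M test_fun_smooth)

lemma integrable_mult_test:
  fixes f :: "real^3 \<Rightarrow> real"
  shows "integrable M f \<Longrightarrow> \<phi> \<in> test_fun \<Omega> \<Longrightarrow> integrable M (\<lambda>x. f x * \<phi> x)"
  using integrable_mult_bounded test_M test_bounded by meson

lemma test_L2: "\<phi> \<in> test_fun \<Omega> \<Longrightarrow> \<phi> \<in> L2 \<Omega>"
  using test_bounded[of \<phi>] test_M bounded_L2[of \<phi>] by auto

lemma L2_mult_test: 
  fixes f :: "real^3 \<Rightarrow> real"
  shows "f \<in> L2 \<Omega> \<Longrightarrow> \<phi> \<in> test_fun \<Omega> \<Longrightarrow> (\<lambda>x. \<phi> x * f x) \<in> L2 \<Omega>"
  using L2_scaleR[of f \<phi>] test_bounded[of \<phi>] test_M[of \<phi>] by auto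

lemma integral_M_lborel_test:
  assumes f: "integrable M f" and F: "F \<in> borel_measurable borel" "\<And>x. x \<notin> \<Omega> \<Longrightarrow> F x = 0" "AE x in M. F x = f x"
    and \<phi>: "\<phi> \<in> test_fun \<Omega>"
  shows "(LINT x|M. f x * \<phi> x) = (LINT x|lborel. F x * \<phi> x)"
proof -
  note [measurable] = F(1) smooth_borel[OF test_fun_smooth[OF \<phi>]]
  have "(LINT x|M. f x * \<phi> x) = (LINT x|M. F x * \<phi> x)"
  proof (intro integral_cong_AE borel_measurable_times test_M[OF \<phi>] borel_imp_M[OF F(1)])
    show "AE x in M. f x * \<phi> x = F x * \<phi> x" using F(3) by eventually_elim simp
  qed (use f in auto)
  also have "\<dots> = (LINT x|lborel. F x * \<phi> x)"
    using F(2) by (intro integrable_M_lborel(2)) auto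
  finally show ?thesis .
qed

lemma representative_integrable:
  fixes f :: "real^3 \<Rightarrow> real"
  assumes f: "integrable M f" and F: "F \<in> borel_measurable borel" "\<And>x. x \<notin> \<Omega> \<Longrightarrow> F x = 0" "AE x in M. F x = f x"
  shows "integrable lborel F"
proof -
  have "integrable M F"
    using F(3) by (intro integrable_cong_AE_imp[OF f borel_imp_M[OF F(1)]]) (auto elim: eventually_mono)
  then show ?thesis using integrable_M_lborel(1)[OF F(1) F(2)] by simp
qed

lemma AE_zero_if_test:
  fixes f :: "real^3 \<Rightarrow> real"
  assumes f: "integrable M f" and 0: "\<And>\<phi>. \<phi> \<in> test_fun \<Omega> \<Longrightarrow> (LINT x|M. f x * \<phi> x) = 0"
  shows "AE x in M. f x = 0"
proof -
  obtain F where F: "F \<in> borel_measurable borel" "\<And>x. x \<notin> \<Omega> \<Longrightarrow> F x = 0" "AE x in M. F x = f x"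
    using borel_representative[of f] f by blast
  have "AE x in lborel. x \<in> \<Omega> \<longrightarrow> F x = 0"
    using representative_integrable[OF f F] open_dom 0 integral_M_lborel_test[OF f F]
    by (intro AE_zero_if_test_integrals_zero) auto
  then have "AE x in M. F x = 0" by (simp add: AE_M_iff)
  with F(3) show ?thesis by eventually_elim simp
qed

lemma weak_partial_unique:
  assumes "g \<in> L2 \<Omega>" "h \<in> L2 \<Omega>" "weak_partial \<Omega> i f g" "weak_partial \<Omega> i f h"
  shows "AE x in M. g x = h x"
proof -
  have "AE x in M. g x - h x = 0"
  proof (rule AE_zero_if_test)
    show "integrable M (\<lambda>x. g x - h x)" using assms L2_integrable by auto
    fix \<phi> assume \<phi>: "\<phi> \<in> test_fun \<Omega>"
    have "(LINT x|M. g x * \<phi> x) = (LINT x|M. h x * \<phi> x)"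
      using bspec[OF assms(3)[unfolded weak_partial_def] \<phi>] bspec[OF assms(4)[unfolded weak_partial_def] \<phi>] by simp
    then show "(LINT x|M. (g x - h x) * \<phi> x) = 0"
      using integrable_mult_test[OF L2_integrable[OF assms(1)] \<phi>] integrable_mult_test[OF L2_integrable[OF assms(2)] \<phi>]
      by (simp add: left_diff_distrib)
  qed
  then show ?thesis by eventually_elim simp
qed

lemma wpartial_works:
  assumes "g \<in> L2 \<Omega>" "weak_partial \<Omega> i f g"
  shows "wpartial \<Omega> i f \<in> L2 \<Omega>" "weak_partial \<Omega> i f (wpartial \<Omega> i f)"
  using someI[of "\<lambda>g. g \<in> L2 \<Omega> \<and> weak_partial \<Omega> i f g", OF conjI[OF assms]]
  by (simp_all add: wpartial_def)

lemma wpartial_AE: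
  assumes "g \<in> L2 \<Omega>" "weak_partial \<Omega> i f g"
  shows "AE x in M. wpartial \<Omega> i f x = g x"
  using weak_partial_unique wpartial_works assms by blast

lemma H1_L2: "f \<in> H1 \<Omega> \<Longrightarrow> f \<in> L2 \<Omega>"
  by (simp add: H1_def)

lemma H1_wpartial:
  assumes "f \<in> H1 \<Omega>"
  shows "wpartial \<Omega> i f \<in> L2 \<Omega>" "weak_partial \<Omega> i f (wpartial \<Omega> i f)"
  using assms wpartial_works unfolding H1_def by blast+

lemma H1I: "f \<in> L2 \<Omega> \<Longrightarrow> (\<And>i. g i \<in> L2 \<Omega>) \<Longrightarrow> (\<And>i. weak_partial \<Omega> i f (g i)) \<Longrightarrow> f \<in> H1 \<Omega>"
  unfolding H1_def by blast

lemma weak_partial_lin: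
  assumes "weak_partial \<Omega> i f g" "weak_partial \<Omega> i f' g'" "f \<in> L2 \<Omega>" "f' \<in> L2 \<Omega>" "g \<in> L2 \<Omega>" "g' \<in> L2 \<Omega>"
  shows "weak_partial \<Omega> i (\<lambda>x. a * f x + b * f' x) (\<lambda>x. a * g x + b * g' x)"
  unfolding weak_partial_def
proof
  fix \<phi> assume \<phi>: "\<phi> \<in> test_fun \<Omega>"
  note int = integrable_mult_test[OF L2_integrable]
  note i = int[OF assms(3) test_fun_partial[OF \<phi>, of i]] int[OF assms(4) test_fun_partial[OF \<phi>, of i]]
    int[OF assms(5) \<phi>] int[OF assms(6) \<phi>]
  have "(LINT x|M. (a * f x + b * f' x) * partial i \<phi> x) =
      a * (LINT x|M. f x * partial i \<phi> x) + b * (LINT x|M. f' x * partial i \<phi> x)"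
    using i(1,2) by (simp add: distrib_right mult.assoc)
  also have "\<dots> = - (a * (LINT x|M. g x * \<phi> x) + b * (LINT x|M. g' x * \<phi> x))"
    using assms(1,2) \<phi> by (simp add: weak_partial_def)
  also have "\<dots> = - (LINT x|M. (a * g x + b * g' x) * \<phi> x)"
    using i(3,4) by (simp add: distrib_right mult.assoc)
  finally show "(LINT x|M. (a * f x + b * f' x) * partial i \<phi> x) = - (LINT x|M. (a * g x + b * g' x) * \<phi> x)" .
qed

lemma integral_test_zero:
  assumes \<phi>: "\<phi> \<in> test_fun \<Omega>" shows "(LINT x|M. partial i \<phi> x) = 0"
proof -
  obtain K where "compact K" "K \<subseteq> \<Omega>" "\<And>x. x \<notin> K \<Longrightarrow> partial i \<phi> x = 0"
    using test_fun_partial[OF \<phi>] unfolding test_fun_iff by blast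
  then have "(LINT x|M. partial i \<phi> x) = (LINT x|lborel. partial i \<phi> x)"
    using smooth_borel[OF smooth_partial[OF test_fun_smooth[OF \<phi>]]] by (intro integrable_M_lborel(2)) auto
  then show ?thesis using integral_partial_test_fun[OF \<phi>] by simp
qed

lemma weak_partial_const: "weak_partial \<Omega> i (\<lambda>x. c) (\<lambda>x. 0)"
  unfolding weak_partial_def using integral_test_zero by simp

lemma weak_partial_test:
  assumes \<phi>: "\<phi> \<in> test_fun \<Omega>" shows "weak_partial \<Omega> i \<phi> (partial i \<phi>)"
  unfolding weak_partial_def
proof
  fix \<psi> assume \<psi>: "\<psi> \<in> test_fun \<Omega>"
  note d = smooth_differentiable[OF test_fun_smooth]
  have "(LINT x|M. partial i \<phi> x * \<psi> x + \<phi> x * partial i \<psi> x) = (LINT x|M. partial i (\<lambda>x. \<phi> x * \<psi> x) x)"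
    using d[OF \<phi>] d[OF \<psi>] by (simp add: partial_mult)
  also have "\<dots> = 0" by (intro integral_test_zero test_fun_mult \<psi> test_fun_smooth[OF \<phi>])
  finally show "(LINT x|M. \<phi> x * partial i \<psi> x) = - (LINT x|M. partial i \<phi> x * \<psi> x)"
    using integrable_mult_test[OF L2_integrable[OF test_L2[OF \<phi>]] test_fun_partial[OF \<psi>, of i]]
      integrable_mult_test[OF L2_integrable[OF test_L2[OF test_fun_partial[OF \<phi>, of i]]] \<psi>] by simp
qed

text \<open>The smooth factor is moved into the test function, where the classical product rule
  produces the extra term.\<close>

lemma weak_partial_mult_test:
  assumes f: "f \<in> L2 \<Omega>" and g: "g \<in> L2 \<Omega>" and wp: "weak_partial \<Omega> i f g" and \<phi>: "\<phi> \<in> test_fun \<Omega>"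
  shows "weak_partial \<Omega> i (\<lambda>x. \<phi> x * f x) (\<lambda>x. partial i \<phi> x * f x + \<phi> x * g x)"
  unfolding weak_partial_def
proof
  fix \<psi> assume \<psi>: "\<psi> \<in> test_fun \<Omega>"
  note d = smooth_differentiable[OF test_fun_smooth]
  note int = integrable_mult_test[OF L2_integrable]
  have t: "(\<lambda>x. \<phi> x * \<psi> x) \<in> test_fun \<Omega>" by (intro test_fun_mult \<psi> test_fun_smooth[OF \<phi>])
  have p: "partial i (\<lambda>x. \<phi> x * \<psi> x) x = partial i \<phi> x * \<psi> x + \<phi> x * partial i \<psi> x" for x
    using d[OF \<phi>] d[OF \<psi>] by (simp add: partial_mult)
  have i1: "integrable M (\<lambda>x. f x * (partial i \<phi> x * \<psi> x))"
    by (intro int f test_fun_mult \<psi> smooth_partial test_fun_smooth[OF \<phi>])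
  have i2: "integrable M (\<lambda>x. f x * (\<phi> x * partial i \<psi> x))"
    by (intro int f test_fun_mult test_fun_partial[OF \<psi>] test_fun_smooth[OF \<phi>])
  have i3: "integrable M (\<lambda>x. g x * (\<phi> x * \<psi> x))"
    by (intro int g t)
  have "(LINT x|M. f x * (partial i \<phi> x * \<psi> x)) + (LINT x|M. f x * (\<phi> x * partial i \<psi> x))
      = - (LINT x|M. g x * (\<phi> x * \<psi> x))"
    using wp t i1 i2 by (auto simp: weak_partial_def p distrib_left)
  then have "(LINT x|M. f x * (\<phi> x * partial i \<psi> x)) =
      - ((LINT x|M. f x * (partial i \<phi> x * \<psi> x)) + (LINT x|M. g x * (\<phi> x * \<psi> x)))" by simp
  also have "\<dots> = - (LINT x|M. f x * (partial i \<phi> x * \<psi> x) + g x * (\<phi> x * \<psi> x))"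
    using i1 i3 by simp
  finally show "(LINT x|M. \<phi> x * f x * partial i \<psi> x) = - (LINT x|M. (partial i \<phi> x * f x + \<phi> x * g x) * \<psi> x)"
    by (simp add: algebra_simps)
qed

text \<open>\<open>weak_product_rule\<close> asks for bounds at every point, whereas the bound on f
  holds only almost everywhere; clipping repairs the exceptional null set.\<close>

lemma clipped_representative:
  fixes f :: "real^3 \<Rightarrow> real"
  assumes f: "f \<in> borel_measurable M" and C: "AE x in M. \<bar>f x\<bar> \<le> C"
  obtains F C' where "F \<in> borel_measurable borel" "\<And>x. x \<notin> \<Omega> \<Longrightarrow> F x = 0" "AE x in M. F x = f x" "\<And>x. \<bar>F x\<bar> \<le> C'"
proof -
  obtain F where F: "F \<in> borel_measurable borel" "\<And>x. x \<notin> \<Omega> \<Longrightarrow> F x = 0" "AE x in M. F x = f x"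
    using borel_representative[OF f] by blast
  show thesis
  proof
    show "(\<lambda>x. max (- \<bar>C\<bar>) (min \<bar>C\<bar> (F x))) \<in> borel_measurable borel" using F(1) by measurable
    show "AE x in M. max (- \<bar>C\<bar>) (min \<bar>C\<bar> (F x)) = f x"
      using F(3) C by eventually_elim auto
    show "\<bar>max (- \<bar>C\<bar>) (min \<bar>C\<bar> (F x))\<bar> \<le> \<bar>C\<bar>" for x by auto
  qed (use F in auto)
qed

text \<open>\<open>weak_product_rule\<close> for suitable representatives of all four functions,
  translated back to \<Omega>.\<close>

lemma weak_partial_prod:
  assumes f: "f \<in> L2 \<Omega>" "AE x in M. \<bar>f x\<bar> \<le> C" and f': "f' \<in> L2 \<Omega>" "AE x in M. \<bar>f' x\<bar> \<le> C'"
    and g: "g \<in> L2 \<Omega>" "weak_partial \<Omega> i f g" and g': "g' \<in> L2 \<Omega>" "weak_partial \<Omega> i f' g'"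
  shows "weak_partial \<Omega> i (\<lambda>x. f x * f' x) (\<lambda>x. f x * g' x + g x * f' x)"
  unfolding weak_partial_def
proof
  fix \<phi> assume \<phi>: "\<phi> \<in> test_fun \<Omega>"
  obtain F D where F: "F \<in> borel_measurable borel" "\<And>x. x \<notin> \<Omega> \<Longrightarrow> F x = 0" "AE x in M. F x = f x" "\<And>x. \<bar>F x\<bar> \<le> D"
    using clipped_representative[OF L2_measurable[OF f(1)] f(2)] by blast
  obtain F' D' where F': "F' \<in> borel_measurable borel" "\<And>x. x \<notin> \<Omega> \<Longrightarrow> F' x = 0" "AE x in M. F' x = f' x" "\<And>x. \<bar>F' x\<bar> \<le> D'"
    using clipped_representative[OF L2_measurable[OF f'(1)] f'(2)] by blast
  obtain G where G: "G \<in> borel_measurable borel" "\<And>x. x \<notin> \<Omega> \<Longrightarrow> G x = 0" "AE x in M. G x = g x"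
    using borel_representative[OF L2_measurable[OF g(1)]] by blast
  obtain G' where G': "G' \<in> borel_measurable borel" "\<And>x. x \<notin> \<Omega> \<Longrightarrow> G' x = 0" "AE x in M. G' x = g' x"
    using borel_representative[OF L2_measurable[OF g'(1)]] by blast
  note li = L2_integrable[OF f(1)] L2_integrable[OF f'(1)] L2_integrable[OF g(1)] L2_integrable[OF g'(1)]
  have ff': "integrable M (\<lambda>x. f x * f' x)" by (rule L2_mult_integrable[OF f(1) f'(1)])
  have gg': "integrable M (\<lambda>x. f x * g' x + g x * f' x)"
    using L2_mult_integrable[OF f(1) g'(1)] L2_mult_integrable[OF g(1) f'(1)] by simp
  have W: "(LINT x|lborel. F x * partial i \<phi> x) = - (LINT x|lborel. G x * \<phi> x)" if "\<phi> \<in> test_fun \<Omega>" for \<phi>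
    using g(2) that integral_M_lborel_test[OF li(1) F(1-3) test_fun_partial[OF that, of i]]
      integral_M_lborel_test[OF li(3) G that] by (simp add: weak_partial_def)
  have W': "(LINT x|lborel. F' x * partial i \<phi> x) = - (LINT x|lborel. G' x * \<phi> x)" if "\<phi> \<in> test_fun \<Omega>" for \<phi>
    using g'(2) that integral_M_lborel_test[OF li(2) F'(1-3) test_fun_partial[OF that, of i]]
      integral_M_lborel_test[OF li(4) G' that] by (simp add: weak_partial_def)
  have "(LINT x|M. f x * f' x * partial i \<phi> x) = (LINT x|lborel. F x * F' x * partial i \<phi> x)"
  proof (rule integral_M_lborel_test[OF ff' _ _ _ test_fun_partial[OF \<phi>]])
    show "AE x in M. F x * F' x = f x * f' x" using F(3) F'(3) by eventually_elim simp
  qed (use F F' in auto)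
  also have "\<dots> = - (LINT x|lborel. (F x * G' x + G x * F' x) * \<phi> x)"
    by (rule weak_product_rule[OF open_dom bounded_dom representative_integrable[OF li(1) F(1-3)] F(4,2)
        representative_integrable[OF li(2) F'(1-3)] F'(4,2) representative_integrable[OF li(3) G] G(2)
        representative_integrable[OF li(4) G'] G'(2) W W' \<phi>])
  also have "(LINT x|lborel. (F x * G' x + G x * F' x) * \<phi> x) = (LINT x|M. (f x * g' x + g x * f' x) * \<phi> x)"
  proof (rule integral_M_lborel_test[OF gg' _ _ _ \<phi>, symmetric])
    show "AE x in M. F x * G' x + G x * F' x = f x * g' x + g x * f' x"
      using F(3) F'(3) G(3) G'(3) by eventually_elim simp
  qed (use F F' G G' in auto)
  finally show "(LINT x|M. f x * f' x * partial i \<phi> x) = - (LINT x|M. (f x * g' x + g x * f' x) * \<phi> x)" .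
qed


section \<open>Gradients, approximation in \<open>H10\<close> and integration by parts\<close>

definition grad :: "(real^3 \<Rightarrow> real) \<Rightarrow> real^3 \<Rightarrow> real^3" where
  "grad \<phi> x = (\<chi> i. partial i \<phi> x)"

lemma grad_L2: "\<phi> \<in> test_fun \<Omega> \<Longrightarrow> grad \<phi> \<in> L2 \<Omega>"
  by (simp add: L2_vec grad_def test_L2 test_fun_partial)

lemma wgrad_AE:
  assumes "g \<in> L2 \<Omega>" "\<And>i. weak_partial \<Omega> i f (\<lambda>x. g x $ i)"
  shows "AE x in M. wgrad \<Omega> f x = g x"
proof -
  have "AE x in M. \<forall>i. wpartial \<Omega> i f x = g x $ i"
    using assms by (subst AE_all_countable) (auto simp: L2_vec intro: wpartial_AE)
  then show ?thesis by eventually_elim (simp add: wgrad_def vec_eq_iff)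
qed

lemma wgrad_L2: "f \<in> H1 \<Omega> \<Longrightarrow> wgrad \<Omega> f \<in> L2 \<Omega>"
  by (simp add: L2_vec wgrad_def H1_wpartial)

lemma test_H1: "\<phi> \<in> test_fun \<Omega> \<Longrightarrow> \<phi> \<in> H1 \<Omega>"
  by (rule H1I[OF test_L2 test_L2[OF test_fun_partial] weak_partial_test])

lemma wgrad_test: "\<phi> \<in> test_fun \<Omega> \<Longrightarrow> AE x in M. wgrad \<Omega> \<phi> x = grad \<phi> x"
  by (rule wgrad_AE[OF grad_L2]) (auto simp: grad_def weak_partial_test)

lemma test_Linf: "\<phi> \<in> test_fun \<Omega> \<Longrightarrow> \<phi> \<in> Linf \<Omega>"
  by (simp add: Linf_def test_M test_bounded)

lemma Linf_L2: "f \<in> Linf \<Omega> \<Longrightarrow> f \<in> L2 \<Omega>"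
  unfolding Linf_def using bounded_L2[of f] by auto

lemma L2_norm_sq: "(L2_norm \<Omega> f)\<^sup>2 = (LINT x|M. (norm (f x))\<^sup>2)"
  by (simp add: L2_norm_def)

text \<open>Monotone convergence for series: the integral of the sum is the finite sum of the
  integrals.\<close>

lemma AE_summable:
  fixes f :: "nat \<Rightarrow> real^3 \<Rightarrow> real"
  assumes f: "\<And>i. integrable M (f i)" "\<And>i x. 0 \<le> f i x" and sum: "summable (\<lambda>i. LINT x|M. f i x)"
  shows "AE x in M. summable (\<lambda>i. f i x)" "integrable M (\<lambda>x. \<Sum>i. f i x)"
proof -
  have [measurable]: "f i \<in> borel_measurable M" for i using f by auto
  have "(\<integral>\<^sup>+x. (\<Sum>i. ennreal (f i x)) \<partial>M) = (\<Sum>i. \<integral>\<^sup>+x. ennreal (f i x) \<partial>M)"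
    by (rule nn_integral_suminf) auto
  also have "\<dots> = (\<Sum>i. ennreal (LINT x|M. f i x))"
    using f by (simp add: nn_integral_eq_integral)
  also have "\<dots> = ennreal (\<Sum>i. LINT x|M. f i x)"
    using f sum by (intro suminf_ennreal2) auto
  finally have "(\<integral>\<^sup>+x. (\<Sum>i. ennreal (f i x)) \<partial>M) \<noteq> \<infinity>" by simp
  then have "AE x in M. (\<Sum>i. ennreal (f i x)) \<noteq> \<infinity>" by (intro nn_integral_PInf_AE) auto
  then show *: "AE x in M. summable (\<lambda>i. f i x)"
    by eventually_elim (use f in \<open>auto intro!: summable_suminf_not_top\<close>)
  show "integrable M (\<lambda>x. \<Sum>i. f i x)"
    using f sum * by (intro integrable_suminf) auto
qed

text \<open>Norm convergence alone gives neither pointwise limits nor a majorant. Choosing the test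
  functions at distance below \<open>(1/2)^j\<close> makes the squared errors so summable that one
  integrable function s dominates the whole sequence and its partial derivatives.\<close>

lemma H10_approx:
  assumes f: "f \<in> H10 \<Omega>"
  obtains \<phi> s where "\<And>j. \<phi> j \<in> test_fun \<Omega>" "integrable M s"
    "AE x in M. (\<lambda>j. \<phi> j x) \<longlonglongrightarrow> f x \<and> (\<forall>j. (\<phi> j x)\<^sup>2 \<le> s x) \<and>
      (\<forall>i. (\<lambda>j. partial i (\<phi> j) x) \<longlonglongrightarrow> wpartial \<Omega> i f x \<and> (\<forall>j. (partial i (\<phi> j) x)\<^sup>2 \<le> s x))"
proof -
  have H1: "f \<in> H1 \<Omega>" using f by (simp add: H10_def)
  have "\<forall>j. \<exists>\<phi>. \<phi> \<in> test_fun \<Omega> \<and> H1_norm \<Omega> (\<lambda>x. f x - \<phi> x) < (1/2) ^ j"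
  proof
    fix j :: nat
    have "\<exists>\<phi>\<in>test_fun \<Omega>. H1_norm \<Omega> (\<lambda>x. f x - \<phi> x) < e" if "e > 0" for e
      using f that by (simp add: H10_def)
    from this[of "(1/2) ^ j"] show "\<exists>\<phi>. \<phi> \<in> test_fun \<Omega> \<and> H1_norm \<Omega> (\<lambda>x. f x - \<phi> x) < (1/2) ^ j" by auto
  qed
  then obtain \<phi> where \<phi>: "\<And>j. \<phi> j \<in> test_fun \<Omega>" "\<And>j. H1_norm \<Omega> (\<lambda>x. f x - \<phi> j x) < (1/2) ^ j"
    by metis
  define D where "D j x = (f x - \<phi> j x)\<^sup>2 + (norm (wgrad \<Omega> f x - grad (\<phi> j) x))\<^sup>2" for j x
  have L1: "(\<lambda>x. f x - \<phi> j x) \<in> L2 \<Omega>" for j by (intro L2_diff H1_L2 H1 test_L2 \<phi>)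
  have Lg: "(\<lambda>x. wgrad \<Omega> f x - grad (\<phi> j) x) \<in> L2 \<Omega>" for j by (intro L2_diff wgrad_L2 H1 grad_L2 \<phi>)
  have Dint: "integrable M (D j)" for j
    unfolding D_def using L2_sq[OF L1[of j]] L2_sq[OF Lg[of j]] by simp
  have Dnn: "0 \<le> D j x" for j x by (simp add: D_def)
  have Dle: "(LINT x|M. D j x) \<le> (1/4) ^ j" for j
  proof -
    have ae: "AE x in M. wgrad \<Omega> (\<lambda>x. f x - \<phi> j x) x = wgrad \<Omega> f x - grad (\<phi> j) x"
    proof (rule wgrad_AE[OF Lg])
      fix i
      have "weak_partial \<Omega> i (\<lambda>x. 1 * f x + (-1) * \<phi> j x) (\<lambda>x. 1 * wpartial \<Omega> i f x + (-1) * partial i (\<phi> j) x)"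
        by (intro weak_partial_lin H1_wpartial H1 weak_partial_test \<phi> H1_L2 test_L2 test_fun_partial)
      then show "weak_partial \<Omega> i (\<lambda>x. f x - \<phi> j x) (\<lambda>x. (wgrad \<Omega> f x - grad (\<phi> j) x) $ i)"
        by (simp add: wgrad_def grad_def)
    qed
    have "(LINT x|M. D j x) = (LINT x|M. (norm (f x - \<phi> j x))\<^sup>2) + (LINT x|M. (norm (wgrad \<Omega> f x - grad (\<phi> j) x))\<^sup>2)"
      unfolding D_def using L2_sq[OF L1[of j]] L2_sq[OF Lg[of j]] by simp
    also have "(LINT x|M. (norm (wgrad \<Omega> f x - grad (\<phi> j) x))\<^sup>2) =
        (LINT x|M. (norm (wgrad \<Omega> (\<lambda>x. f x - \<phi> j x) x))\<^sup>2)"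
    proof (rule integral_cong_AE)
      have "wgrad \<Omega> (\<lambda>x. f x - \<phi> j x) \<in> L2 \<Omega>"
        by (rule L2_cong_AE[OF Lg]) (use ae in \<open>auto elim: eventually_mono\<close>)
      then show "(\<lambda>x. (norm (wgrad \<Omega> (\<lambda>x. f x - \<phi> j x) x))\<^sup>2) \<in> borel_measurable M"
        by (auto dest: L2_sq)
      show "AE x in M. (norm (wgrad \<Omega> f x - grad (\<phi> j) x))\<^sup>2 = (norm (wgrad \<Omega> (\<lambda>x. f x - \<phi> j x) x))\<^sup>2"
        using ae by eventually_elim simp
    qed (use L2_sq[OF Lg[of j]] in auto)
    also have "(LINT x|M. (norm (f x - \<phi> j x))\<^sup>2) + \<dots> = (H1_norm \<Omega> (\<lambda>x. f x - \<phi> j x))\<^sup>2"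
      by (simp add: H1_norm_def L2_norm_sq)
    also have "\<dots> \<le> ((1/2) ^ j)\<^sup>2"
      using \<phi>(2)[of j] by (intro power_mono) (auto simp: H1_norm_def)
    also have "\<dots> = (1/4) ^ j" by (simp add: power2_eq_square power_mult_distrib[symmetric])
    finally show ?thesis .
  qed
  \<comment> \<open>The squared errors have integral at most \<open>(1/4)^j\<close>, so the weight
    \<open>2^j\<close> still leaves a convergent series. It pays twice: \<open>D j x\<close> is at
    most S x, and at most \<open>(1/2)^j * S x\<close>, which tends to 0 wherever the series
    converges.\<close>
  define S where "S x = (\<Sum>j. 2 ^ j * D j x)" for x
  have sm: "summable (\<lambda>j. LINT x|M. 2 ^ j * D j x)"
  proof (rule summable_comparison_test)
    show "summable (\<lambda>j. (1/2 :: real) ^ j)" by (rule summable_geometric) simp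
    have "norm (LINT x|M. 2 ^ j * D j x) \<le> (1/2) ^ j" for j
    proof -
      have "norm (LINT x|M. 2 ^ j * D j x) = 2 ^ j * (LINT x|M. D j x)"
        using Dnn by (simp add: abs_mult)
      also have "\<dots> \<le> 2 ^ j * (1/4) ^ j" using Dle by (intro mult_left_mono) auto
      also have "\<dots> = (1/2 :: real) ^ j" by (simp add: power_mult_distrib[symmetric])
      finally show ?thesis .
    qed
    then show "\<exists>N. \<forall>j\<ge>N. norm (LINT x|M. 2 ^ j * D j x) \<le> (1/2) ^ j" by blast
  qed
  have S: "AE x in M. summable (\<lambda>j. 2 ^ j * D j x)" "integrable M S"
    unfolding S_def using Dint Dnn sm by (intro AE_summable; simp)+
  \<comment> \<open>Tailored to \<open>a^2 \<le> 2 * b^2 + 2 * (b - a)^2\<close>, with b the limit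
    and a the approximant, for the values and each partial derivative at once.\<close>
  define s where "s x = 2 * (f x)\<^sup>2 + 2 * (norm (wgrad \<Omega> f x))\<^sup>2 + 2 * S x" for x
  show thesis
  proof (rule that[of \<phi> s])
    show "integrable M s"
      unfolding s_def using L2_sq[OF H1_L2[OF H1]] L2_sq[OF wgrad_L2[OF H1]] S(2) by simp
    show "AE x in M. (\<lambda>j. \<phi> j x) \<longlonglongrightarrow> f x \<and> (\<forall>j. (\<phi> j x)\<^sup>2 \<le> s x) \<and>
      (\<forall>i. (\<lambda>j. partial i (\<phi> j) x) \<longlonglongrightarrow> wpartial \<Omega> i f x \<and> (\<forall>j. (partial i (\<phi> j) x)\<^sup>2 \<le> s x))"
      using S(1)
    proof eventually_elim
      case (elim x)
      have Dj: "2 ^ j * D j x \<le> S x" for j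
      proof -
        have "(\<Sum>i\<in>{j}. 2 ^ i * D i x) \<le> (\<Sum>i. 2 ^ i * D i x)"
          by (rule sum_le_suminf[OF elim]) (auto simp: Dnn)
        then show ?thesis by (simp add: S_def)
      qed
      have DS: "D j x \<le> S x" for j
        using Dj[of j] mult_right_mono[of 1 "2 ^ j" "D j x"] Dnn[of j x] by auto
      have D0: "(\<lambda>j. D j x) \<longlonglongrightarrow> 0"
      proof (rule tendsto_sandwich[of "\<lambda>_. 0" _ _ "\<lambda>j. (1/2) ^ j * S x"])
        show "\<forall>\<^sub>F j in sequentially. D j x \<le> (1/2) ^ j * S x"
          using Dj by (auto simp: field_simps power_divide)
        show "(\<lambda>j. (1/2) ^ j * S x) \<longlonglongrightarrow> 0"
          by (intro tendsto_mult_left_zero LIMSEQ_realpow_zero) auto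
      qed (auto simp: Dnn)
      have key: "(\<lambda>j. a j) \<longlonglongrightarrow> b \<and> (\<forall>j. (a j)\<^sup>2 \<le> s x)"
        if ab: "\<And>j. (b - a j)\<^sup>2 \<le> D j x" and b: "2 * b\<^sup>2 + 2 * S x \<le> s x" for a :: "nat \<Rightarrow> real" and b
      proof
        have "(\<lambda>j. sqrt (D j x)) \<longlonglongrightarrow> sqrt 0" by (intro tendsto_real_sqrt D0)
        then have lim0: "(\<lambda>j. sqrt (D j x)) \<longlonglongrightarrow> 0" by simp
        have le: "norm (a j - b) \<le> sqrt (D j x)" for j
          using ab[of j] by (intro real_le_rsqrt) (simp add: power2_commute)
        have "\<forall>\<^sub>F j in sequentially. norm (a j - b) \<le> sqrt (D j x)"
          by (intro always_eventually allI le)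
        from Lim_null_comparison[OF this lim0] have "(\<lambda>j. a j - b) \<longlonglongrightarrow> 0" .
        then show "a \<longlonglongrightarrow> b" by (simp add: LIM_zero_iff)
        show "\<forall>j. (a j)\<^sup>2 \<le> s x"
        proof
          fix j
          have "(a j)\<^sup>2 \<le> 2 * b\<^sup>2 + 2 * (b - a j)\<^sup>2"
            using zero_le_power2[of "2 * b - a j"] by (simp add: power2_eq_square algebra_simps)
          then show "(a j)\<^sup>2 \<le> s x" using ab[of j] DS[of j] b by linarith
        qed
      qed
      have "(\<lambda>j. \<phi> j x) \<longlonglongrightarrow> f x \<and> (\<forall>j. (\<phi> j x)\<^sup>2 \<le> s x)"
        by (rule key) (auto simp: D_def s_def)
      moreover have "(\<lambda>j. partial i (\<phi> j) x) \<longlonglongrightarrow> wpartial \<Omega> i f x \<and> (\<forall>j. (partial i (\<phi> j) x)\<^sup>2 \<le> s x)" for i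
      proof (rule key)
        fix j
        have "\<bar>(wgrad \<Omega> f x - grad (\<phi> j) x) $ i\<bar> \<le> norm (wgrad \<Omega> f x - grad (\<phi> j) x)"
          by (rule component_le_norm_cart)
        then have "\<bar>(wgrad \<Omega> f x - grad (\<phi> j) x) $ i\<bar>\<^sup>2 \<le> (norm (wgrad \<Omega> f x - grad (\<phi> j) x))\<^sup>2"
          by (rule power_mono) simp
        then show "(wpartial \<Omega> i f x - partial i (\<phi> j) x)\<^sup>2 \<le> D j x"
          by (simp add: D_def wgrad_def grad_def add_increasing)
      next
        have "\<bar>wgrad \<Omega> f x $ i\<bar>\<^sup>2 \<le> (norm (wgrad \<Omega> f x))\<^sup>2"
          by (intro power_mono component_le_norm_cart) simp
        then have "(wpartial \<Omega> i f x)\<^sup>2 \<le> (norm (wgrad \<Omega> f x))\<^sup>2" by (simp add: wgrad_def)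
        moreover have "0 \<le> (f x)\<^sup>2" by simp
        ultimately show "2 * (wpartial \<Omega> i f x)\<^sup>2 + 2 * S x \<le> s x" unfolding s_def by linarith
      qed
      ultimately show ?case by blast
    qed
  qed (rule \<phi>)
qed

text \<open>For a test function in place of f this is the definition of the weak derivative of
  \<open>\<xi>\<close>; \<open>H10_approx\<close> passes to the limit. The vanishing boundary values
  are those of f, while \<open>\<xi>\<close> ranges over all of \<open>H1\<close>.\<close>

lemma H10_integration_by_parts:
  assumes f: "f \<in> H10 \<Omega>" and \<xi>: "\<xi> \<in> H1 \<Omega>"
  shows "(LINT x|M. f x * wpartial \<Omega> i \<xi> x) = - (LINT x|M. wpartial \<Omega> i f x * \<xi> x)"
proof -
  obtain \<phi> s where \<phi>: "\<And>j. \<phi> j \<in> test_fun \<Omega>" and s: "integrable M s"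
    and ae: "AE x in M. (\<lambda>j. \<phi> j x) \<longlonglongrightarrow> f x \<and> (\<forall>j. (\<phi> j x)\<^sup>2 \<le> s x) \<and>
      (\<forall>i. (\<lambda>j. partial i (\<phi> j) x) \<longlonglongrightarrow> wpartial \<Omega> i f x \<and> (\<forall>j. (partial i (\<phi> j) x)\<^sup>2 \<le> s x))"
    using H10_approx[OF f] by blast
  have fH1: "f \<in> H1 \<Omega>" using f by (simp add: H10_def)
  have lim: "(\<lambda>j. LINT x|M. a j x * h x) \<longlonglongrightarrow> (LINT x|M. b x * h x)"
    if h: "h \<in> L2 \<Omega>" and a: "\<And>j. a j \<in> test_fun \<Omega>" and b: "b \<in> L2 \<Omega>"
      and ab: "AE x in M. (\<lambda>j. a j x) \<longlonglongrightarrow> b x \<and> (\<forall>j. (a j x)\<^sup>2 \<le> s x)" for a h b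
  proof (rule integral_dominated_convergence)
    show "integrable M (\<lambda>x. s x + (h x)\<^sup>2)" using s L2_sq[OF h] by simp
    show "AE x in M. (\<lambda>j. a j x * h x) \<longlonglongrightarrow> b x * h x"
      using ab by eventually_elim (auto intro: tendsto_intros)
    show "AE x in M. norm (a j x * h x) \<le> s x + (h x)\<^sup>2" for j
      using ab
    proof eventually_elim
      case (elim x)
      have "2 * \<bar>a j x * h x\<bar> \<le> (a j x)\<^sup>2 + (h x)\<^sup>2"
        using sum_squares_bound[of "\<bar>a j x\<bar>" "\<bar>h x\<bar>"] by (simp add: abs_mult)
      moreover have "(a j x)\<^sup>2 \<le> s x" using elim by blast
      moreover have "0 \<le> \<bar>a j x * h x\<bar>" by simp
      ultimately show ?case by simp
    qed
  qed (use test_M[OF a] L2_measurable[OF h] L2_measurable[OF b] in auto)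
  have 1: "(\<lambda>j. LINT x|M. \<phi> j x * wpartial \<Omega> i \<xi> x) \<longlonglongrightarrow> (LINT x|M. f x * wpartial \<Omega> i \<xi> x)"
    by (rule lim[OF H1_wpartial(1)[OF \<xi>] \<phi> H1_L2[OF fH1]]) (use ae in \<open>auto elim: eventually_mono\<close>)
  have 2: "(\<lambda>j. LINT x|M. partial i (\<phi> j) x * \<xi> x) \<longlonglongrightarrow> (LINT x|M. wpartial \<Omega> i f x * \<xi> x)"
    by (rule lim[OF H1_L2[OF \<xi>] test_fun_partial[OF \<phi>] H1_wpartial(1)[OF fH1]])
       (use ae in \<open>auto elim: eventually_mono\<close>)
  have "(LINT x|M. \<phi> j x * wpartial \<Omega> i \<xi> x) = - (LINT x|M. partial i (\<phi> j) x * \<xi> x)" for j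
    using H1_wpartial(2)[OF \<xi>, of i] \<phi>[of j] by (simp add: weak_partial_def mult.commute)
  with 1 have "(\<lambda>j. - (LINT x|M. partial i (\<phi> j) x * \<xi> x)) \<longlonglongrightarrow> (LINT x|M. f x * wpartial \<Omega> i \<xi> x)" by simp
  from LIMSEQ_unique[OF this tendsto_minus[OF 2]] show ?thesis .
qed

lemma vH10_comp: "v \<in> vH10 \<Omega> \<Longrightarrow> (\<lambda>x. v x $ i) \<in> H10 \<Omega>"
  by (simp add: vH10_def)

lemma vH10_H1: "v \<in> vH10 \<Omega> \<Longrightarrow> (\<lambda>x. v x $ i) \<in> H1 \<Omega>"
  using vH10_comp[of v i] by (simp add: H10_def)

lemma vH10_L2: "v \<in> vH10 \<Omega> \<Longrightarrow> v \<in> L2 \<Omega>"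
  using H1_L2[OF vH10_H1[of v]] by (simp add: L2_vec)

lemma wjac_L2: "v \<in> vH10 \<Omega> \<Longrightarrow> wjac \<Omega> v \<in> L2 \<Omega>"
  by (simp add: L2_vec wjac_def H1_wpartial[OF vH10_H1])

lemma wdiv_L2: "v \<in> vH10 \<Omega> \<Longrightarrow> wdiv \<Omega> v \<in> L2 \<Omega>"
  unfolding wdiv_def[abs_def] trace_def wjac_def
  by (auto intro!: L2_sum H1_wpartial[OF vH10_H1])

lemma vH10_divergence:
  assumes v: "v \<in> vH10 \<Omega>" and \<xi>: "\<xi> \<in> H1 \<Omega>"
  shows "(LINT x|M. v x \<bullet> wgrad \<Omega> \<xi> x) = - (LINT x|M. wdiv \<Omega> v x * \<xi> x)"
proof -
  have "(LINT x|M. v x \<bullet> wgrad \<Omega> \<xi> x) = (LINT x|M. (\<Sum>i\<in>UNIV. v x $ i * wpartial \<Omega> i \<xi> x))"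
    by (simp add: inner_vec_def wgrad_def)
  also have "\<dots> = (\<Sum>i\<in>UNIV. (LINT x|M. v x $ i * wpartial \<Omega> i \<xi> x))"
    by (intro Bochner_Integration.integral_sum L2_mult_integrable H1_L2[OF vH10_H1[OF v]] H1_wpartial[OF \<xi>])
  also have "\<dots> = - (\<Sum>i\<in>UNIV. (LINT x|M. wpartial \<Omega> i (\<lambda>y. v y $ i) x * \<xi> x))"
    by (simp add: H10_integration_by_parts[OF vH10_comp[OF v] \<xi>] sum_negf)
  also have "(\<Sum>i\<in>UNIV. (LINT x|M. wpartial \<Omega> i (\<lambda>y. v y $ i) x * \<xi> x)) =
      (LINT x|M. (\<Sum>i\<in>UNIV. wpartial \<Omega> i (\<lambda>y. v y $ i) x * \<xi> x))"
    by (intro Bochner_Integration.integral_sum[symmetric] L2_mult_integrable H1_wpartial[OF vH10_H1[OF v]] H1_L2[OF \<xi>])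
  also have "\<dots> = (LINT x|M. wdiv \<Omega> v x * \<xi> x)"
    by (simp add: wdiv_def trace_def wjac_def sum_distrib_right)
  finally show ?thesis .
qed

section \<open>Solenoidal fields and the density equation\<close>

text \<open>Testing with all of \<open>H1\<close> instead of test functions only encodes zero
  divergence together with a zero normal trace on the boundary. This is the right notion for the
  projected velocities, which are merely square integrable.\<close>

definition solenoidal :: "(real^3 \<Rightarrow> real^3) \<Rightarrow> bool" where
  "solenoidal w \<longleftrightarrow> w \<in> L2 \<Omega> \<and> (\<forall>\<xi>\<in>H1 \<Omega>. (LINT x|M. w x \<bullet> wgrad \<Omega> \<xi> x) = 0)"

lemma solenoidal_initial:
  assumes v: "v \<in> vH10 \<Omega>" and div0: "AE x in M. wdiv \<Omega> v x = 0"
  shows "solenoidal v"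
  unfolding solenoidal_def
proof (intro conjI ballI vH10_L2[OF v])
  fix \<xi> assume \<xi>: "\<xi> \<in> H1 \<Omega>"
  have "(LINT x|M. wdiv \<Omega> v x * \<xi> x) = (LINT x|M. 0)"
    using div0 L2_measurable[OF wdiv_L2[OF v]] L2_measurable[OF H1_L2[OF \<xi>]]
    by (intro integral_cong_AE) (auto elim: eventually_mono)
  then show "(LINT x|M. v x \<bullet> wgrad \<Omega> \<xi> x) = 0" using vH10_divergence[OF v \<xi>] by simp
qed

text \<open>The Neumann problem for q, tested with \<open>\<xi>\<close>, says precisely that the
  scaled gradient of q carries the whole divergence of v. Since v vanishes on the boundary,
  \<open>vH10_divergence\<close> applies to any \<open>\<xi>\<close> in \<open>H1\<close>.\<close>

lemma solenoidal_projection: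
  assumes v: "v \<in> vH10 \<Omega>" and q: "pressure_step \<Omega> dt \<rho>1 v q" and dt: "dt > 0" "\<rho>1 > 0"
    and w: "AE x in M. w x = v x - (dt / \<rho>1) *\<^sub>R wgrad \<Omega> q x"
  shows "solenoidal w"
  unfolding solenoidal_def
proof (intro conjI ballI)
  have qH: "q \<in> H1 \<Omega>" and qe: "\<And>\<psi>. \<psi> \<in> H1 \<Omega> \<Longrightarrow> - (LINT x|M. wgrad \<Omega> q x \<bullet> wgrad \<Omega> \<psi> x)
                = (LINT x|M. (\<rho>1/dt) * wdiv \<Omega> v x * \<psi> x)"
    using q by (auto simp: pressure_step_def)
  have L: "(\<lambda>x. v x - (dt / \<rho>1) *\<^sub>R wgrad \<Omega> q x) \<in> L2 \<Omega>"
    by (intro L2_diff L2_cmult vH10_L2 v wgrad_L2 qH)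
  show wL: "w \<in> L2 \<Omega>" by (rule L2_cong_AE[OF L]) (use w in \<open>auto elim: eventually_mono\<close>)
  fix \<xi> assume \<xi>: "\<xi> \<in> H1 \<Omega>"
  have "(LINT x|M. w x \<bullet> wgrad \<Omega> \<xi> x) = (LINT x|M. v x \<bullet> wgrad \<Omega> \<xi> x - (dt / \<rho>1) * (wgrad \<Omega> q x \<bullet> wgrad \<Omega> \<xi> x))"
  proof (rule integral_cong_AE)
    show "AE x in M. w x \<bullet> wgrad \<Omega> \<xi> x = v x \<bullet> wgrad \<Omega> \<xi> x - (dt / \<rho>1) * (wgrad \<Omega> q x \<bullet> wgrad \<Omega> \<xi> x)"
      using w by eventually_elim (simp add: inner_diff_left)
  qed (use L2_measurable[OF wL] L2_measurable[OF vH10_L2[OF v]] L2_measurable[OF wgrad_L2[OF qH]]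
      L2_measurable[OF wgrad_L2[OF \<xi>]] in auto)
  also have "\<dots> = (LINT x|M. v x \<bullet> wgrad \<Omega> \<xi> x) - (dt / \<rho>1) * (LINT x|M. wgrad \<Omega> q x \<bullet> wgrad \<Omega> \<xi> x)"
    using L2_inner_integrable[OF vH10_L2[OF v] wgrad_L2[OF \<xi>]] L2_inner_integrable[OF wgrad_L2[OF qH] wgrad_L2[OF \<xi>]]
    by simp
  also have "(LINT x|M. wgrad \<Omega> q x \<bullet> wgrad \<Omega> \<xi> x) = - ((\<rho>1 / dt) * (LINT x|M. wdiv \<Omega> v x * \<xi> x))"
    using qe[OF \<xi>] by (simp add: mult.assoc)
  finally show "(LINT x|M. w x \<bullet> wgrad \<Omega> \<xi> x) = 0"
    using vH10_divergence[OF v \<xi>] dt by simp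
qed

section \<open>Maximum principle for the viscous density equation\<close>

lemma weak_partial_power:
  assumes s: "s \<in> L2 \<Omega>" "AE x in M. \<bar>s x\<bar> \<le> C" and g: "g \<in> L2 \<Omega>" "weak_partial \<Omega> i s g"
  shows "weak_partial \<Omega> i (\<lambda>x. s x ^ n) (\<lambda>x. real n * s x ^ (n - 1) * g x) \<and>
    (\<lambda>x. s x ^ n) \<in> L2 \<Omega> \<and> (\<lambda>x. real n * s x ^ (n - 1) * g x) \<in> L2 \<Omega>"
proof -
  have bd: "AE x in M. \<bar>s x ^ n\<bar> \<le> C ^ n" for n
    using s(2) by eventually_elim (auto simp: power_abs intro: power_mono)
  have L: "(\<lambda>x. s x ^ n) \<in> L2 \<Omega>" for n
    using bd[of n] L2_measurable[OF s(1)] by (intro bounded_L2) auto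
  have Lg: "(\<lambda>x. real n * s x ^ (n - 1) * g x) \<in> L2 \<Omega>" for n
  proof -
    have "(\<lambda>x. s x ^ (n - 1) *\<^sub>R g x) \<in> L2 \<Omega>"
      using bd[of "n - 1"] L2_measurable[OF s(1)] by (intro L2_scaleR g) auto
    from L2_cmult[OF this, of "real n"] show ?thesis by (simp add: mult.assoc)
  qed
  have "weak_partial \<Omega> i (\<lambda>x. s x ^ n) (\<lambda>x. real n * s x ^ (n - 1) * g x)"
  proof (induction n)
    case 0
    then show ?case using weak_partial_const[of i 1] by simp
  next
    case (Suc n)
    have "weak_partial \<Omega> i (\<lambda>x. s x * s x ^ n) (\<lambda>x. s x * (real n * s x ^ (n - 1) * g x) + g x * s x ^ n)"
      by (rule weak_partial_prod[OF s L bd g Lg Suc])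
    \<comment> \<open>The case split concerns n = 0, where \<open>n - 1\<close> is again 0 and the
      factor \<open>real n\<close> removes the term.\<close>
    moreover have "s x * (real n * s x ^ (n - 1) * g x) + g x * s x ^ n = real (Suc n) * s x ^ (Suc n - 1) * g x" for x
      by (cases n) (auto simp: algebra_simps)
    ultimately show ?case by simp
  qed
  with L Lg show ?thesis by blast
qed

text \<open>For an odd exponent m the left side is at least (|s| - R) |s|^m. This is at least \<eta>
  (R + \<eta>)^m where |s| exceeds R + \<eta>, nonnegative where |s| lies above R, and never below -
  R^(m + 1).\<close>

lemma odd_power_excess:
  fixes s r R \<eta> :: real
  assumes r: "\<bar>r\<bar> \<le> R" and \<eta>: "\<eta> > 0"
  shows "(s - r) * s ^ (2 * k + 1) \<ge> (if \<bar>s\<bar> > R + \<eta> then \<eta> * (R + \<eta>) ^ (2 * k + 1) else 0) - R ^ (2 * k + 2)"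
proof -
  have R: "R \<ge> 0" using r by simp
  have s2: "s * s ^ (2 * k + 1) = \<bar>s\<bar> * \<bar>s\<bar> ^ (2 * k + 1)"
    by (cases "s \<ge> 0") (auto simp: power_minus_odd)
  have "r * s ^ (2 * k + 1) \<le> \<bar>r * s ^ (2 * k + 1)\<bar>" by simp
  also have "\<dots> \<le> R * \<bar>s\<bar> ^ (2 * k + 1)"
    using r by (simp add: abs_mult power_abs mult_right_mono)
  finally have low: "(s - r) * s ^ (2 * k + 1) \<ge> (\<bar>s\<bar> - R) * \<bar>s\<bar> ^ (2 * k + 1)"
    unfolding left_diff_distrib s2 by linarith
  show ?thesis
  proof (cases "\<bar>s\<bar> > R + \<eta>")
    case True
    have "(\<bar>s\<bar> - R) * \<bar>s\<bar> ^ (2 * k + 1) \<ge> \<eta> * (R + \<eta>) ^ (2 * k + 1)"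
      using True R \<eta> by (intro mult_mono power_mono) auto
    moreover have "R ^ (2 * k + 2) \<ge> 0" using R by simp
    ultimately show ?thesis using low True by simp
  next
    case False
    have "(\<bar>s\<bar> - R) * \<bar>s\<bar> ^ (2 * k + 1) \<ge> - (R ^ (2 * k + 2))"
    proof (cases "\<bar>s\<bar> \<le> R")
      case True
      have "(R - \<bar>s\<bar>) * \<bar>s\<bar> ^ (2 * k + 1) \<le> R * R ^ (2 * k + 1)"
        using True by (intro mult_mono power_mono) auto
      then show ?thesis by (simp add: algebra_simps)
    next
      case False
      then have "(\<bar>s\<bar> - R) * \<bar>s\<bar> ^ (2 * k + 1) \<ge> 0" by simp
      moreover have "R ^ (2 * k + 2) \<ge> 0" using R by simp
      ultimately show ?thesis by linarith
    qed
    with low False show ?thesis by simp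
  qed
qed


text \<open>A Chebyshev argument with growing exponent: integrating \<open>odd_power_excess\<close>
  bounds the measure of the set where |s| > R + \<eta> by a constant times (R / (R + \<eta>))^(2 k +
  1), which is geometric in k.\<close>

lemma excess_set_null:
  fixes s r :: "real^3 \<Rightarrow> real"
  assumes s: "s \<in> borel_measurable M" "AE x in M. \<bar>s x\<bar> \<le> C" and r: "r \<in> borel_measurable M" "AE x in M. \<bar>r x\<bar> \<le> R"
    and le: "\<And>k. (LINT x|M. (s x - r x) * s x ^ (2 * k + 1)) \<le> 0" and \<eta>: "\<eta> > 0" and R: "R \<ge> 0"
  shows "AE x in M. \<bar>s x\<bar> \<le> R + \<eta>"
proof -
  define A where "A = {x \<in> space M. \<bar>s x\<bar> > R + \<eta>}"
  have A[measurable]: "A \<in> sets M" using s(1) unfolding A_def by measurable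
  define m where "m = measure M (space M)"
  have key: "measure M A \<le> (R / (R + \<eta>)) ^ (2 * k + 1) * (R * m / \<eta>)" for k
  proof -
    have "integrable M (\<lambda>x. (s x - r x) * s x ^ (2 * k + 1))"
    proof (rule integrable_const_bound)
      show "AE x in M. norm ((s x - r x) * s x ^ (2 * k + 1)) \<le> (C + R) * C ^ (2 * k + 1)"
        using s(2) r(2)
      proof eventually_elim
        case (elim x)
        have "\<bar>s x - r x\<bar> \<le> C + R" using elim by linarith
        moreover have "\<bar>s x\<bar> ^ (2 * k + 1) \<le> C ^ (2 * k + 1)" using elim by (intro power_mono) auto
        ultimately show ?case
          unfolding real_norm_def abs_mult power_abs
          by (intro mult_mono) (auto intro: order_trans[OF abs_ge_zero])
      qed
    qed (use s(1) r(1) in auto)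
    moreover have "integrable M (\<lambda>x. \<eta> * (R + \<eta>) ^ (2 * k + 1) * indicator A x - R ^ (2 * k + 2))"
      using A by (intro Bochner_Integration.integrable_diff integrable_mult_right integrable_real_indicator)
        (auto simp: emeasure_eq_measure)
    moreover have "AE x in M. \<eta> * (R + \<eta>) ^ (2 * k + 1) * indicator A x - R ^ (2 * k + 2) \<le> (s x - r x) * s x ^ (2 * k + 1)"
      using r(2) AE_space
    proof eventually_elim
      case (elim x)
      then show ?case using odd_power_excess[OF elim(1) \<eta>, of "s x" k]
        by (cases "\<bar>s x\<bar> > R + \<eta>") (auto simp: A_def)
    qed
    ultimately have "(LINT x|M. \<eta> * (R + \<eta>) ^ (2 * k + 1) * indicator A x - R ^ (2 * k + 2)) \<le> 0"
      by (intro order_trans[OF integral_mono_AE le[of k]])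
    moreover have "(LINT x|M. \<eta> * (R + \<eta>) ^ (2 * k + 1) * indicator A x - R ^ (2 * k + 2)) =
        \<eta> * (R + \<eta>) ^ (2 * k + 1) * measure M A - R ^ (2 * k + 2) * m"
      using A sets.Int_space_eq2[OF A] by (subst Bochner_Integration.integral_diff)
        (auto intro!: integrable_mult_right integrable_real_indicator simp: emeasure_eq_measure m_def mult.commute simp del: power_Suc)
    ultimately have *: "\<eta> * (R + \<eta>) ^ (2 * k + 1) * measure M A \<le> R ^ (2 * k + 2) * m" by simp
    have pos: "(R + \<eta>) ^ (2 * k + 1) > 0" using R \<eta> by (intro zero_less_power) simp
    have "measure M A \<le> R ^ (2 * k + 2) * m / (\<eta> * (R + \<eta>) ^ (2 * k + 1))"
      using * pos \<eta> by (subst pos_le_divide_eq) (auto simp: mult.commute simp del: power_Suc)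
    also have "\<dots> = (R / (R + \<eta>)) ^ (2 * k + 1) * (R * m / \<eta>)"
      by (simp add: power_divide field_simps)
    finally show ?thesis .
  qed
  have "(\<lambda>k. (R / (R + \<eta>)) ^ (2 * k + 1) * (R * m / \<eta>)) \<longlonglongrightarrow> 0"
  proof (rule tendsto_mult_left_zero)
    have "(\<lambda>n. (R / (R + \<eta>)) ^ n) \<longlonglongrightarrow> 0" using R \<eta> by (intro LIMSEQ_realpow_zero) auto
    then show "(\<lambda>k. (R / (R + \<eta>)) ^ (2 * k + 1)) \<longlonglongrightarrow> 0"
      by (rule LIMSEQ_subseq_LIMSEQ[of _ _ "\<lambda>k. 2 * k + 1", unfolded o_def]) (auto simp: strict_mono_def)
  qed
  then have "measure M A \<le> 0" by (rule LIMSEQ_le_const) (use key in auto)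
  then have "emeasure M A = 0" by (simp add: emeasure_eq_measure measure_le_0_iff)
  then have "AE x in M. x \<notin> A" using A by (intro AE_not_in) (auto simp: null_sets_def)
  then show ?thesis using AE_space by eventually_elim (auto simp: A_def)
qed

text \<open>The equation is tested with the power s^m of s = \<sigma> - c, where m = 2 k + 1.
  Diffusion has a sign because m - 1 is even, and transport is the pairing of w with the gradient of
  s^(m + 1) / (m + 1), which is zero. The difference is left in the shape that
  \<open>excess_set_null\<close> expects.\<close>

lemma viscous_odd_moment:
  assumes w: "solenoidal w" and eq: "viscous_density_eq \<Omega> dt w \<rho> \<epsilon> \<sigma>" and pos: "dt > 0" "\<epsilon> > 0"
    and \<sigma>: "\<sigma> \<in> Linf \<Omega>" and \<rho>: "\<rho> \<in> L2 \<Omega>"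
  shows "(LINT x|M. ((\<sigma> x - c) - (\<rho> x - c)) * (\<sigma> x - c) ^ (2 * k + 1)) \<le> 0"
proof -
  define s where "s x = \<sigma> x - c" for x
  define m where "m = 2 * k + 1"
  have \<sigma>H: "\<sigma> \<in> H1 \<Omega>" using eq by (simp add: viscous_density_eq_def)
  obtain C where C: "AE x in M. \<bar>\<sigma> x\<bar> \<le> C" using \<sigma> by (auto simp: Linf_def)
  have sb: "AE x in M. \<bar>s x\<bar> \<le> C + \<bar>c\<bar>" using C by eventually_elim (auto simp: s_def)
  have sL: "s \<in> L2 \<Omega>" unfolding s_def[abs_def] by (intro L2_diff H1_L2 \<sigma>H L2_const)
  have wp: "weak_partial \<Omega> i s (wpartial \<Omega> i \<sigma>)" for i
  proof -
    have "weak_partial \<Omega> i (\<lambda>x. 1 * \<sigma> x + (-1) * c) (\<lambda>x. 1 * wpartial \<Omega> i \<sigma> x + (-1) * 0)"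
      by (intro weak_partial_lin H1_wpartial \<sigma>H weak_partial_const H1_L2 L2_const)
    then show ?thesis by (simp add: s_def[abs_def])
  qed
  note pw = weak_partial_power[OF sL sb H1_wpartial(1)[OF \<sigma>H] wp]
  have H: "(\<lambda>x. s x ^ n) \<in> H1 \<Omega>" for n
    by (rule H1I[of _ "\<lambda>i x. real n * s x ^ (n - 1) * wpartial \<Omega> i \<sigma> x"]) (use pw in blast)+
  have g: "AE x in M. wgrad \<Omega> (\<lambda>x. s x ^ n) x = (real n * s x ^ (n - 1)) *\<^sub>R wgrad \<Omega> \<sigma> x" for n
    by (rule wgrad_AE) (use pw[where n = n] in \<open>auto simp: L2_vec wgrad_def\<close>)
  have wL: "w \<in> L2 \<Omega>" using w by (simp add: solenoidal_def)
  have sm: "(\<lambda>x. s x ^ n) \<in> borel_measurable M" for n using L2_measurable[OF sL] by simp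
  have sbn: "AE x in M. \<bar>s x ^ n\<bar> \<le> (C + \<bar>c\<bar>) ^ n" for n
    using sb by eventually_elim (auto simp: power_abs intro: power_mono)
  have inf: "(\<lambda>x. s x ^ n) \<in> Linf \<Omega>" for n using sm[of n] sbn[of n] by (auto simp: Linf_def)
  have e: "(LINT x|M. ((\<sigma> x - \<rho> x) / dt + w x \<bullet> wgrad \<Omega> \<sigma> x) * s x ^ m)
        + \<epsilon> * (LINT x|M. wgrad \<Omega> \<sigma> x \<bullet> wgrad \<Omega> (\<lambda>x. s x ^ m) x) = 0"
    using eq H[of m] inf[of m] by (simp add: viscous_density_eq_def)
  have diff: "(LINT x|M. wgrad \<Omega> \<sigma> x \<bullet> wgrad \<Omega> (\<lambda>x. s x ^ m) x) \<ge> 0"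
  proof (rule integral_nonneg_AE)
    show "AE x in M. 0 \<le> wgrad \<Omega> \<sigma> x \<bullet> wgrad \<Omega> (\<lambda>x. s x ^ m) x"
      using g[of m]
    proof eventually_elim
      case (elim x)
      have "s x ^ (m - 1) \<ge> 0" by (simp add: m_def)
      then show ?case using elim by simp
    qed
  qed
  have adv: "(LINT x|M. (w x \<bullet> wgrad \<Omega> \<sigma> x) * s x ^ m) = 0"
  proof -
    have "0 = (LINT x|M. w x \<bullet> wgrad \<Omega> (\<lambda>x. s x ^ (m + 1)) x)"
      using w H[of "m + 1"] by (simp add: solenoidal_def)
    also have "\<dots> = (LINT x|M. real (m + 1) * ((w x \<bullet> wgrad \<Omega> \<sigma> x) * s x ^ m))"
    proof (rule integral_cong_AE)
      show "AE x in M. w x \<bullet> wgrad \<Omega> (\<lambda>x. s x ^ (m + 1)) x = real (m + 1) * ((w x \<bullet> wgrad \<Omega> \<sigma> x) * s x ^ m)"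
        using g[of "m + 1"] by eventually_elim (simp add: mult_ac)
      show "(\<lambda>x. w x \<bullet> wgrad \<Omega> (\<lambda>x. s x ^ (m + 1)) x) \<in> borel_measurable M"
        using L2_measurable[OF wL] L2_measurable[OF wgrad_L2[OF H[of "m + 1"]]] by simp
      show "(\<lambda>x. real (m + 1) * ((w x \<bullet> wgrad \<Omega> \<sigma> x) * s x ^ m)) \<in> borel_measurable M"
        using L2_measurable[OF wL] L2_measurable[OF wgrad_L2[OF \<sigma>H]] sm[of m] by simp
    qed
    finally show ?thesis by simp
  qed
  have i1: "integrable M (\<lambda>x. (\<sigma> x - \<rho> x) * s x ^ m)"
    by (rule integrable_mult_bounded[OF L2_integrable[OF L2_diff[OF H1_L2[OF \<sigma>H] \<rho>]] sm sbn])
  have i2: "integrable M (\<lambda>x. (w x \<bullet> wgrad \<Omega> \<sigma> x) * s x ^ m)"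
    by (rule integrable_mult_bounded[OF L2_inner_integrable[OF wL wgrad_L2[OF \<sigma>H]] sm sbn])
  have "(LINT x|M. ((\<sigma> x - \<rho> x) / dt + w x \<bullet> wgrad \<Omega> \<sigma> x) * s x ^ m) =
      (LINT x|M. ((\<sigma> x - \<rho> x) * s x ^ m) / dt + (w x \<bullet> wgrad \<Omega> \<sigma> x) * s x ^ m)"
    by (simp add: distrib_right)
  also have "\<dots> = (LINT x|M. (\<sigma> x - \<rho> x) * s x ^ m) / dt"
    using i1 i2 adv by simp
  finally have "(LINT x|M. (\<sigma> x - \<rho> x) * s x ^ m) / dt = - (\<epsilon> * (LINT x|M. wgrad \<Omega> \<sigma> x \<bullet> wgrad \<Omega> (\<lambda>x. s x ^ m) x))"
    using e by linarith
  also have "\<dots> \<le> 0" using diff pos by simp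
  finally show ?thesis using pos by (simp add: s_def m_def divide_le_0_iff)
qed

text \<open>Centring at the midpoint c turns the two bounds into the single one |\<sigma> - c| \<le>
  R, with R half the length of the interval. The excess \<eta> runs through a sequence tending to 0,
  so that only countably many null sets are collected.\<close>

lemma viscous_maximum_principle:
  assumes w: "solenoidal w" and eq: "viscous_density_eq \<Omega> dt w \<rho> \<epsilon> \<sigma>" and pos: "dt > 0" "\<epsilon> > 0"
    and \<sigma>: "\<sigma> \<in> Linf \<Omega>" and \<rho>: "\<rho> \<in> borel_measurable M" "AE x in M. a \<le> \<rho> x \<and> \<rho> x \<le> b" and ab: "a \<le> b"
  shows "AE x in M. a \<le> \<sigma> x \<and> \<sigma> x \<le> b"
proof -
  define c where "c = (a + b) / 2"
  define R where "R = (b - a) / 2"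
  have \<rho>L: "\<rho> \<in> L2 \<Omega>"
  proof (rule bounded_L2)
    show "AE x in M. norm (\<rho> x) \<le> \<bar>a\<bar> + \<bar>b\<bar>" using \<rho>(2) by eventually_elim auto
  qed (rule \<rho>)
  obtain C where C: "AE x in M. \<bar>\<sigma> x\<bar> \<le> C" using \<sigma> by (auto simp: Linf_def)
  have m: "\<sigma> \<in> borel_measurable M" using \<sigma> by (simp add: Linf_def)
  have "AE x in M. \<bar>\<sigma> x - c\<bar> \<le> R + inverse (real (Suc n))" for n
  proof (rule excess_set_null[where C = "C + \<bar>c\<bar>" and r = "\<lambda>x. \<rho> x - c"])
    show "AE x in M. \<bar>\<sigma> x - c\<bar> \<le> C + \<bar>c\<bar>" using C by eventually_elim auto
    show "AE x in M. \<bar>\<rho> x - c\<bar> \<le> R" using \<rho>(2) by eventually_elim (auto simp: c_def R_def abs_le_iff field_simps)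
    show "(LINT x|M. (\<sigma> x - c - (\<rho> x - c)) * (\<sigma> x - c) ^ (2 * k + 1)) \<le> 0" for k
      by (rule viscous_odd_moment[OF w eq pos \<sigma> \<rho>L])
  qed (use m \<rho>(1) ab in \<open>auto simp: R_def\<close>)
  then have "AE x in M. \<forall>n. \<bar>\<sigma> x - c\<bar> \<le> R + inverse (real (Suc n))" by (simp add: AE_all_countable)
  then show ?thesis
  proof eventually_elim
    case (elim x)
    have "(\<lambda>n. R + inverse (real (Suc n))) \<longlonglongrightarrow> R + 0" by (intro tendsto_intros LIMSEQ_inverse_real_of_nat)
    then have "\<bar>\<sigma> x - c\<bar> \<le> R + 0" by (rule LIMSEQ_le_const) (use elim in blast)
    then show ?case by (auto simp: c_def R_def abs_le_iff field_simps)
  qed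
qed

text \<open>The weak-star convergence is tested with the indicator of the set where the limit
  violates the bound, so that set must be null. The factor c, used with the values 1 and -1, covers
  upper and lower bounds together.\<close>

lemma weak_star_upper_bound:
  assumes lim: "weak_star_Linf \<Omega> f l F" and F: "F \<noteq> bot"
    and le: "\<forall>\<^sub>F \<epsilon> in F. AE x in M. c * f \<epsilon> x \<le> b"
  shows "AE x in M. c * l x \<le> b"
proof -
  have l: "l \<in> Linf \<Omega>" and ev: "\<forall>\<^sub>F \<epsilon> in F. f \<epsilon> \<in> Linf \<Omega>"
    and lim': "\<And>g. integrable M g \<Longrightarrow> ((\<lambda>\<epsilon>. LINT x|M. f \<epsilon> x * g x) \<longlongrightarrow> (LINT x|M. l x * g x)) F"
    using lim by (auto simp: weak_star_Linf_def)
  have lm[measurable]: "l \<in> borel_measurable M" using l by (simp add: Linf_def)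
  define A where "A = {x \<in> space M. c * l x > b}"
  have A[measurable]: "A \<in> sets M" unfolding A_def by measurable
  have Ai: "integrable M (indicat_real A)"
    using A by (intro integrable_real_indicator) (auto simp: emeasure_eq_measure)
  have iA: "integrable M (\<lambda>x. h x * indicator A x)" if "h \<in> Linf \<Omega>" for h :: "real^3 \<Rightarrow> real"
    using integrable_real_mult_indicator[OF A L2_integrable[OF Linf_L2[OF that]]] .
  have "((\<lambda>\<epsilon>. c * (LINT x|M. f \<epsilon> x * indicator A x)) \<longlongrightarrow> c * (LINT x|M. l x * indicator A x)) F"
    by (intro tendsto_intros lim' Ai)
  moreover have "\<forall>\<^sub>F \<epsilon> in F. c * (LINT x|M. f \<epsilon> x * indicator A x) \<le> b * measure M A"
    using le ev
  proof eventually_elim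
    case (elim \<epsilon>)
    have "c * (LINT x|M. f \<epsilon> x * indicator A x) = (LINT x|M. c * (f \<epsilon> x * indicator A x))" by simp
    also have "\<dots> \<le> (LINT x|M. b * indicator A x)"
    proof (rule integral_mono_AE)
      show "AE x in M. c * (f \<epsilon> x * indicator A x) \<le> b * indicator A x"
        using elim(1) by eventually_elim (auto simp: indicator_def)
    qed (use iA[OF elim(2)] Ai in auto)
    finally show ?case using sets.Int_space_eq2[OF A] by simp
  qed
  ultimately have "c * (LINT x|M. l x * indicator A x) \<le> b * measure M A"
    by (rule tendsto_upperbound[OF _ _ F])
  then have "(LINT x|M. (c * l x - b) * indicator A x) \<le> 0"
    using iA[OF l] Ai sets.Int_space_eq2[OF A] by (simp add: left_diff_distrib mult.assoc)
  moreover have nn: "0 \<le> (c * l x - b) * indicator A x" for x by (auto simp: A_def indicator_def)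
  ultimately have "(LINT x|M. (c * l x - b) * indicator A x) = 0"
    by (intro antisym integral_nonneg_AE) auto
  moreover have "integrable M (\<lambda>x. (c * l x - b) * indicator A x)"
    using iA[OF l] Ai by (simp add: left_diff_distrib mult.assoc)
  ultimately have "AE x in M. (c * l x - b) * indicator A x = 0"
    using nn by (simp add: integral_nonneg_eq_0_iff_AE)
  then show ?thesis using AE_space
  proof eventually_elim
    case (elim x)
    show ?case
    proof (rule ccontr)
      assume "\<not> ?case"
      with elim show False by (auto simp: A_def indicator_def)
    qed
  qed
qed

lemma density_step_bounds:
  assumes w: "solenoidal w" and st: "density_step \<Omega> dt w \<rho> \<rho>'" and dt: "dt > 0"
    and \<rho>: "\<rho> \<in> borel_measurable M" "AE x in M. a \<le> \<rho> x \<and> \<rho> x \<le> b" and ab: "a \<le> b"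
  shows "\<rho>' \<in> borel_measurable M" "AE x in M. a \<le> \<rho>' x \<and> \<rho>' x \<le> b"
proof -
  obtain \<sigma> where \<sigma>: "\<And>\<epsilon>. \<epsilon> > 0 \<Longrightarrow> viscous_density_eq \<Omega> dt w \<rho> \<epsilon> (\<sigma> \<epsilon>)"
    and ws: "weak_star_Linf \<Omega> \<sigma> \<rho>' (at_right 0)"
    using st by (auto simp: density_step_def)
  show "\<rho>' \<in> borel_measurable M" using ws by (simp add: weak_star_Linf_def Linf_def)
  \<comment> \<open>The maximum principle needs a bounded solution. A viscous solution is only known
    to be in \<open>H1\<close>; its boundedness for small \<epsilon> is part of weak-star
    convergence.\<close>
  have "\<forall>\<^sub>F \<epsilon> in at_right 0. \<sigma> \<epsilon> \<in> Linf \<Omega>" using ws by (simp add: weak_star_Linf_def)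
  then have ev: "\<forall>\<^sub>F \<epsilon> in at_right 0. AE x in M. a \<le> \<sigma> \<epsilon> x \<and> \<sigma> \<epsilon> x \<le> b"
    using eventually_at_right_less[of 0]
    by eventually_elim (rule viscous_maximum_principle[OF w \<sigma> dt _ _ \<rho> ab])
  have "AE x in M. 1 * \<rho>' x \<le> b"
    by (rule weak_star_upper_bound[OF ws]) (use ev in \<open>auto elim!: eventually_mono\<close>)
  moreover have "AE x in M. (-1) * \<rho>' x \<le> - a"
    by (rule weak_star_upper_bound[OF ws]) (use ev in \<open>auto elim!: eventually_mono\<close>)
  ultimately show "AE x in M. a \<le> \<rho>' x \<and> \<rho>' x \<le> b" by eventually_elim auto
qed

text \<open>No bound on the gradient of the viscous solutions is at hand, so all derivatives are
  moved to \<open>\<psi>\<close>: transport by solenoidality of w, diffusion by turning it into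
  \<epsilon> times a pairing with the Laplacian \<open>lap\<close> of \<open>\<psi>\<close>. Then
  every term is a pairing of the solution with a fixed integrable function and passes to the
  weak-star limit.\<close>

lemma density_step_divergence:
  assumes w: "solenoidal w" and st: "density_step \<Omega> dt w \<rho> \<rho>'" and dt: "dt > 0"
    and \<rho>: "\<rho> \<in> L2 \<Omega>" and \<psi>: "\<psi> \<in> test_fun \<Omega>"
  shows "(LINT x|M. (\<rho>' x *\<^sub>R w x) \<bullet> grad \<psi> x) = (1 / dt) * (LINT x|M. (\<rho>' x - \<rho> x) * \<psi> x)"
proof -
  obtain \<sigma> where \<sigma>: "\<And>\<epsilon>. \<epsilon> > 0 \<Longrightarrow> viscous_density_eq \<Omega> dt w \<rho> \<epsilon> (\<sigma> \<epsilon>)"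
    and ws: "weak_star_Linf \<Omega> \<sigma> \<rho>' (at_right 0)"
    using st by (auto simp: density_step_def)
  have lim: "((\<lambda>\<epsilon>. LINT x|M. \<sigma> \<epsilon> x * g x) \<longlongrightarrow> (LINT x|M. \<rho>' x * g x)) (at_right 0)"
    if "integrable M g" for g using ws that by (simp add: weak_star_Linf_def)
  have \<rho>'L: "\<rho>' \<in> L2 \<Omega>" using ws by (intro Linf_L2) (simp add: weak_star_Linf_def)
  have wL: "w \<in> L2 \<Omega>" using w by (simp add: solenoidal_def)
  define lap where "lap x = (\<Sum>i\<in>UNIV. partial i (partial i \<psi>) x)" for x
  have lap: "lap \<in> test_fun \<Omega>" unfolding lap_def[abs_def] by (intro test_fun_sum test_fun_partial \<psi>)
  have id: "(1 / dt) * ((LINT x|M. \<sigma> \<epsilon> x * \<psi> x) - (LINT x|M. \<rho> x * \<psi> x))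
      - (LINT x|M. \<sigma> \<epsilon> x * (w x \<bullet> grad \<psi> x)) - \<epsilon> * (LINT x|M. \<sigma> \<epsilon> x * lap x) = 0"
    if \<epsilon>: "\<epsilon> > 0" for \<epsilon>
  proof -
    let ?s = "\<sigma> \<epsilon>"
    have sH: "?s \<in> H1 \<Omega>" using \<sigma>[OF \<epsilon>] by (simp add: viscous_density_eq_def)
    have e: "(LINT x|M. ((?s x - \<rho> x) / dt + w x \<bullet> wgrad \<Omega> ?s x) * \<psi> x)
        + \<epsilon> * (LINT x|M. wgrad \<Omega> ?s x \<bullet> wgrad \<Omega> \<psi> x) = 0"
      using \<sigma>[OF \<epsilon>] test_H1[OF \<psi>] test_Linf[OF \<psi>] by (simp add: viscous_density_eq_def)
    obtain C where C: "AE x in M. \<bar>\<psi> x\<bar> \<le> C" using test_bounded[OF \<psi>] by blast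
    have i1: "integrable M (\<lambda>x. ?s x * \<psi> x)" "integrable M (\<lambda>x. \<rho> x * \<psi> x)"
      by (intro integrable_mult_test \<psi> L2_integrable H1_L2 sH \<rho>)+
    have i2: "integrable M (\<lambda>x. (w x \<bullet> wgrad \<Omega> ?s x) * \<psi> x)"
      by (intro integrable_mult_test \<psi> L2_inner_integrable wL wgrad_L2 sH)
    have pw: "weak_partial \<Omega> i (\<lambda>x. \<psi> x * ?s x) (\<lambda>x. partial i \<psi> x * ?s x + \<psi> x * wpartial \<Omega> i ?s x)" for i
      by (intro weak_partial_mult_test H1_L2 sH H1_wpartial \<psi>)
    have cL: "(\<lambda>x. partial i \<psi> x * ?s x + \<psi> x * wpartial \<Omega> i ?s x) \<in> L2 \<Omega>" for i
      by (rule L2_add[OF L2_mult_test[OF H1_L2[OF sH] test_fun_partial[OF \<psi>]] L2_mult_test[OF H1_wpartial(1)[OF sH] \<psi>]])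
    have gL: "(\<lambda>x. ?s x *\<^sub>R grad \<psi> x + \<psi> x *\<^sub>R wgrad \<Omega> ?s x) \<in> L2 \<Omega>"
      using cL by (simp add: L2_vec grad_def wgrad_def mult.commute[of "?s _"])
    have pH: "(\<lambda>x. \<psi> x * ?s x) \<in> H1 \<Omega>"
      by (rule H1I[OF L2_mult_test[OF H1_L2[OF sH] \<psi>] cL pw])
    have g: "AE x in M. wgrad \<Omega> (\<lambda>x. \<psi> x * ?s x) x = ?s x *\<^sub>R grad \<psi> x + \<psi> x *\<^sub>R wgrad \<Omega> ?s x"
      by (rule wgrad_AE[OF gL]) (use pw in \<open>simp add: grad_def wgrad_def mult.commute\<close>)
    have i3: "integrable M (\<lambda>x. ?s x * (w x \<bullet> grad \<psi> x))"
    proof -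
      have "(\<lambda>x. ?s x *\<^sub>R grad \<psi> x) \<in> L2 \<Omega>"
        using L2_mult_test[OF H1_L2[OF sH] test_fun_partial[OF \<psi>]]
        by (simp add: L2_vec grad_def mult.commute[of "?s _"])
      from L2_inner_integrable[OF wL this] show ?thesis by simp
    qed
    \<comment> \<open>The product of \<open>\<psi>\<close> and the viscous solution is in
      \<open>H1\<close>, hence admissible for \<open>solenoidal w\<close>; the product rule then
      moves the gradient onto \<open>\<psi>\<close>.\<close>
    have "0 = (LINT x|M. w x \<bullet> wgrad \<Omega> (\<lambda>x. \<psi> x * ?s x) x)"
      using w pH by (simp add: solenoidal_def)
    also have "\<dots> = (LINT x|M. ?s x * (w x \<bullet> grad \<psi> x) + (w x \<bullet> wgrad \<Omega> ?s x) * \<psi> x)"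
    proof (rule integral_cong_AE)
      show "AE x in M. w x \<bullet> wgrad \<Omega> (\<lambda>x. \<psi> x * ?s x) x = ?s x * (w x \<bullet> grad \<psi> x) + (w x \<bullet> wgrad \<Omega> ?s x) * \<psi> x"
        using g by eventually_elim (simp add: inner_add_right)
    qed (use L2_measurable[OF wL] L2_measurable[OF wgrad_L2[OF pH]] i2 i3 in auto)
    also have "\<dots> = (LINT x|M. ?s x * (w x \<bullet> grad \<psi> x)) + (LINT x|M. (w x \<bullet> wgrad \<Omega> ?s x) * \<psi> x)"
      using i2 i3 by simp
    finally have adv: "(LINT x|M. (w x \<bullet> wgrad \<Omega> ?s x) * \<psi> x) = - (LINT x|M. ?s x * (w x \<bullet> grad \<psi> x))"
      by simp
    have "(LINT x|M. wgrad \<Omega> ?s x \<bullet> wgrad \<Omega> \<psi> x) = (LINT x|M. (\<Sum>i\<in>UNIV. wpartial \<Omega> i ?s x * partial i \<psi> x))"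
    proof (rule integral_cong_AE)
      show "AE x in M. wgrad \<Omega> ?s x \<bullet> wgrad \<Omega> \<psi> x = (\<Sum>i\<in>UNIV. wpartial \<Omega> i ?s x * partial i \<psi> x)"
        using wgrad_test[OF \<psi>] by eventually_elim (simp add: inner_vec_def grad_def wgrad_def vec_eq_iff)
    qed (use L2_measurable[OF wgrad_L2[OF sH]] L2_measurable[OF wgrad_L2[OF test_H1[OF \<psi>]]]
        L2_measurable[OF H1_wpartial(1)[OF sH]] test_M[OF test_fun_partial[OF \<psi>]] in auto)
    also have "\<dots> = (\<Sum>i\<in>UNIV. (LINT x|M. wpartial \<Omega> i ?s x * partial i \<psi> x))"
      by (intro Bochner_Integration.integral_sum integrable_mult_test L2_integrable H1_wpartial sH test_fun_partial \<psi>)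
    also have "\<dots> = (\<Sum>i\<in>UNIV. - (LINT x|M. ?s x * partial i (partial i \<psi>) x))"
      using H1_wpartial(2)[OF sH] test_fun_partial[OF \<psi>] by (simp add: weak_partial_def)
    also have "\<dots> = - (LINT x|M. (\<Sum>i\<in>UNIV. ?s x * partial i (partial i \<psi>) x))"
      by (subst Bochner_Integration.integral_sum)
         (use integrable_mult_test[OF L2_integrable[OF H1_L2[OF sH]] test_fun_partial[OF test_fun_partial[OF \<psi>]]]
           in \<open>simp_all add: sum_negf\<close>)
    finally have dif: "(LINT x|M. wgrad \<Omega> ?s x \<bullet> wgrad \<Omega> \<psi> x) = - (LINT x|M. ?s x * lap x)"
      by (simp add: lap_def sum_distrib_left)
    have "(LINT x|M. ((?s x - \<rho> x) / dt + w x \<bullet> wgrad \<Omega> ?s x) * \<psi> x) =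
        (LINT x|M. (1 / dt) * (?s x * \<psi> x - \<rho> x * \<psi> x) + (w x \<bullet> wgrad \<Omega> ?s x) * \<psi> x)"
      by (intro Bochner_Integration.integral_cong) (auto simp: field_simps)
    also have "\<dots> = (1 / dt) * ((LINT x|M. ?s x * \<psi> x) - (LINT x|M. \<rho> x * \<psi> x)) - (LINT x|M. ?s x * (w x \<bullet> grad \<psi> x))"
      using i1 i2 adv by simp
    finally show ?thesis using e dif by simp
  qed
  have iwg: "integrable M (\<lambda>x. w x \<bullet> grad \<psi> x)" by (intro L2_inner_integrable wL grad_L2 \<psi>)
  have "((\<lambda>\<epsilon>. (1 / dt) * ((LINT x|M. \<sigma> \<epsilon> x * \<psi> x) - (LINT x|M. \<rho> x * \<psi> x))
      - (LINT x|M. \<sigma> \<epsilon> x * (w x \<bullet> grad \<psi> x)) - \<epsilon> * (LINT x|M. \<sigma> \<epsilon> x * lap x)) \<longlongrightarrow>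
      (1 / dt) * ((LINT x|M. \<rho>' x * \<psi> x) - (LINT x|M. \<rho> x * \<psi> x))
      - (LINT x|M. \<rho>' x * (w x \<bullet> grad \<psi> x)) - 0 * (LINT x|M. \<rho>' x * lap x)) (at_right 0)"
    by (intro tendsto_intros lim L2_integrable test_L2 \<psi> lap iwg)
  moreover have "((\<lambda>\<epsilon>. (1 / dt) * ((LINT x|M. \<sigma> \<epsilon> x * \<psi> x) - (LINT x|M. \<rho> x * \<psi> x))
      - (LINT x|M. \<sigma> \<epsilon> x * (w x \<bullet> grad \<psi> x)) - \<epsilon> * (LINT x|M. \<sigma> \<epsilon> x * lap x)) \<longlongrightarrow> 0) (at_right 0)"
    by (rule tendsto_eventually) (use eventually_at_right_less[of 0] id in \<open>auto elim: eventually_mono\<close>)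
  ultimately have "(1 / dt) * ((LINT x|M. \<rho>' x * \<psi> x) - (LINT x|M. \<rho> x * \<psi> x))
      - (LINT x|M. \<rho>' x * (w x \<bullet> grad \<psi> x)) - 0 * (LINT x|M. \<rho>' x * lap x) = 0"
    by (rule tendsto_unique[OF trivial_limit_at_right_real])
  moreover have "(LINT x|M. (\<rho>' x - \<rho> x) * \<psi> x) = (LINT x|M. \<rho>' x * \<psi> x) - (LINT x|M. \<rho> x * \<psi> x)"
    using integrable_mult_test[OF L2_integrable[OF \<rho>'L] \<psi>] integrable_mult_test[OF L2_integrable[OF \<rho>] \<psi>]
    by (simp add: left_diff_distrib)
  ultimately show ?thesis by simp
qed

end

section \<open>Regularised test fields\<close>

text \<open>A rational damping factor is smooth in v, unlike a cut-off at a fixed height, so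
  truncated test fields are again test fields.\<close>

definition damp :: "real \<Rightarrow> real^3 \<Rightarrow> real" where
  "damp \<delta> v = inverse (1 + \<delta> * (v \<bullet> v))"

definition trunc :: "real \<Rightarrow> real^3 \<Rightarrow> real^3" where
  "trunc \<delta> v = (damp \<delta> v)\<^sup>2 *\<^sub>R v"

definition outer :: "real^3 \<Rightarrow> real^3 \<Rightarrow> real^3^3" where
  "outer a b = (\<chi> i j. a $ i * b $ j)"

text \<open>The chain rule for the Jacobian of \<open>trunc \<delta>\<close> composed with a field,
  v being its value and A its Jacobian. A is a free argument because the formula is later evaluated
  at weak Jacobians as well.\<close>

definition trunc_jac :: "real \<Rightarrow> real^3 \<Rightarrow> real^3^3 \<Rightarrow> real^3^3" where
  "trunc_jac \<delta> v A = (damp \<delta> v)\<^sup>2 *\<^sub>R A - (4 * \<delta> * damp \<delta> v ^ 3) *\<^sub>R outer v (transpose A *v v)"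

text \<open>The gradient of \<open>trunc_energy \<delta> \<circ> \<phi>\<close> is the transposed Jacobian of \<open>\<phi>\<close> applied to
  \<open>trunc \<delta> \<circ> \<phi>\<close>, for every \<open>\<delta> > 0\<close>.\<close>

definition trunc_energy :: "real \<Rightarrow> real^3 \<Rightarrow> real" where
  "trunc_energy \<delta> v = damp \<delta> v * (v \<bullet> v) / 2"

section \<open>Matrix norms, and bounds and limits of the truncation\<close>

lemma norm_matrix_vector_le:
  fixes A :: "real^'n^'m" shows "norm (A *v x) \<le> norm A * norm x"
proof -
  have "(norm (A *v x))\<^sup>2 = (\<Sum>i\<in>UNIV. (A $ i \<bullet> x)\<^sup>2)"
    by (simp add: norm_vec_def L2_set_def sum_nonneg matrix_vector_mul_component)
  also have "\<dots> \<le> (\<Sum>i\<in>UNIV. (norm (A $ i))\<^sup>2 * (norm x)\<^sup>2)"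
  proof (rule sum_mono)
    fix i
    have "\<bar>A $ i \<bullet> x\<bar>\<^sup>2 \<le> (norm (A $ i) * norm x)\<^sup>2"
      by (intro power_mono Cauchy_Schwarz_ineq2) simp
    then show "(A $ i \<bullet> x)\<^sup>2 \<le> (norm (A $ i))\<^sup>2 * (norm x)\<^sup>2" by (simp add: power_mult_distrib)
  qed
  also have "\<dots> = (norm A * norm x)\<^sup>2"
    by (simp add: norm_vec_def[of A] L2_set_def sum_nonneg power_mult_distrib sum_distrib_right)
  finally show ?thesis by (rule power2_le_imp_le) simp
qed

lemma norm_outer: "norm (outer a b) = norm a * norm b"
proof -
  have "(norm (outer a b))\<^sup>2 = (norm a * norm b)\<^sup>2"
    unfolding outer_def power_mult_distrib
    by (simp add: norm_vec_def L2_set_def sum_nonneg power_mult_distrib sum_distrib_left sum_distrib_right)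
       (rule sum.swap)
  then show ?thesis by simp
qed

lemma inner_transpose: "transpose A \<bullet> transpose B = (A :: real^'n^'m) \<bullet> B"
  by (simp add: inner_vec_def transpose_def) (rule sum.swap)

lemma norm_transpose: "norm (transpose A :: real^'n^'m) = norm A"
  by (simp add: norm_eq_sqrt_inner inner_transpose)

lemma inner_matrix_vector: "w \<bullet> (transpose A *v v) = (A *v w) \<bullet> (v :: real^3)"
  using dot_lmul_matrix[of v A w] by (simp add: inner_commute)

lemma damp_bounds:
  assumes "\<delta> \<ge> 0"
  shows "0 < damp \<delta> v" "damp \<delta> v \<le> 1" "\<delta> * (v \<bullet> v) * damp \<delta> v \<le> 1"
proof -
  have "\<delta> * (v \<bullet> v) \<ge> 0" using assms by simp
  then show "0 < damp \<delta> v" "damp \<delta> v \<le> 1" "\<delta> * (v \<bullet> v) * damp \<delta> v \<le> 1"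
    by (auto simp: damp_def field_simps)
qed

lemma trunc_le: "\<delta> \<ge> 0 \<Longrightarrow> norm (trunc \<delta> v) \<le> norm v"
  using damp_bounds[of \<delta> v] by (auto simp: trunc_def power_le_one intro!: mult_left_le_one_le)

text \<open>Since \<delta> \<le> 1, \<delta> |v| \<le> \<delta> (1 + |v|^2) \<le> 1 + \<delta>
  |v|^2, the reciprocal of \<open>damp\<close>. The bound degenerates as \<delta> tends to 0 and
  serves only limits at fixed \<delta>.\<close>

lemma trunc_bounded:
  assumes "0 < \<delta>" "\<delta> \<le> 1" shows "norm (trunc \<delta> v) \<le> 1 / \<delta>"
proof -
  note d = damp_bounds[of \<delta> v]
  have "norm v \<le> 1 + norm v ^ 2"
    using zero_le_power2[of "norm v - 1/2"] by (simp add: power2_eq_square algebra_simps)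
  also have "\<dots> = 1 + v \<bullet> v" by (simp add: dot_square_norm)
  finally have "\<delta> * norm v \<le> \<delta> * (1 + v \<bullet> v)" using assms by (intro mult_left_mono) auto
  also have "\<dots> \<le> 1 + \<delta> * (v \<bullet> v)" using assms by (simp add: distrib_left)
  finally have "damp \<delta> v * (\<delta> * norm v) \<le> damp \<delta> v * (1 + \<delta> * (v \<bullet> v))"
    using d assms by (intro mult_left_mono) auto
  also have "\<dots> = 1"
  proof -
    have "1 + \<delta> * (v \<bullet> v) > 0" using assms by (simp add: add_pos_nonneg)
    then show ?thesis by (simp add: damp_def)
  qed
  finally have "damp \<delta> v * norm v \<le> 1 / \<delta>" using assms by (simp add: field_simps)
  moreover have "norm (trunc \<delta> v) \<le> damp \<delta> v * norm v"
    using d assms by (auto simp: trunc_def power2_eq_square intro!: mult_left_le_one_le)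
  ultimately show ?thesis by linarith
qed

text \<open>The constant is 1 + 4: the rank-one correction is at most 4 |A|, since \<delta> |v|^2 is
  compensated by one factor \<open>damp\<close>. Being uniform in \<delta>, the bound also serves
  the limit \<delta> to 0.\<close>

lemma trunc_jac_le:
  assumes "\<delta> \<ge> 0" shows "norm (trunc_jac \<delta> v A) \<le> 5 * norm A"
proof -
  note d = damp_bounds[OF assms, of v]
  have "norm (trunc_jac \<delta> v A) \<le> norm ((damp \<delta> v)\<^sup>2 *\<^sub>R A) + norm ((4 * \<delta> * damp \<delta> v ^ 3) *\<^sub>R outer v (transpose A *v v))"
    unfolding trunc_jac_def by (rule norm_triangle_ineq4)
  also have "norm ((damp \<delta> v)\<^sup>2 *\<^sub>R A) \<le> norm A"
    using d by (auto simp: power_le_one intro!: mult_left_le_one_le)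
  also have "norm ((4 * \<delta> * damp \<delta> v ^ 3) *\<^sub>R outer v (transpose A *v v)) \<le> 4 * norm A"
  proof -
    have "norm ((4 * \<delta> * damp \<delta> v ^ 3) *\<^sub>R outer v (transpose A *v v)) =
        4 * \<delta> * damp \<delta> v ^ 3 * (norm v * norm (transpose A *v v))"
      using d assms by (simp add: norm_outer abs_mult)
    also have "\<dots> \<le> 4 * \<delta> * damp \<delta> v ^ 3 * (norm v * (norm A * norm v))"
      using d assms norm_matrix_vector_le[of "transpose A" v]
      by (intro mult_left_mono) (auto simp: norm_transpose)
    also have "\<dots> = (\<delta> * (v \<bullet> v) * damp \<delta> v) * (damp \<delta> v)\<^sup>2 * (4 * norm A)"
      by (simp add: dot_square_norm power2_eq_square power3_eq_cube)
    also have "\<dots> \<le> 1 * (4 * norm A)"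
      using d assms by (intro mult_right_mono mult_le_one[OF d(3)]) (auto simp: power_le_one)
    finally show ?thesis by simp
  qed
  finally show ?thesis by simp
qed

lemma trunc_energy_bounds:
  assumes "\<delta> \<ge> 0" shows "0 \<le> trunc_energy \<delta> v" "trunc_energy \<delta> v \<le> (norm v)\<^sup>2"
proof -
  have "0 \<le> damp \<delta> v * (v \<bullet> v)" "damp \<delta> v * (v \<bullet> v) \<le> v \<bullet> v"
    using damp_bounds[OF assms, of v] by (auto intro: mult_left_le_one_le)
  then show "0 \<le> trunc_energy \<delta> v" "trunc_energy \<delta> v \<le> (norm v)\<^sup>2"
    unfolding trunc_energy_def dot_square_norm[symmetric] by linarith+
qed

lemma continuous_damp: "\<delta> \<ge> 0 \<Longrightarrow> continuous_on UNIV (damp \<delta>)"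
  unfolding damp_def
  by (intro continuous_intros) (metis add_pos_nonneg inner_ge_zero mult_nonneg_nonneg order_less_irrefl zero_less_one)

lemma continuous_trunc: "\<delta> \<ge> 0 \<Longrightarrow> continuous_on UNIV (trunc \<delta>)"
  unfolding trunc_def by (intro continuous_intros continuous_damp)

lemma continuous_trunc_energy: "\<delta> \<ge> 0 \<Longrightarrow> continuous_on UNIV (trunc_energy \<delta>)"
  unfolding trunc_energy_def by (intro continuous_intros continuous_damp) auto

text \<open>Joint continuity in both arguments yields measurability along measurable fields as well
  as limits at fixed \<delta>.\<close>

lemma continuous_trunc_jac:
  assumes "\<delta> \<ge> 0" shows "continuous_on UNIV (\<lambda>p. trunc_jac \<delta> (fst p) (snd p))"
proof -
  have d: "continuous_on UNIV (\<lambda>p :: (real^3) \<times> (real^3^3). damp \<delta> (fst p))"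
    by (rule continuous_on_compose2[OF continuous_damp[OF assms]]) (auto intro: continuous_intros)
  show ?thesis
    unfolding trunc_jac_def outer_def matrix_vector_mult_def transpose_def
    by (intro continuous_intros d)
qed

lemma tendsto_damp_0: "(d \<longlongrightarrow> 0) F \<Longrightarrow> ((\<lambda>n. damp (d n) v) \<longlongrightarrow> 1) F"
  unfolding damp_def by (auto intro!: tendsto_eq_intros)

lemma tendsto_trunc_0: "(d \<longlongrightarrow> 0) F \<Longrightarrow> ((\<lambda>n. trunc (d n) v) \<longlongrightarrow> v) F"
  unfolding trunc_def by (auto intro!: tendsto_eq_intros tendsto_damp_0)

lemma tendsto_trunc_energy_0: "(d \<longlongrightarrow> 0) F \<Longrightarrow> ((\<lambda>n. trunc_energy (d n) v) \<longlongrightarrow> v \<bullet> v / 2) F"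
  unfolding trunc_energy_def by (auto intro!: tendsto_eq_intros tendsto_damp_0)

lemma tendsto_trunc_jac_0:
  assumes "(d \<longlongrightarrow> 0) F" shows "((\<lambda>n. trunc_jac (d n) v A) \<longlongrightarrow> A) F"
proof -
  have "((\<lambda>n. trunc_jac (d n) v A) \<longlongrightarrow> 1\<^sup>2 *\<^sub>R A - (4 * 0 * 1 ^ 3) *\<^sub>R outer v (transpose A *v v)) F"
    unfolding trunc_jac_def by (intro tendsto_intros assms tendsto_damp_0)
  then show ?thesis by simp
qed

section \<open>Truncation of test fields\<close>

lemma vtest_smooth: "\<phi> \<in> vtest_fun \<Omega> \<Longrightarrow> smooth (\<lambda>x. \<phi> x $ i)"
  unfolding vtest_fun_def using test_fun_smooth by blast

lemma vtest_test: "\<phi> \<in> vtest_fun \<Omega> \<Longrightarrow> (\<lambda>x. \<phi> x $ i) \<in> test_fun \<Omega>"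
  by (simp add: vtest_fun_def)

context
  fixes \<phi> :: "real^3 \<Rightarrow> real^3" and \<delta> :: real
  assumes \<phi>: "\<And>i. smooth (\<lambda>x. \<phi> x $ i)" and \<delta>: "\<delta> \<ge> 0"
begin

lemma smooth_damp: "smooth (\<lambda>x. damp \<delta> (\<phi> x))"
proof -
  have "1 + \<delta> * (\<Sum>i\<in>UNIV. \<phi> x $ i * \<phi> x $ i) \<noteq> 0" for x
  proof -
    have "\<delta> * (\<Sum>i\<in>UNIV. \<phi> x $ i * \<phi> x $ i) \<ge> 0" using \<delta> by (intro mult_nonneg_nonneg[OF _ sum_nonneg]) simp_all
    then show ?thesis by linarith
  qed
  then show ?thesis unfolding damp_def inner_vec_def inner_real_def
    by (intro smooth_inverse smooth_add smooth_const smooth_mult smooth_sum \<phi>)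
qed

lemma partial_damp:
  "partial k (\<lambda>x. damp \<delta> (\<phi> x)) x = - (2 * \<delta> * (damp \<delta> (\<phi> x))\<^sup>2 * (transpose (jac \<phi> x) *v \<phi> x) $ k)"
proof -
  note d = smooth_differentiable[OF \<phi>]
  define q where "q x = 1 + \<delta> * (\<Sum>i\<in>UNIV. \<phi> x $ i * \<phi> x $ i)" for x
  have q: "damp \<delta> (\<phi> x) = inverse (q x)" for x by (simp add: damp_def q_def inner_vec_def)
  have sq: "smooth q" unfolding q_def by (intro smooth_add smooth_const smooth_mult smooth_sum \<phi>)
  have q0: "q x \<noteq> 0" for x
  proof -
    have "\<delta> * (\<Sum>i\<in>UNIV. \<phi> x $ i * \<phi> x $ i) \<ge> 0" using \<delta> by (intro mult_nonneg_nonneg[OF _ sum_nonneg]) simp_all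
    then show ?thesis unfolding q_def by linarith
  qed
  have s: "smooth (\<lambda>x. \<Sum>i\<in>UNIV. \<phi> x $ i * \<phi> x $ i)" by (intro smooth_mult smooth_sum \<phi>)
  have "partial k q x = \<delta> * (\<Sum>i\<in>UNIV. partial k (\<lambda>x. \<phi> x $ i) x * \<phi> x $ i + \<phi> x $ i * partial k (\<lambda>x. \<phi> x $ i) x)"
    unfolding q_def
    using smooth_differentiable[OF s] smooth_differentiable[OF smooth_mult[OF \<phi> \<phi>]] smooth_differentiable[OF smooth_mult[OF smooth_const[of \<delta>] s]]
    by (simp add: partial_add partial_mult partial_const partial_sum d)
  also have "\<dots> = 2 * \<delta> * (transpose (jac \<phi> x) *v \<phi> x) $ k"
    by (simp add: matrix_vector_mult_def transpose_def jac_def sum_distrib_left algebra_simps)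
  finally have pq: "partial k q x = 2 * \<delta> * (transpose (jac \<phi> x) *v \<phi> x) $ k" .
  show ?thesis unfolding q
    using partial_inverse[of q x k] smooth_differentiable[OF sq] q0
    by (simp add: pq power2_eq_square)
qed

lemma smooth_trunc: "smooth (\<lambda>x. trunc \<delta> (\<phi> x) $ i)"
  unfolding trunc_def power2_eq_square vector_scaleR_component real_scaleR_def
  by (intro smooth_mult smooth_damp \<phi>)

lemma jac_trunc: "jac (\<lambda>x. trunc \<delta> (\<phi> x)) x = trunc_jac \<delta> (\<phi> x) (jac \<phi> x)"
proof -
  note d = smooth_differentiable[OF \<phi>] smooth_differentiable[OF smooth_damp]
    smooth_differentiable[OF smooth_mult[OF smooth_damp smooth_damp]]
  have "partial k (\<lambda>x. damp \<delta> (\<phi> x) * damp \<delta> (\<phi> x) * \<phi> x $ i) x =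
      (damp \<delta> (\<phi> x))\<^sup>2 * partial k (\<lambda>x. \<phi> x $ i) x
      - 4 * \<delta> * damp \<delta> (\<phi> x) ^ 3 * (\<phi> x $ i * (transpose (jac \<phi> x) *v \<phi> x) $ k)" for i k
    by (simp add: partial_mult d partial_damp) (simp add: power2_eq_square power3_eq_cube algebra_simps)
  then show ?thesis
    by (simp add: jac_def[of "\<lambda>x. trunc \<delta> (\<phi> x)"] trunc_def trunc_jac_def outer_def vec_eq_iff power2_eq_square[of "damp _ _"])
       (simp add: jac_def power2_eq_square)
qed

lemma smooth_trunc_energy: "smooth (\<lambda>x. trunc_energy \<delta> (\<phi> x))"
  unfolding trunc_energy_def inner_vec_def inner_real_def divide_inverse
  by (intro smooth_mult smooth_damp smooth_sum smooth_const \<phi>)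

lemma partial_trunc_energy:
  assumes "\<delta> > 0"
  shows "partial k (\<lambda>x. trunc_energy \<delta> (\<phi> x)) x = (transpose (jac \<phi> x) *v trunc \<delta> (\<phi> x)) $ k"
proof -
  have pos: "1 + \<delta> * (v \<bullet> v) > 0" for v :: "real^3" using assms by (simp add: add_pos_nonneg)
  \<comment> \<open>For \<delta> > 0 the energy equals (1 - damp) / (2 \<delta>), an affine function
    of \<open>damp\<close>, so \<open>partial_damp\<close> gives its derivative at once.\<close>
  define c where "c = - (1 / (2 * \<delta>))"
  have eq: "trunc_energy \<delta> (\<phi> x) = (1 / (2 * \<delta>)) + c * damp \<delta> (\<phi> x)" for x
    using assms pos[of "\<phi> x"] unfolding c_def
    by (simp add: trunc_energy_def damp_def nonzero_eq_divide_eq divide_simps)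
  have "partial k (\<lambda>x. trunc_energy \<delta> (\<phi> x)) x = c * partial k (\<lambda>x. damp \<delta> (\<phi> x)) x"
    unfolding eq
    using smooth_differentiable[OF smooth_damp] smooth_differentiable[OF smooth_mult[OF smooth_const[of c] smooth_damp]]
    by (subst partial_add) (simp_all add: partial_mult partial_const)
  also have "\<dots> = (damp \<delta> (\<phi> x))\<^sup>2 * (transpose (jac \<phi> x) *v \<phi> x) $ k"
    using assms by (simp add: partial_damp c_def)
  also have "\<dots> = (transpose (jac \<phi> x) *v trunc \<delta> (\<phi> x)) $ k"
    by (simp add: trunc_def matrix_vector_mult_scaleR)
  finally show ?thesis .
qed

end

lemma vtest_support:
  assumes "\<phi> \<in> vtest_fun \<Omega>"
  obtains K where "compact K" "K \<subseteq> \<Omega>" "\<And>x. x \<notin> K \<Longrightarrow> \<phi> x = 0"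
proof -
  have "\<forall>i. \<exists>K. compact K \<and> K \<subseteq> \<Omega> \<and> (\<forall>x. x \<notin> K \<longrightarrow> \<phi> x $ i = 0)"
    using vtest_test[OF assms] unfolding test_fun_iff by blast
  then obtain K where K: "\<And>i. compact (K i)" "\<And>i. K i \<subseteq> \<Omega>" "\<And>i x. x \<notin> K i \<Longrightarrow> \<phi> x $ i = 0" by metis
  show thesis
    by (rule that[of "\<Union>i\<in>UNIV. K i"]) (use K in \<open>auto simp: vec_eq_iff intro!: compact_UN\<close>)
qed

lemma vtest_trunc:
  assumes "\<phi> \<in> vtest_fun \<Omega>" "\<delta> \<ge> 0" shows "(\<lambda>x. trunc \<delta> (\<phi> x)) \<in> vtest_fun \<Omega>"
proof -
  obtain K where "compact K" "K \<subseteq> \<Omega>" "\<And>x. x \<notin> K \<Longrightarrow> \<phi> x = 0" using vtest_support[OF assms(1)] by blast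
  then show ?thesis
    unfolding vtest_fun_def
    by (intro CollectI allI test_funI[of _ K] smooth_trunc vtest_smooth[OF assms(1)] assms(2)) (auto simp: trunc_def)
qed

lemma test_trunc_energy:
  assumes "\<phi> \<in> vtest_fun \<Omega>" "\<delta> \<ge> 0" shows "(\<lambda>x. trunc_energy \<delta> (\<phi> x)) \<in> test_fun \<Omega>"
proof -
  obtain K where "compact K" "K \<subseteq> \<Omega>" "\<And>x. x \<notin> K \<Longrightarrow> \<phi> x = 0" using vtest_support[OF assms(1)] by blast
  then show ?thesis
    by (intro test_funI[of _ K] smooth_trunc_energy vtest_smooth[OF assms(1)] assms(2)) (auto simp: trunc_energy_def)
qed

lemma vtest_diff: "\<phi> \<in> vtest_fun \<Omega> \<Longrightarrow> \<psi> \<in> vtest_fun \<Omega> \<Longrightarrow> (\<lambda>x. \<phi> x - \<psi> x) \<in> vtest_fun \<Omega>"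
  using test_fun_add[OF _ test_fun_mult[OF _ smooth_const[of "-1"]]] by (fastforce simp: vtest_fun_def)

lemma jac_diff: "\<phi> \<in> vtest_fun \<Omega> \<Longrightarrow> \<psi> \<in> vtest_fun \<Omega> \<Longrightarrow> jac (\<lambda>x. \<phi> x - \<psi> x) x = jac \<phi> x - jac \<psi> x"
  by (simp add: jac_def vec_eq_iff partial_diff smooth_differentiable vtest_smooth)

section \<open>The energy identity\<close>

context bounded_open
begin

text \<open>The approximating sequence converges almost everywhere and is dominated in \<open>L2\<close>, together with
  its Jacobians, so that limits can be taken by dominated convergence.\<close>

definition approximable ::
  "(real^3 \<Rightarrow> real^3) \<Rightarrow> (real^3 \<Rightarrow> real^3^3) \<Rightarrow> (nat \<Rightarrow> real^3 \<Rightarrow> real^3) \<Rightarrow> (real^3 \<Rightarrow> real) \<Rightarrow> bool" where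
  "approximable v A \<phi> s \<longleftrightarrow> v \<in> L2 \<Omega> \<and> A \<in> L2 \<Omega> \<and> (\<forall>j. \<phi> j \<in> vtest_fun \<Omega>) \<and> integrable M s \<and>
     (AE x in M. (\<lambda>j. \<phi> j x) \<longlonglongrightarrow> v x \<and> (\<lambda>j. jac (\<phi> j) x) \<longlonglongrightarrow> A x \<and>
        (\<forall>j. (norm (\<phi> j x))\<^sup>2 \<le> s x \<and> (norm (jac (\<phi> j) x))\<^sup>2 \<le> s x))"

lemma vH10_approximable:
  assumes v: "v \<in> vH10 \<Omega>"
  shows "\<exists>\<phi> s. approximable v (wjac \<Omega> v) \<phi> s"
proof -
  define Q where "Q i \<phi> s \<longleftrightarrow> (\<forall>j. \<phi> j \<in> test_fun \<Omega>) \<and> integrable M s \<and>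
    (AE x in M. (\<lambda>j. \<phi> j x) \<longlonglongrightarrow> v x $ i \<and> (\<forall>j. (\<phi> j x)\<^sup>2 \<le> s x) \<and>
      (\<forall>k. (\<lambda>j. partial k (\<phi> j) x) \<longlonglongrightarrow> wpartial \<Omega> k (\<lambda>y. v y $ i) x \<and> (\<forall>j. (partial k (\<phi> j) x)\<^sup>2 \<le> s x)))"
    for i \<phi> s
  have "\<exists>\<phi> s. Q i \<phi> s" for i
    by (rule H10_approx[OF vH10_comp[OF v, of i]]) (auto simp: Q_def)
  then obtain \<phi> s where Q: "\<And>i. Q i (\<phi> i) (s i)" by metis
  then have \<phi>: "\<phi> i j \<in> test_fun \<Omega>" and s: "integrable M (s i)"
    and ae: "AE x in M. (\<lambda>j. \<phi> i j x) \<longlonglongrightarrow> v x $ i \<and> (\<forall>j. (\<phi> i j x)\<^sup>2 \<le> s i x) \<and>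
      (\<forall>k. (\<lambda>j. partial k (\<phi> i j) x) \<longlonglongrightarrow> wpartial \<Omega> k (\<lambda>y. v y $ i) x \<and> (\<forall>j. (partial k (\<phi> i j) x)\<^sup>2 \<le> s i x))"
    for i j
    unfolding Q_def by blast+
  define \<Phi> where "\<Phi> j x = (\<chi> i. \<phi> i j x)" for j x
  \<comment> \<open>Row i of the Jacobian has three entries, each with square at most
    \<open>s i x\<close>; the bound for the values is then covered too.\<close>
  define S where "S x = (\<Sum>i\<in>UNIV. 3 * s i x)" for x
  have "approximable v (wjac \<Omega> v) \<Phi> S"
    unfolding approximable_def
  proof (intro conjI allI vH10_L2[OF v] wjac_L2[OF v])
    show "\<Phi> j \<in> vtest_fun \<Omega>" for j by (simp add: vtest_fun_def \<Phi>_def \<phi>)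
    show "integrable M S" unfolding S_def using s by simp
    have "AE x in M. \<forall>i. (\<lambda>j. \<phi> i j x) \<longlonglongrightarrow> v x $ i \<and> (\<forall>j. (\<phi> i j x)\<^sup>2 \<le> s i x) \<and>
      (\<forall>k. (\<lambda>j. partial k (\<phi> i j) x) \<longlonglongrightarrow> wpartial \<Omega> k (\<lambda>y. v y $ i) x \<and> (\<forall>j. (partial k (\<phi> i j) x)\<^sup>2 \<le> s i x))"
      using ae by (subst AE_all_countable) blast
    then show "AE x in M. (\<lambda>j. \<Phi> j x) \<longlonglongrightarrow> v x \<and> (\<lambda>j. jac (\<Phi> j) x) \<longlonglongrightarrow> wjac \<Omega> v x \<and>
        (\<forall>j. (norm (\<Phi> j x))\<^sup>2 \<le> S x \<and> (norm (jac (\<Phi> j) x))\<^sup>2 \<le> S x)"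
    proof eventually_elim
      case (elim x)
      have nn: "0 \<le> s i x" for i
      proof -
        have "(\<phi> i 0 x)\<^sup>2 \<le> s i x" using elim by blast
        then show ?thesis using zero_le_power2[of "\<phi> i 0 x"] by linarith
      qed
      have "(\<lambda>j. \<Phi> j x) \<longlonglongrightarrow> v x"
        unfolding \<Phi>_def by (rule vec_tendstoI) (use elim in simp)
      moreover have "(\<lambda>j. jac (\<Phi> j) x) \<longlonglongrightarrow> wjac \<Omega> v x"
        unfolding \<Phi>_def jac_def wjac_def
        by (rule vec_tendstoI, rule vec_tendstoI) (use elim in simp)
      moreover have "(norm (\<Phi> j x))\<^sup>2 \<le> S x" for j
      proof -
        have "(norm (\<Phi> j x))\<^sup>2 = (\<Sum>i\<in>UNIV. (\<phi> i j x)\<^sup>2)"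
          by (simp add: norm_vec_def L2_set_def sum_nonneg \<Phi>_def)
        also have "\<dots> \<le> S x"
          unfolding S_def
        proof (rule sum_mono)
          fix i
          have "(\<phi> i j x)\<^sup>2 \<le> s i x" using elim by blast
          then show "(\<phi> i j x)\<^sup>2 \<le> 3 * s i x" using nn[of i] by linarith
        qed
        finally show ?thesis .
      qed
      moreover have "(norm (jac (\<Phi> j) x))\<^sup>2 \<le> S x" for j
      proof -
        have "(norm (jac (\<Phi> j) x))\<^sup>2 = (\<Sum>i\<in>UNIV. \<Sum>k\<in>UNIV. (partial k (\<phi> i j) x)\<^sup>2)"
          by (simp add: norm_vec_def L2_set_def sum_nonneg \<Phi>_def jac_def)
        also have "\<dots> \<le> (\<Sum>i\<in>UNIV. \<Sum>k\<in>(UNIV :: 3 set). s i x)"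
          by (intro sum_mono) (use elim in blast)
        also have "\<dots> = S x" by (simp add: S_def)
        finally show ?thesis .
      qed
      ultimately show ?case by blast
    qed
  qed
  then show ?thesis by blast
qed

lemma approximable_diff:
  assumes 1: "approximable v A \<phi> s" and 2: "approximable v' A' \<phi>' s'"
  shows "approximable (\<lambda>x. v x - v' x) (\<lambda>x. A x - A' x) (\<lambda>j x. \<phi> j x - \<phi>' j x) (\<lambda>x. 2 * s x + 2 * s' x)"
  unfolding approximable_def
proof (intro conjI allI)
  have sq: "(norm (a - b))\<^sup>2 \<le> 2 * (norm a)\<^sup>2 + 2 * (norm b)\<^sup>2" for a b :: "'c::real_normed_vector"
  proof -
    have "(norm (a - b))\<^sup>2 \<le> (norm a + norm b)\<^sup>2" by (intro power_mono norm_triangle_ineq4) simp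
    also have "\<dots> \<le> 2 * (norm a)\<^sup>2 + 2 * (norm b)\<^sup>2"
      using sum_squares_bound[of "norm a" "norm b"] by (simp add: power2_sum)
    finally show ?thesis .
  qed
  have t: "\<phi> j \<in> vtest_fun \<Omega>" "\<phi>' j \<in> vtest_fun \<Omega>" for j using 1 2 by (auto simp: approximable_def)
  then show "(\<lambda>x. \<phi> j x - \<phi>' j x) \<in> vtest_fun \<Omega>" for j by (rule vtest_diff)
  show "(\<lambda>x. v x - v' x) \<in> L2 \<Omega>" "(\<lambda>x. A x - A' x) \<in> L2 \<Omega>"
    using 1 2 by (auto simp: approximable_def intro: L2_diff)
  show "integrable M (\<lambda>x. 2 * s x + 2 * s' x)" using 1 2 by (auto simp: approximable_def)
  have "AE x in M. (\<lambda>j. \<phi> j x) \<longlonglongrightarrow> v x \<and> (\<lambda>j. jac (\<phi> j) x) \<longlonglongrightarrow> A x \<and>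
        (\<forall>j. (norm (\<phi> j x))\<^sup>2 \<le> s x \<and> (norm (jac (\<phi> j) x))\<^sup>2 \<le> s x)"
    "AE x in M. (\<lambda>j. \<phi>' j x) \<longlonglongrightarrow> v' x \<and> (\<lambda>j. jac (\<phi>' j) x) \<longlonglongrightarrow> A' x \<and>
        (\<forall>j. (norm (\<phi>' j x))\<^sup>2 \<le> s' x \<and> (norm (jac (\<phi>' j) x))\<^sup>2 \<le> s' x)"
    using 1 2 by (auto simp: approximable_def)
  then show "AE x in M. (\<lambda>j. \<phi> j x - \<phi>' j x) \<longlonglongrightarrow> v x - v' x \<and>
      (\<lambda>j. jac (\<lambda>x. \<phi> j x - \<phi>' j x) x) \<longlonglongrightarrow> A x - A' x \<and>
      (\<forall>j. (norm (\<phi> j x - \<phi>' j x))\<^sup>2 \<le> 2 * s x + 2 * s' x \<and>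
        (norm (jac (\<lambda>x. \<phi> j x - \<phi>' j x) x))\<^sup>2 \<le> 2 * s x + 2 * s' x)"
  proof eventually_elim
    case (elim x)
    have "(norm (\<phi> j x - \<phi>' j x))\<^sup>2 \<le> 2 * s x + 2 * s' x" for j
    proof -
      have "(norm (\<phi> j x))\<^sup>2 \<le> s x" "(norm (\<phi>' j x))\<^sup>2 \<le> s' x" using elim by blast+
      then show ?thesis using sq[of "\<phi> j x" "\<phi>' j x"] by linarith
    qed
    moreover have "(norm (jac (\<phi> j) x - jac (\<phi>' j) x))\<^sup>2 \<le> 2 * s x + 2 * s' x" for j
    proof -
      have "(norm (jac (\<phi> j) x))\<^sup>2 \<le> s x" "(norm (jac (\<phi>' j) x))\<^sup>2 \<le> s' x" using elim by blast+
      then show ?thesis using sq[of "jac (\<phi> j) x" "jac (\<phi>' j) x"] by linarith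
    qed
    ultimately show ?case
      using elim by (simp add: jac_diff[OF t] tendsto_diff)
  qed
qed

section \<open>Transport of test fields by a field with bounded weak divergence\<close>

lemma vtest_M: "\<phi> \<in> vtest_fun \<Omega> \<Longrightarrow> \<phi> \<in> borel_measurable M"
  by (rule L2_measurable) (simp add: L2_vec test_L2 vtest_test)

lemma jac_M: "\<phi> \<in> vtest_fun \<Omega> \<Longrightarrow> jac \<phi> \<in> borel_measurable M"
  by (rule L2_measurable) (simp add: L2_vec jac_def test_L2 test_fun_partial vtest_test)

lemma jac_L2: "\<phi> \<in> vtest_fun \<Omega> \<Longrightarrow> jac \<phi> \<in> L2 \<Omega>"
  by (simp add: L2_vec jac_def test_L2 test_fun_partial vtest_test)

lemma vtest_L2: "\<phi> \<in> vtest_fun \<Omega> \<Longrightarrow> \<phi> \<in> L2 \<Omega>"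
  by (simp add: L2_vec test_L2 vtest_test)

lemma vtest_bounded:
  assumes \<phi>: "\<phi> \<in> vtest_fun \<Omega>" obtains C where "C \<ge> 0" "\<And>x. norm (\<phi> x) \<le> C" "\<And>x. norm (jac \<phi> x) \<le> C"
proof -
  have "\<forall>i. \<exists>C. \<forall>x. \<bar>\<phi> x $ i\<bar> \<le> C" using test_fun_bounded[OF vtest_test[OF \<phi>]] by metis
  then obtain B where B: "\<And>i x. \<bar>\<phi> x $ i\<bar> \<le> B i" by metis
  have "\<forall>i k. \<exists>C. \<forall>x. \<bar>partial k (\<lambda>x. \<phi> x $ i) x\<bar> \<le> C"
    using test_fun_bounded[OF test_fun_partial[OF vtest_test[OF \<phi>]]] by metis
  then obtain D where D: "\<And>i k x. \<bar>partial k (\<lambda>x. \<phi> x $ i) x\<bar> \<le> D i k" by metis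
  have 1: "norm (\<phi> x) \<le> (\<Sum>i\<in>UNIV. B i)" for x
    by (rule order_trans[OF norm_le_l1_cart sum_mono]) (rule B)
  have 2: "norm (jac \<phi> x) \<le> (\<Sum>i\<in>UNIV. \<Sum>k\<in>UNIV. D i k)" for x
  proof -
    have "norm (jac \<phi> x) \<le> (\<Sum>i\<in>UNIV. norm (jac \<phi> x $ i))"
      unfolding norm_vec_def[of "jac \<phi> x"] by (rule L2_set_le_sum) simp
    also have "\<dots> \<le> (\<Sum>i\<in>UNIV. \<Sum>k\<in>UNIV. D i k)"
      by (intro sum_mono order_trans[OF norm_le_l1_cart]) (simp add: jac_def D sum_mono)
    finally show ?thesis .
  qed
  show thesis
  proof (rule that[of "max 0 (max (\<Sum>i\<in>UNIV. B i) (\<Sum>i\<in>UNIV. \<Sum>k\<in>UNIV. D i k))"])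
  qed (use 1 2 in \<open>auto simp: le_max_iff_disj\<close>)
qed

lemma matrix_vector_measurable:
  fixes A :: "real^3 \<Rightarrow> real^3^3"
  assumes "A \<in> borel_measurable M" "w \<in> borel_measurable M"
  shows "(\<lambda>x. A x *v w x) \<in> borel_measurable M"
proof -
  have "continuous_on UNIV (\<lambda>p :: (real^3^3) \<times> (real^3). fst p *v snd p)"
    unfolding matrix_vector_mult_def by (intro continuous_intros)
  from borel_measurable_continuous_on[OF this borel_measurable_Pair[OF assms]] show ?thesis by simp
qed

lemma transpose_measurable:
  fixes A :: "real^3 \<Rightarrow> real^3^3"
  assumes "A \<in> borel_measurable M" shows "(\<lambda>x. transpose (A x)) \<in> borel_measurable M"
proof -
  have "continuous_on UNIV (\<lambda>A :: real^3^3. transpose A)"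
    unfolding transpose_def by (intro continuous_intros)
  from borel_measurable_continuous_on[OF this assms] show ?thesis .
qed

lemma tendsto_matrix_vector:
  fixes A :: "real^3^3"
  shows "(f \<longlongrightarrow> A) F \<Longrightarrow> (g \<longlongrightarrow> v) F \<Longrightarrow> ((\<lambda>n. f n *v g n) \<longlongrightarrow> A *v v) F"
  unfolding matrix_vector_mult_def by (intro tendsto_intros)

lemma tendsto_transpose:
  fixes A :: "real^3^3"
  shows "(f \<longlongrightarrow> A) F \<Longrightarrow> ((\<lambda>n. transpose (f n)) \<longlongrightarrow> transpose A) F"
  unfolding transpose_def by (intro tendsto_intros)

lemma abs_mult_le_squares: "\<bar>a\<bar> * \<bar>b\<bar> \<le> a\<^sup>2 + (b::real)\<^sup>2"
proof -
  have "2 * (\<bar>a\<bar> * \<bar>b\<bar>) \<le> a\<^sup>2 + b\<^sup>2"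
    using sum_squares_bound[of "\<bar>a\<bar>" "\<bar>b\<bar>"] by (simp add: mult.assoc)
  moreover have "0 \<le> \<bar>a\<bar> * \<bar>b\<bar>" by simp
  ultimately show ?thesis by linarith
qed

lemma weak_partial_sum:
  assumes "finite I" "\<And>i. i \<in> I \<Longrightarrow> weak_partial \<Omega> k (f i) (g i)"
    "\<And>i. i \<in> I \<Longrightarrow> f i \<in> L2 \<Omega>" "\<And>i. i \<in> I \<Longrightarrow> g i \<in> L2 \<Omega>"
  shows "weak_partial \<Omega> k (\<lambda>x. \<Sum>i\<in>I. f i x) (\<lambda>x. \<Sum>i\<in>I. g i x)"
  using assms
proof (induction I)
  case empty
  then show ?case using weak_partial_const[of k 0] by simp
next
  case (insert i I)
  have "weak_partial \<Omega> k (\<lambda>x. 1 * f i x + 1 * (\<Sum>i\<in>I. f i x)) (\<lambda>x. 1 * g i x + 1 * (\<Sum>i\<in>I. g i x))"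
    using insert by (intro weak_partial_lin L2_sum) auto
  then show ?case using insert.hyps by simp
qed

text \<open>\<open>div W = - g\<close> in the sense of distributions.\<close>

definition weak_div :: "(real^3 \<Rightarrow> real^3) \<Rightarrow> (real^3 \<Rightarrow> real) \<Rightarrow> bool" where
  "weak_div W g \<longleftrightarrow> W \<in> L2 \<Omega> \<and> g \<in> Linf \<Omega> \<and>
     (\<forall>\<psi>\<in>test_fun \<Omega>. (LINT x|M. W x \<bullet> grad \<psi> x) = (LINT x|M. g x * \<psi> x))"

lemma Linf_bound:
  assumes "g \<in> Linf \<Omega>" obtains C where "C \<ge> 0" "AE x in M. \<bar>g x\<bar> \<le> C"
proof -
  obtain C where "AE x in M. \<bar>g x\<bar> \<le> C" using assms by (auto simp: Linf_def)
  then have "AE x in M. \<bar>g x\<bar> \<le> max C 0" by eventually_elim auto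
  then show thesis using that[of "max C 0"] by auto
qed

lemma grad_inner:
  assumes v: "v \<in> vtest_fun \<Omega>" and \<phi>: "\<phi> \<in> vtest_fun \<Omega>"
  shows "(\<lambda>x. v x \<bullet> \<phi> x) \<in> test_fun \<Omega>"
    "grad (\<lambda>x. v x \<bullet> \<phi> x) x = transpose (jac v x) *v \<phi> x + transpose (jac \<phi> x) *v v x"
proof -
  have s: "smooth (\<lambda>x. v x $ i)" "smooth (\<lambda>x. \<phi> x $ i)" for i
    using v \<phi> by (auto intro: vtest_smooth)
  note d = smooth_differentiable[OF s(1)] smooth_differentiable[OF s(2)] smooth_differentiable[OF smooth_mult[OF s]]
  show "(\<lambda>x. v x \<bullet> \<phi> x) \<in> test_fun \<Omega>"
    unfolding inner_vec_def inner_real_def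
    by (intro test_fun_sum test_fun_mult[OF vtest_test[OF \<phi>] s(1)])
  have "partial k (\<lambda>x. v x \<bullet> \<phi> x) x =
     (\<Sum>i\<in>UNIV. partial k (\<lambda>x. v x $ i) x * \<phi> x $ i + v x $ i * partial k (\<lambda>x. \<phi> x $ i) x)" for k
    unfolding inner_vec_def inner_real_def by (subst partial_sum) (simp_all add: d partial_mult)
  then show "grad (\<lambda>x. v x \<bullet> \<phi> x) x = transpose (jac v x) *v \<phi> x + transpose (jac \<phi> x) *v v x"
    by (simp add: grad_def vec_eq_iff matrix_vector_mult_def transpose_def jac_def sum.distrib mult.commute)
qed

text \<open>The weak divergence of W may be paired only with test functions, and the product of v
  and \<open>\<phi>\<close> is in general not one. It is a dominated limit of products of test
  fields, together with its gradient, and this suffices because W is square integrable and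
  \<open>\<phi>\<close> and its Jacobian are bounded.\<close>

lemma B_tilde_eq:
  assumes W: "weak_div W g" and v: "v \<in> vH10 \<Omega>" and \<phi>: "\<phi> \<in> vtest_fun \<Omega>"
  shows "B_tilde \<Omega> W v \<phi> = (LINT x|M. (wjac \<Omega> v x *v W x) \<bullet> \<phi> x) - (1/2) * (LINT x|M. g x * (v x \<bullet> \<phi> x))"
proof -
  have WL: "W \<in> L2 \<Omega>" and g: "g \<in> Linf \<Omega>"
    and div: "\<And>\<psi>. \<psi> \<in> test_fun \<Omega> \<Longrightarrow> (LINT x|M. W x \<bullet> grad \<psi> x) = (LINT x|M. g x * \<psi> x)"
    using W by (auto simp: weak_div_def)
  obtain C where C: "C \<ge> 0" "\<And>x. norm (\<phi> x) \<le> C" "\<And>x. norm (jac \<phi> x) \<le> C" using vtest_bounded[OF \<phi>] by blast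
  obtain D where D: "D \<ge> 0" "AE x in M. \<bar>g x\<bar> \<le> D" using Linf_bound[OF g] by blast
  obtain a s where ap: "approximable v (wjac \<Omega> v) a s" using vH10_approximable[OF v] by blast
  have a: "\<And>j. a j \<in> vtest_fun \<Omega>" and s: "integrable M s" and
    ae: "AE x in M. (\<lambda>j. a j x) \<longlonglongrightarrow> v x \<and> (\<lambda>j. jac (a j) x) \<longlonglongrightarrow> wjac \<Omega> v x \<and>
        (\<forall>j. (norm (a j x))\<^sup>2 \<le> s x \<and> (norm (jac (a j) x))\<^sup>2 \<le> s x)"
    using ap by (auto simp: approximable_def)
  note m = L2_measurable[OF WL] L2_measurable[OF vH10_L2[OF v]] L2_measurable[OF wjac_L2[OF v]] vtest_M[OF \<phi>] jac_M[OF \<phi>]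
    L2_measurable[OF Linf_L2[OF g]]
  \<comment> \<open>The candidate for the weak gradient of the inner product of v and
    \<open>\<phi>\<close>. Uniqueness of weak derivatives identifies it with the
    \<open>wgrad\<close> occurring in \<open>B_tilde\<close>.\<close>
  define P where "P x = transpose (wjac \<Omega> v x) *v \<phi> x + transpose (jac \<phi> x) *v v x" for x
  have Pm: "P \<in> borel_measurable M"
    unfolding P_def[abs_def]
    by (intro borel_measurable_add matrix_vector_measurable transpose_measurable m)
  have PL: "P \<in> L2 \<Omega>"
  proof -
    have L: "(\<lambda>x. transpose (wjac \<Omega> v x) *v \<phi> x) \<in> L2 \<Omega>"
    proof (rule L2_bound)
      show "integrable M (\<lambda>x. C\<^sup>2 * (norm (wjac \<Omega> v x))\<^sup>2)" using L2_sq[OF wjac_L2[OF v]] by simp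
      have "(norm (transpose (wjac \<Omega> v x) *v \<phi> x))\<^sup>2 \<le> C\<^sup>2 * (norm (wjac \<Omega> v x))\<^sup>2" for x
      proof -
        have "norm (transpose (wjac \<Omega> v x) *v \<phi> x) \<le> norm (wjac \<Omega> v x) * norm (\<phi> x)"
          using norm_matrix_vector_le[of "transpose (wjac \<Omega> v x)" "\<phi> x"] by (simp add: norm_transpose)
        also have "\<dots> \<le> norm (wjac \<Omega> v x) * C" using C by (intro mult_left_mono) auto
        also have "\<dots> = C * norm (wjac \<Omega> v x)" by simp
        finally have "(norm (transpose (wjac \<Omega> v x) *v \<phi> x))\<^sup>2 \<le> (C * norm (wjac \<Omega> v x))\<^sup>2"
          by (rule power_mono) simp
        then show ?thesis by (simp add: power_mult_distrib)
      qed
      then show "AE x in M. (norm (transpose (wjac \<Omega> v x) *v \<phi> x))\<^sup>2 \<le> C\<^sup>2 * (norm (wjac \<Omega> v x))\<^sup>2" by simp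
    qed (intro matrix_vector_measurable transpose_measurable m)
    have L': "(\<lambda>x. transpose (jac \<phi> x) *v v x) \<in> L2 \<Omega>"
    proof (rule L2_bound)
      show "integrable M (\<lambda>x. C\<^sup>2 * (norm (v x))\<^sup>2)" using L2_sq[OF vH10_L2[OF v]] by simp
      have "(norm (transpose (jac \<phi> x) *v v x))\<^sup>2 \<le> C\<^sup>2 * (norm (v x))\<^sup>2" for x
      proof -
        have "norm (transpose (jac \<phi> x) *v v x) \<le> norm (jac \<phi> x) * norm (v x)"
          using norm_matrix_vector_le[of "transpose (jac \<phi> x)" "v x"] by (simp add: norm_transpose)
        also have "\<dots> \<le> C * norm (v x)" using C by (simp add: mult_right_mono)
        finally have "(norm (transpose (jac \<phi> x) *v v x))\<^sup>2 \<le> (C * norm (v x))\<^sup>2"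
          by (rule power_mono) simp
        then show ?thesis by (simp add: power_mult_distrib)
      qed
      then show "AE x in M. (norm (transpose (jac \<phi> x) *v v x))\<^sup>2 \<le> C\<^sup>2 * (norm (v x))\<^sup>2" by simp
    qed (intro matrix_vector_measurable transpose_measurable m)
    show ?thesis unfolding P_def[abs_def] by (rule L2_add[OF L L'])
  qed
  have wg: "AE x in M. wgrad \<Omega> (\<lambda>y. v y \<bullet> \<phi> y) x = P x"
  proof (rule wgrad_AE[OF PL])
    fix k
    have "weak_partial \<Omega> k (\<lambda>x. \<Sum>i\<in>UNIV. \<phi> x $ i * v x $ i)
        (\<lambda>x. \<Sum>i\<in>UNIV. partial k (\<lambda>x. \<phi> x $ i) x * v x $ i + \<phi> x $ i * wpartial \<Omega> k (\<lambda>x. v x $ i) x)"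
    proof (rule weak_partial_sum)
      fix i
      note h = vH10_H1[OF v, of i]
      show "weak_partial \<Omega> k (\<lambda>x. \<phi> x $ i * v x $ i)
          (\<lambda>x. partial k (\<lambda>x. \<phi> x $ i) x * v x $ i + \<phi> x $ i * wpartial \<Omega> k (\<lambda>x. v x $ i) x)"
        by (rule weak_partial_mult_test[OF H1_L2[OF h] H1_wpartial[OF h] vtest_test[OF \<phi>]])
      show "(\<lambda>x. \<phi> x $ i * v x $ i) \<in> L2 \<Omega>" by (rule L2_mult_test[OF H1_L2[OF h] vtest_test[OF \<phi>]])
      show "(\<lambda>x. partial k (\<lambda>x. \<phi> x $ i) x * v x $ i + \<phi> x $ i * wpartial \<Omega> k (\<lambda>x. v x $ i) x) \<in> L2 \<Omega>"
        by (rule L2_add[OF L2_mult_test[OF H1_L2[OF h] test_fun_partial[OF vtest_test[OF \<phi>]]]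
              L2_mult_test[OF H1_wpartial(1)[OF h] vtest_test[OF \<phi>]]])
    qed simp
    moreover have "(\<lambda>x. \<Sum>i\<in>UNIV. partial k (\<lambda>x. \<phi> x $ i) x * v x $ i + \<phi> x $ i * wpartial \<Omega> k (\<lambda>x. v x $ i) x) = (\<lambda>x. P x $ k)"
      by (simp add: P_def matrix_vector_mult_def transpose_def jac_def wjac_def sum.distrib mult.commute add.commute)
    ultimately show "weak_partial \<Omega> k (\<lambda>y. v y \<bullet> \<phi> y) (\<lambda>x. P x $ k)"
      by (simp add: inner_vec_def mult.commute)
  qed
  have lim1: "(\<lambda>j. LINT x|M. W x \<bullet> grad (\<lambda>x. a j x \<bullet> \<phi> x) x) \<longlonglongrightarrow> (LINT x|M. W x \<bullet> P x)"
  proof (rule integral_dominated_convergence)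
    show "integrable M (\<lambda>x. 2 * C * ((norm (W x))\<^sup>2 + s x))" using L2_sq[OF WL] s by simp
    show "AE x in M. (\<lambda>j. W x \<bullet> grad (\<lambda>x. a j x \<bullet> \<phi> x) x) \<longlonglongrightarrow> W x \<bullet> P x"
      using ae unfolding grad_inner(2)[OF a \<phi>] P_def
      by eventually_elim (intro tendsto_intros tendsto_matrix_vector tendsto_transpose; blast)
    show "AE x in M. norm (W x \<bullet> grad (\<lambda>x. a j x \<bullet> \<phi> x) x) \<le> 2 * C * ((norm (W x))\<^sup>2 + s x)" for j
      using ae
    proof eventually_elim
      case (elim x)
      have n1: "norm (transpose (jac (a j) x) *v \<phi> x) \<le> C * norm (jac (a j) x)"
        using norm_matrix_vector_le[of "transpose (jac (a j) x)" "\<phi> x"] mult_left_mono[OF C(2)[of x] norm_ge_zero[of "jac (a j) x"]]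
        by (simp add: norm_transpose mult.commute)
      have n2: "norm (transpose (jac \<phi> x) *v a j x) \<le> C * norm (a j x)"
        using norm_matrix_vector_le[of "transpose (jac \<phi> x)" "a j x"] mult_right_mono[OF C(3)[of x] norm_ge_zero[of "a j x"]]
        by (simp add: norm_transpose)
      have q: "norm (W x) * norm (jac (a j) x) \<le> (norm (W x))\<^sup>2 + s x" "norm (W x) * norm (a j x) \<le> (norm (W x))\<^sup>2 + s x"
        using elim abs_mult_le_squares[of "norm (W x)" "norm (jac (a j) x)"] abs_mult_le_squares[of "norm (W x)" "norm (a j x)"]
        by (simp_all, (meson add_left_mono order_trans)+)
      have "\<bar>W x \<bullet> grad (\<lambda>x. a j x \<bullet> \<phi> x) x\<bar> \<le> norm (W x) * norm (grad (\<lambda>x. a j x \<bullet> \<phi> x) x)"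
        by (rule Cauchy_Schwarz_ineq2)
      also have "\<dots> \<le> norm (W x) * (C * norm (jac (a j) x) + C * norm (a j x))"
        unfolding grad_inner(2)[OF a \<phi>] by (intro mult_left_mono norm_triangle_le add_mono n1 n2) simp
      also have "\<dots> = C * (norm (W x) * norm (jac (a j) x) + norm (W x) * norm (a j x))"
        by (simp add: algebra_simps)
      also have "\<dots> \<le> C * (((norm (W x))\<^sup>2 + s x) + ((norm (W x))\<^sup>2 + s x))"
        by (intro mult_left_mono add_mono q C)
      finally show ?case by (simp add: algebra_simps)
    qed
    show "(\<lambda>x. W x \<bullet> grad (\<lambda>x. a j x \<bullet> \<phi> x) x) \<in> borel_measurable M" for j
      using m(1) L2_measurable[OF grad_L2[OF grad_inner(1)[OF a[of j] \<phi>]]] by simp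
  qed (use m(1) Pm in simp)
  have lim2: "(\<lambda>j. LINT x|M. g x * (a j x \<bullet> \<phi> x)) \<longlonglongrightarrow> (LINT x|M. g x * (v x \<bullet> \<phi> x))"
  proof (rule integral_dominated_convergence)
    show "integrable M (\<lambda>x. D * (s x + C\<^sup>2))" using s by simp
    show "AE x in M. (\<lambda>j. g x * (a j x \<bullet> \<phi> x)) \<longlonglongrightarrow> g x * (v x \<bullet> \<phi> x)"
      using ae by eventually_elim (intro tendsto_intros; blast)
    show "AE x in M. norm (g x * (a j x \<bullet> \<phi> x)) \<le> D * (s x + C\<^sup>2)" for j
      using ae D(2)
    proof eventually_elim
      case (elim x)
      have "\<bar>a j x \<bullet> \<phi> x\<bar> \<le> norm (a j x) * norm (\<phi> x)" by (rule Cauchy_Schwarz_ineq2)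
      also have "\<dots> \<le> (norm (a j x))\<^sup>2 + (norm (\<phi> x))\<^sup>2"
        using abs_mult_le_squares[of "norm (a j x)" "norm (\<phi> x)"] by simp
      also have "\<dots> \<le> s x + C\<^sup>2" using elim C by (intro add_mono power_mono) auto
      finally show ?case using elim D(1) by (auto simp: abs_mult intro!: mult_mono)
    qed
  qed (use m vtest_M[OF a] in simp_all)
  have "(LINT x|M. W x \<bullet> P x) = (LINT x|M. g x * (v x \<bullet> \<phi> x))"
    by (rule LIMSEQ_unique[OF lim1]) (simp add: div[OF grad_inner(1)[OF a \<phi>]] lim2)
  moreover have "(LINT x|M. W x \<bullet> wgrad \<Omega> (\<lambda>y. v y \<bullet> \<phi> y) x) = (LINT x|M. W x \<bullet> P x)"
  proof (rule integral_cong_AE)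
    have "wgrad \<Omega> (\<lambda>y. v y \<bullet> \<phi> y) \<in> borel_measurable M"
      by (rule AE_measurable[OF Pm]) (use wg in \<open>auto elim: eventually_mono\<close>)
    with m(1) show "(\<lambda>x. W x \<bullet> wgrad \<Omega> (\<lambda>y. v y \<bullet> \<phi> y) x) \<in> borel_measurable M" by simp
    show "AE x in M. W x \<bullet> wgrad \<Omega> (\<lambda>y. v y \<bullet> \<phi> y) x = W x \<bullet> P x"
      using wg by eventually_elim simp
  qed (use m(1) Pm in simp)
  ultimately show ?thesis by (simp add: B_tilde_def)
qed


text \<open>Formally this is the equation at \<open>\<psi> = e\<close>, with A the Jacobian of e,
  and transport contributes half of g |e|^2. As A W is merely integrable, the limit of the
  approximating fields is taken first, at fixed \<delta>, where the truncated fields are bounded.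
  The transport term is then rewritten through \<open>trunc_energy\<close>, and only afterwards
  \<delta> tends to 0.\<close>

lemma energy_identity:
  assumes ap: "approximable e A \<phi> s" and W: "weak_div W g" and c: "c \<in> Linf \<Omega>" and P: "P \<in> L2 \<Omega>"
    and eq: "\<And>\<psi>. \<psi> \<in> vtest_fun \<Omega> \<Longrightarrow> (LINT x|M. c x * (e x \<bullet> \<psi> x)) + (LINT x|M. (A x *v W x) \<bullet> \<psi> x)
      + (LINT x|M. P x \<bullet> jac \<psi> x) = 0"
  shows "(LINT x|M. (c x + g x / 2) * (e x \<bullet> e x)) + (LINT x|M. P x \<bullet> A x) = 0"
proof -
  have eL: "e \<in> L2 \<Omega>" and AL: "A \<in> L2 \<Omega>" and \<phi>: "\<And>j. \<phi> j \<in> vtest_fun \<Omega>" and s: "integrable M s"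
    and ae: "AE x in M. (\<lambda>j. \<phi> j x) \<longlonglongrightarrow> e x \<and> (\<lambda>j. jac (\<phi> j) x) \<longlonglongrightarrow> A x \<and>
        (\<forall>j. (norm (\<phi> j x))\<^sup>2 \<le> s x \<and> (norm (jac (\<phi> j) x))\<^sup>2 \<le> s x)"
    using ap by (auto simp: approximable_def)
  have WL: "W \<in> L2 \<Omega>" and g: "g \<in> Linf \<Omega>"
    and div: "\<And>\<psi>. \<psi> \<in> test_fun \<Omega> \<Longrightarrow> (LINT x|M. W x \<bullet> grad \<psi> x) = (LINT x|M. g x * \<psi> x)"
    using W by (auto simp: weak_div_def)
  obtain C where C: "C \<ge> 0" "AE x in M. \<bar>c x\<bar> \<le> C" using Linf_bound[OF c] by blast
  obtain D where D: "D \<ge> 0" "AE x in M. \<bar>g x\<bar> \<le> D" using Linf_bound[OF g] by blast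
  note m = L2_measurable[OF eL] L2_measurable[OF AL] L2_measurable[OF WL] L2_measurable[OF P]
    L2_measurable[OF Linf_L2[OF c]] L2_measurable[OF Linf_L2[OF g]]
  note cm = borel_measurable_continuous_on
  have tm: "(\<lambda>x. trunc \<delta> (f x)) \<in> borel_measurable M" if "\<delta> \<ge> 0" "f \<in> borel_measurable M" for \<delta> f
    by (rule cm[OF continuous_trunc[OF that(1)] that(2)])
  have gm: "(\<lambda>x. trunc_energy \<delta> (f x)) \<in> borel_measurable M" if "\<delta> \<ge> 0" "f \<in> borel_measurable M" for \<delta> f
    by (rule cm[OF continuous_trunc_energy[OF that(1)] that(2)])
  have jm: "(\<lambda>x. trunc_jac \<delta> (f x) (B x)) \<in> borel_measurable M"
    if "\<delta> \<ge> 0" "f \<in> borel_measurable M" "B \<in> borel_measurable M" for \<delta> f B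
    using cm[OF continuous_trunc_jac[OF that(1)] borel_measurable_Pair[OF that(2,3)]] by simp
  have AW: "(\<lambda>x. A x *v W x) \<in> borel_measurable M" by (intro matrix_vector_measurable m)
  \<comment> \<open>The identity at fixed \<delta>, with the transport term already expressed
    through g: A W no longer appears.\<close>
  have reg: "(LINT x|M. c x * (e x \<bullet> trunc \<delta> (e x))) + (LINT x|M. g x * trunc_energy \<delta> (e x))
      + (LINT x|M. P x \<bullet> trunc_jac \<delta> (e x) (A x)) = 0" if \<delta>: "0 < \<delta>" "\<delta> \<le> 1" for \<delta>
  proof -
    have \<delta>0: "\<delta> \<ge> 0" using \<delta> by simp
    have tt: "(\<lambda>x. trunc \<delta> (\<phi> j x)) \<in> vtest_fun \<Omega>" for j by (rule vtest_trunc[OF \<phi> \<delta>0])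
    have te: "(\<lambda>x. trunc_energy \<delta> (\<phi> j x)) \<in> test_fun \<Omega>" for j by (rule test_trunc_energy[OF \<phi> \<delta>0])
    have tj: "jac (\<lambda>x. trunc \<delta> (\<phi> j x)) x = trunc_jac \<delta> (\<phi> j x) (jac (\<phi> j) x)" for j x
      by (rule jac_trunc[OF vtest_smooth[OF \<phi>] \<delta>0])
    have ct: "(\<lambda>j. trunc \<delta> (f j)) \<longlonglongrightarrow> trunc \<delta> l" if "f \<longlonglongrightarrow> l" for f l
      by (rule continuous_on_tendsto_compose[OF continuous_trunc[OF \<delta>0] that]) auto
    have cg: "(\<lambda>j. trunc_energy \<delta> (f j)) \<longlonglongrightarrow> trunc_energy \<delta> l" if "f \<longlonglongrightarrow> l" for f l
      by (rule continuous_on_tendsto_compose[OF continuous_trunc_energy[OF \<delta>0] that]) auto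
    have cj: "(\<lambda>j. trunc_jac \<delta> (f j) (B j)) \<longlonglongrightarrow> trunc_jac \<delta> l L" if "f \<longlonglongrightarrow> l" "B \<longlonglongrightarrow> L" for f l B L
      using continuous_on_tendsto_compose[OF continuous_trunc_jac[OF \<delta>0] tendsto_Pair[OF that]] by simp
    note pm = vtest_M[OF \<phi>] jac_M[OF \<phi>]
    have l1: "(\<lambda>j. LINT x|M. c x * (e x \<bullet> trunc \<delta> (\<phi> j x))) \<longlonglongrightarrow> (LINT x|M. c x * (e x \<bullet> trunc \<delta> (e x)))"
    proof (rule integral_dominated_convergence)
      show "integrable M (\<lambda>x. C * ((norm (e x))\<^sup>2 + s x))" using L2_sq[OF eL] s by simp
      show "AE x in M. (\<lambda>j. c x * (e x \<bullet> trunc \<delta> (\<phi> j x))) \<longlonglongrightarrow> c x * (e x \<bullet> trunc \<delta> (e x))"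
        using ae by eventually_elim (intro tendsto_intros ct; blast)
      show "AE x in M. norm (c x * (e x \<bullet> trunc \<delta> (\<phi> j x))) \<le> C * ((norm (e x))\<^sup>2 + s x)" for j
        using ae C(2)
      proof eventually_elim
        case (elim x)
        have "\<bar>e x \<bullet> trunc \<delta> (\<phi> j x)\<bar> \<le> norm (e x) * norm (trunc \<delta> (\<phi> j x))" by (rule Cauchy_Schwarz_ineq2)
        also have "\<dots> \<le> norm (e x) * norm (\<phi> j x)" by (intro mult_left_mono trunc_le \<delta>0) simp
        also have "\<dots> \<le> (norm (e x))\<^sup>2 + (norm (\<phi> j x))\<^sup>2"
          using abs_mult_le_squares[of "norm (e x)" "norm (\<phi> j x)"] by simp
        also have "\<dots> \<le> (norm (e x))\<^sup>2 + s x" using elim by simp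
        finally show ?case using elim C(1) by (auto simp: abs_mult intro!: mult_mono)
      qed
    qed (use m tm[OF \<delta>0 m(1)] tm[OF \<delta>0 pm(1)] in simp_all)
    have l2: "(\<lambda>j. LINT x|M. (A x *v W x) \<bullet> trunc \<delta> (\<phi> j x)) \<longlonglongrightarrow> (LINT x|M. (A x *v W x) \<bullet> trunc \<delta> (e x))"
    proof (rule integral_dominated_convergence)
      show "integrable M (\<lambda>x. (norm (A x) * norm (W x)) * (1 / \<delta>))"
        using L2_norm_mult_integrable[OF AL WL] by simp
      show "AE x in M. (\<lambda>j. (A x *v W x) \<bullet> trunc \<delta> (\<phi> j x)) \<longlonglongrightarrow> (A x *v W x) \<bullet> trunc \<delta> (e x)"
        using ae by eventually_elim (intro tendsto_intros ct; blast)
      show "AE x in M. norm ((A x *v W x) \<bullet> trunc \<delta> (\<phi> j x)) \<le> (norm (A x) * norm (W x)) * (1 / \<delta>)" for j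
      proof (rule AE_I2)
        fix x
        have "norm ((A x *v W x) \<bullet> trunc \<delta> (\<phi> j x)) \<le> norm (A x *v W x) * norm (trunc \<delta> (\<phi> j x))"
          using Cauchy_Schwarz_ineq2 by simp
        also have "\<dots> \<le> (norm (A x) * norm (W x)) * (1 / \<delta>)"
          by (intro mult_mono norm_matrix_vector_le trunc_bounded \<delta>) auto
        finally show "norm ((A x *v W x) \<bullet> trunc \<delta> (\<phi> j x)) \<le> (norm (A x) * norm (W x)) * (1 / \<delta>)" .
      qed
    qed (use AW tm[OF \<delta>0 m(1)] tm[OF \<delta>0 pm(1)] in simp_all)
    have l3: "(\<lambda>j. LINT x|M. P x \<bullet> trunc_jac \<delta> (\<phi> j x) (jac (\<phi> j) x)) \<longlonglongrightarrow> (LINT x|M. P x \<bullet> trunc_jac \<delta> (e x) (A x))"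
    proof (rule integral_dominated_convergence)
      show "integrable M (\<lambda>x. 5 * ((norm (P x))\<^sup>2 + s x))" using L2_sq[OF P] s by simp
      show "AE x in M. (\<lambda>j. P x \<bullet> trunc_jac \<delta> (\<phi> j x) (jac (\<phi> j) x)) \<longlonglongrightarrow> P x \<bullet> trunc_jac \<delta> (e x) (A x)"
        using ae by eventually_elim (intro tendsto_intros cj; blast)
      show "AE x in M. norm (P x \<bullet> trunc_jac \<delta> (\<phi> j x) (jac (\<phi> j) x)) \<le> 5 * ((norm (P x))\<^sup>2 + s x)" for j
        using ae
      proof eventually_elim
        case (elim x)
        have "\<bar>P x \<bullet> trunc_jac \<delta> (\<phi> j x) (jac (\<phi> j) x)\<bar> \<le> norm (P x) * norm (trunc_jac \<delta> (\<phi> j x) (jac (\<phi> j) x))"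
          by (rule Cauchy_Schwarz_ineq2)
        also have "\<dots> \<le> norm (P x) * (5 * norm (jac (\<phi> j) x))" by (intro mult_left_mono trunc_jac_le \<delta>0) simp
        also have "\<dots> = 5 * (norm (P x) * norm (jac (\<phi> j) x))" by simp
        also have "\<dots> \<le> 5 * ((norm (P x))\<^sup>2 + (norm (jac (\<phi> j) x))\<^sup>2)"
          using abs_mult_le_squares[of "norm (P x)" "norm (jac (\<phi> j) x)"] by simp
        also have "\<dots> \<le> 5 * ((norm (P x))\<^sup>2 + s x)" using elim by simp
        finally show ?case by simp
      qed
    qed (use m jm[OF \<delta>0 m(1) m(2)] jm[OF \<delta>0 pm] in simp_all)
    have l4: "(\<lambda>j. LINT x|M. g x * trunc_energy \<delta> (\<phi> j x)) \<longlonglongrightarrow> (LINT x|M. g x * trunc_energy \<delta> (e x))"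
    proof (rule integral_dominated_convergence)
      show "integrable M (\<lambda>x. D * s x)" using s by simp
      show "AE x in M. (\<lambda>j. g x * trunc_energy \<delta> (\<phi> j x)) \<longlonglongrightarrow> g x * trunc_energy \<delta> (e x)"
        using ae by eventually_elim (intro tendsto_intros cg; blast)
      show "AE x in M. norm (g x * trunc_energy \<delta> (\<phi> j x)) \<le> D * s x" for j
        using ae D(2)
      proof eventually_elim
        case (elim x)
        have "\<bar>trunc_energy \<delta> (\<phi> j x)\<bar> \<le> (norm (\<phi> j x))\<^sup>2" using trunc_energy_bounds[OF \<delta>0, of "\<phi> j x"] by simp
        also have "\<dots> \<le> s x" using elim by blast
        finally show ?case using elim D(1) by (auto simp: abs_mult intro!: mult_mono)
      qed
    qed (use m gm[OF \<delta>0 m(1)] gm[OF \<delta>0 pm(1)] in simp_all)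
    \<comment> \<open>The limit is that of \<open>l2\<close>, but here the Jacobian is approximated
      as well. Along this sequence the integrand is W against the gradient of a genuine test
      function, so the weak divergence of W applies before the limit.\<close>
    have l5: "(\<lambda>j. LINT x|M. (jac (\<phi> j) x *v W x) \<bullet> trunc \<delta> (\<phi> j x)) \<longlonglongrightarrow> (LINT x|M. (A x *v W x) \<bullet> trunc \<delta> (e x))"
    proof (rule integral_dominated_convergence)
      show "integrable M (\<lambda>x. ((norm (W x))\<^sup>2 + s x) * (1 / \<delta>))"
        using L2_sq[OF WL] s by simp
      show "AE x in M. (\<lambda>j. (jac (\<phi> j) x *v W x) \<bullet> trunc \<delta> (\<phi> j x)) \<longlonglongrightarrow> (A x *v W x) \<bullet> trunc \<delta> (e x)"
        using ae by eventually_elim (intro tendsto_intros ct tendsto_matrix_vector; blast)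
      show "AE x in M. norm ((jac (\<phi> j) x *v W x) \<bullet> trunc \<delta> (\<phi> j x)) \<le> ((norm (W x))\<^sup>2 + s x) * (1 / \<delta>)" for j
        using ae
      proof eventually_elim
        case (elim x)
        have "norm ((jac (\<phi> j) x *v W x) \<bullet> trunc \<delta> (\<phi> j x)) \<le> norm (jac (\<phi> j) x *v W x) * norm (trunc \<delta> (\<phi> j x))"
          using Cauchy_Schwarz_ineq2 by simp
        also have "\<dots> \<le> (norm (jac (\<phi> j) x) * norm (W x)) * (1 / \<delta>)"
          by (intro mult_mono norm_matrix_vector_le trunc_bounded \<delta>) auto
        also have "\<dots> \<le> ((norm (jac (\<phi> j) x))\<^sup>2 + (norm (W x))\<^sup>2) * (1 / \<delta>)"
          using abs_mult_le_squares[of "norm (jac (\<phi> j) x)" "norm (W x)"] \<delta> by (intro mult_right_mono) auto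
        also have "\<dots> \<le> ((norm (W x))\<^sup>2 + s x) * (1 / \<delta>)"
        proof (rule mult_right_mono)
          have "(norm (jac (\<phi> j) x))\<^sup>2 \<le> s x" using elim by blast
          then show "(norm (jac (\<phi> j) x))\<^sup>2 + (norm (W x))\<^sup>2 \<le> (norm (W x))\<^sup>2 + s x" by linarith
        qed (use \<delta> in simp)
        finally show ?case .
      qed
      show "(\<lambda>x. (A x *v W x) \<bullet> trunc \<delta> (e x)) \<in> borel_measurable M"
        using AW tm[OF \<delta>0 m(1)] by simp
      show "(\<lambda>x. (jac (\<phi> j) x *v W x) \<bullet> trunc \<delta> (\<phi> j x)) \<in> borel_measurable M" for j
        using matrix_vector_measurable[OF pm(2) m(3), of j] tm[OF \<delta>0 pm(1), of j] by simp
    qed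
    have "(LINT x|M. (jac (\<phi> j) x *v W x) \<bullet> trunc \<delta> (\<phi> j x)) = (LINT x|M. g x * trunc_energy \<delta> (\<phi> j x))" for j
    proof -
      have "grad (\<lambda>x. trunc_energy \<delta> (\<phi> j x)) x = transpose (jac (\<phi> j) x) *v trunc \<delta> (\<phi> j x)" for x
        by (simp add: grad_def vec_eq_iff partial_trunc_energy[OF vtest_smooth[OF \<phi>] \<delta>0 \<delta>(1)])
      then have "W x \<bullet> grad (\<lambda>x. trunc_energy \<delta> (\<phi> j x)) x = (jac (\<phi> j) x *v W x) \<bullet> trunc \<delta> (\<phi> j x)" for x
        by (simp only: inner_matrix_vector)
      then show ?thesis using div[OF te[of j]] by simp
    qed
    then have "(LINT x|M. (A x *v W x) \<bullet> trunc \<delta> (e x)) = (LINT x|M. g x * trunc_energy \<delta> (e x))"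
      using LIMSEQ_unique[OF l5] l4 by simp
    moreover have "(\<lambda>j. (LINT x|M. c x * (e x \<bullet> trunc \<delta> (\<phi> j x))) + (LINT x|M. (A x *v W x) \<bullet> trunc \<delta> (\<phi> j x))
      + (LINT x|M. P x \<bullet> trunc_jac \<delta> (\<phi> j x) (jac (\<phi> j) x))) \<longlonglongrightarrow>
      (LINT x|M. c x * (e x \<bullet> trunc \<delta> (e x))) + (LINT x|M. (A x *v W x) \<bullet> trunc \<delta> (e x))
      + (LINT x|M. P x \<bullet> trunc_jac \<delta> (e x) (A x))"
      by (intro tendsto_add l1 l2 l3)
    ultimately show ?thesis using eq[OF tt] by (simp add: tj LIMSEQ_const_iff)
  qed
  \<comment> \<open>From here \<delta> tends to 0, and the majorants are the bounds uniform in
    \<delta>: |e|^2 for the first two terms and 5 |P| |A| for the last.\<close>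
  define d where "d n = inverse (real (Suc n))" for n
  have d: "0 < d n" "d n \<le> 1" "d n \<ge> 0" for n by (auto simp: d_def field_simps)
  have d0: "d \<longlonglongrightarrow> 0" unfolding d_def by (rule LIMSEQ_inverse_real_of_nat)
  have l1: "(\<lambda>n. LINT x|M. c x * (e x \<bullet> trunc (d n) (e x))) \<longlonglongrightarrow> (LINT x|M. c x * (e x \<bullet> e x))"
  proof (rule integral_dominated_convergence)
    show "integrable M (\<lambda>x. C * (norm (e x))\<^sup>2)" using L2_sq[OF eL] by simp
    show "AE x in M. norm (c x * (e x \<bullet> trunc (d n) (e x))) \<le> C * (norm (e x))\<^sup>2" for n
      using C(2)
    proof eventually_elim
      case (elim x)
      have "\<bar>e x \<bullet> trunc (d n) (e x)\<bar> \<le> norm (e x) * norm (trunc (d n) (e x))" by (rule Cauchy_Schwarz_ineq2)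
      also have "\<dots> \<le> norm (e x) * norm (e x)" by (intro mult_left_mono trunc_le d) simp
      finally show ?case using elim C(1) by (auto simp: abs_mult power2_eq_square intro!: mult_mono)
    qed
    show "AE x in M. (\<lambda>n. c x * (e x \<bullet> trunc (d n) (e x))) \<longlonglongrightarrow> c x * (e x \<bullet> e x)"
      by (intro AE_I2 tendsto_mult tendsto_inner tendsto_const tendsto_trunc_0 d0)
  qed (use m tm[OF d(3) m(1)] in simp_all)
  have l2: "(\<lambda>n. LINT x|M. g x * trunc_energy (d n) (e x)) \<longlonglongrightarrow> (LINT x|M. g x * (e x \<bullet> e x / 2))"
  proof (rule integral_dominated_convergence)
    show "integrable M (\<lambda>x. D * (norm (e x))\<^sup>2)" using L2_sq[OF eL] by simp
    show "AE x in M. norm (g x * trunc_energy (d n) (e x)) \<le> D * (norm (e x))\<^sup>2" for n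
      using D(2)
    proof eventually_elim
      case (elim x)
      have "\<bar>trunc_energy (d n) (e x)\<bar> \<le> (norm (e x))\<^sup>2" using trunc_energy_bounds[OF d(3), of n "e x"] by simp
      then show ?case using elim D(1) by (auto simp: abs_mult intro!: mult_mono)
    qed
    show "AE x in M. (\<lambda>n. g x * trunc_energy (d n) (e x)) \<longlonglongrightarrow> g x * (e x \<bullet> e x / 2)"
      by (intro AE_I2 tendsto_mult tendsto_const tendsto_trunc_energy_0 d0)
  qed (use m gm[OF d(3) m(1)] in simp_all)
  have l3: "(\<lambda>n. LINT x|M. P x \<bullet> trunc_jac (d n) (e x) (A x)) \<longlonglongrightarrow> (LINT x|M. P x \<bullet> A x)"
  proof (rule integral_dominated_convergence)
    show "integrable M (\<lambda>x. 5 * (norm (P x) * norm (A x)))" using L2_norm_mult_integrable[OF P AL] by simp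
    show "AE x in M. norm (P x \<bullet> trunc_jac (d n) (e x) (A x)) \<le> 5 * (norm (P x) * norm (A x))" for n
    proof (rule AE_I2)
      fix x
      have "\<bar>P x \<bullet> trunc_jac (d n) (e x) (A x)\<bar> \<le> norm (P x) * norm (trunc_jac (d n) (e x) (A x))"
        by (rule Cauchy_Schwarz_ineq2)
      also have "\<dots> \<le> norm (P x) * (5 * norm (A x))" by (intro mult_left_mono trunc_jac_le d) simp
      finally show "norm (P x \<bullet> trunc_jac (d n) (e x) (A x)) \<le> 5 * (norm (P x) * norm (A x))" by simp
    qed
    show "AE x in M. (\<lambda>n. P x \<bullet> trunc_jac (d n) (e x) (A x)) \<longlonglongrightarrow> P x \<bullet> A x"
      by (intro AE_I2 tendsto_inner tendsto_const tendsto_trunc_jac_0 d0)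
  qed (use m jm[OF d(3) m(1) m(2)] in simp_all)
  have "(LINT x|M. c x * (e x \<bullet> e x)) + (LINT x|M. g x * (e x \<bullet> e x / 2)) + (LINT x|M. P x \<bullet> A x) = 0"
    using tendsto_add[OF tendsto_add[OF l1 l2] l3] reg[OF d(1,2)] by (simp add: LIMSEQ_const_iff)
  moreover have "(LINT x|M. (c x + g x / 2) * (e x \<bullet> e x)) =
      (LINT x|M. c x * (e x \<bullet> e x)) + (LINT x|M. g x * (e x \<bullet> e x / 2))"
  proof -
    have "integrable M (\<lambda>x. (e x \<bullet> e x) * c x)" "integrable M (\<lambda>x. (e x \<bullet> e x / 2) * g x)"
      using integrable_mult_bounded[OF L2_inner_integrable[OF eL eL] m(5) C(2)]
        integrable_mult_bounded[OF integrable_divide_zero[OF L2_inner_integrable[OF eL eL]] m(6) D(2)]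
      by auto
    then have "(LINT x|M. c x * (e x \<bullet> e x) + g x * (e x \<bullet> e x / 2)) =
        (LINT x|M. c x * (e x \<bullet> e x)) + (LINT x|M. g x * (e x \<bullet> e x / 2))"
      by (intro Bochner_Integration.integral_add) (simp_all add: mult.commute)
    then show ?thesis by (simp add: distrib_right)
  qed
  ultimately show ?thesis by simp
qed

section \<open>Difference of two solutions of the momentum equation\<close>

lemma strain_L2: "v \<in> vH10 \<Omega> \<Longrightarrow> strain \<Omega> v \<in> L2 \<Omega>"
  unfolding strain_def[abs_def]
proof (rule L2_cmult, rule L2_add)
  assume "v \<in> vH10 \<Omega>"
  then have J: "wjac \<Omega> v \<in> L2 \<Omega>" by (rule wjac_L2)
  then show "wjac \<Omega> v \<in> L2 \<Omega>" .
  show "(\<lambda>x. transpose (wjac \<Omega> v x)) \<in> L2 \<Omega>"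
    by (rule L2_bound[OF transpose_measurable[OF L2_measurable[OF J]] L2_sq[OF J]]) (simp add: norm_transpose)
qed

lemma inner_symmetric_part:
  fixes S A :: "real^3^3"
  assumes "transpose S = S"
  shows "S \<bullet> A = S \<bullet> ((1/2) *\<^sub>R (A + transpose A))"
proof -
  have "S \<bullet> transpose A = S \<bullet> A" using inner_transpose[of S A] assms by simp
  then show ?thesis by (simp add: inner_add_right)
qed

text \<open>The equation is affine in the velocity and the stress, so the data common to both
  solutions drop out. The half divergence of \<open>B_tilde\<close> becomes, by
  \<open>B_tilde_eq\<close>, the zeroth order coefficient - g / 2.\<close>

lemma momentum_difference:
  fixes \<rho> \<rho>' m a \<pi> :: "real^3 \<Rightarrow> real" and v w u u' :: "real^3 \<Rightarrow> real^3" and S S' :: "real^3 \<Rightarrow> real^3^3"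
  assumes W: "weak_div (\<lambda>x. \<rho>' x *\<^sub>R w x) g"
    and \<rho>: "\<rho> \<in> Linf \<Omega>" "\<rho>' \<in> Linf \<Omega>" "m \<in> Linf \<Omega>" "a \<in> Linf \<Omega>" and v: "v \<in> L2 \<Omega>"
    and u: "u \<in> vH10 \<Omega>" "u' \<in> vH10 \<Omega>" and S: "S \<in> L2 \<Omega>" "S' \<in> L2 \<Omega>"
    and eq: "momentum_eq \<Omega> dt \<rho> \<rho>' m a v w \<pi> S u" "momentum_eq \<Omega> dt \<rho> \<rho>' m a v w \<pi> S' u'"
    and \<phi>: "\<phi> \<in> vtest_fun \<Omega>"
  shows "(LINT x|M. ((\<rho>' x + \<rho> x) / (2 * dt) - g x / 2) * ((u x - u' x) \<bullet> \<phi> x))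
    + (LINT x|M. ((wjac \<Omega> u x - wjac \<Omega> u' x) *v (\<rho>' x *\<^sub>R w x)) \<bullet> \<phi> x)
    + (LINT x|M. ((2 * m x) *\<^sub>R (strain \<Omega> u x - strain \<Omega> u' x) + a x *\<^sub>R (S x - S' x)) \<bullet> jac \<phi> x) = 0"
proof -
  define W where "W x = \<rho>' x *\<^sub>R w x" for x
  have W': "weak_div W g" using W by (simp add: W_def[abs_def])
  have WL: "W \<in> L2 \<Omega>" and g: "g \<in> Linf \<Omega>" using W' by (auto simp: weak_div_def)
  have sc: "(\<lambda>x. h x *\<^sub>R f x) \<in> L2 \<Omega>" if h: "h \<in> Linf \<Omega>" and f: "f \<in> L2 \<Omega>" for h and f :: "real^3 \<Rightarrow> 'b::euclidean_space"
    using h f unfolding Linf_def by (auto intro: L2_scaleR)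
  define b where "b x = (1/2) * (\<rho>' x + \<rho> x)" for x
  have bL: "b \<in> Linf \<Omega>"
  proof -
    obtain C1 where C1: "AE x in M. \<bar>\<rho> x\<bar> \<le> C1" using \<rho> by (auto simp: Linf_def)
    obtain C2 where C2: "AE x in M. \<bar>\<rho>' x\<bar> \<le> C2" using \<rho> by (auto simp: Linf_def)
    have "AE x in M. \<bar>b x\<bar> \<le> C1 + C2" using C1 C2 by eventually_elim (auto simp: b_def)
    moreover have "b \<in> borel_measurable M"
    proof -
      have "\<rho> \<in> borel_measurable M" "\<rho>' \<in> borel_measurable M" using \<rho> by (simp_all add: Linf_def)
      then show ?thesis unfolding b_def[abs_def] by measurable
    qed
    ultimately show ?thesis unfolding Linf_def by blast
  qed
  obtain Cp where Cp: "Cp \<ge> 0" "\<And>x. norm (\<phi> x) \<le> Cp" "\<And>x. norm (jac \<phi> x) \<le> Cp"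
    using vtest_bounded[OF \<phi>] by blast
  note \<phi>L = vtest_L2[OF \<phi>] and jL = jac_L2[OF \<phi>]
  have i1: "integrable M (\<lambda>x. b x * (z x \<bullet> \<phi> x))" "integrable M (\<lambda>x. g x * (z x \<bullet> \<phi> x))" if "z \<in> vH10 \<Omega>" for z
    using L2_inner_integrable[OF sc[OF bL vH10_L2[OF that]] \<phi>L] L2_inner_integrable[OF sc[OF g vH10_L2[OF that]] \<phi>L]
    by simp_all
  have i2: "integrable M (\<lambda>x. \<rho> x * (v x \<bullet> \<phi> x))"
    using L2_inner_integrable[OF sc[OF \<rho>(1) v] \<phi>L] by simp
  have i3: "integrable M (\<lambda>x. (wjac \<Omega> z x *v W x) \<bullet> \<phi> x)" if z: "z \<in> vH10 \<Omega>" for z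
  proof (rule Bochner_Integration.integrable_bound)
    show "integrable M (\<lambda>x. Cp * (norm (wjac \<Omega> z x) * norm (W x)))"
      using L2_norm_mult_integrable[OF wjac_L2[OF z] WL] by simp
    show "AE x in M. norm ((wjac \<Omega> z x *v W x) \<bullet> \<phi> x) \<le> norm (Cp * (norm (wjac \<Omega> z x) * norm (W x)))"
    proof (rule AE_I2)
      fix x
      have "norm ((wjac \<Omega> z x *v W x) \<bullet> \<phi> x) \<le> norm (wjac \<Omega> z x *v W x) * norm (\<phi> x)"
        using Cauchy_Schwarz_ineq2 by simp
      also have "\<dots> \<le> (norm (wjac \<Omega> z x) * norm (W x)) * Cp"
        by (intro mult_mono norm_matrix_vector_le Cp) auto
      finally show "norm ((wjac \<Omega> z x *v W x) \<bullet> \<phi> x) \<le> norm (Cp * (norm (wjac \<Omega> z x) * norm (W x)))"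
        using Cp(1) by (simp add: mult_ac)
    qed
    show "(\<lambda>x. (wjac \<Omega> z x *v W x) \<bullet> \<phi> x) \<in> borel_measurable M"
      using matrix_vector_measurable[OF L2_measurable[OF wjac_L2[OF z]] L2_measurable[OF WL]] vtest_M[OF \<phi>] by simp
  qed
  have i4: "integrable M (\<lambda>x. m x * (strain \<Omega> z x \<bullet> jac \<phi> x))" if "z \<in> vH10 \<Omega>" for z
    using L2_inner_integrable[OF sc[OF \<rho>(3) strain_L2[OF that]] jL] by simp
  have i5: "integrable M (\<lambda>x. a x * (Z x \<bullet> jac \<phi> x))" if "Z \<in> L2 \<Omega>" for Z
    using L2_inner_integrable[OF sc[OF \<rho>(4) that] jL] by simp
  \<comment> \<open>The pressure term and the term of the old velocity are the same numbers in both
    equations; naming them lets them cancel arithmetically.\<close>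
  define pr where "pr = (LINT x|M. \<pi> x * trace (jac \<phi> x))"
  define ov where "ov = (LINT x|M. \<rho> x * (v x \<bullet> \<phi> x))"
  have key: "(1/dt) * ((LINT x|M. b x * (z x \<bullet> \<phi> x)) - ov)
      + ((LINT x|M. (wjac \<Omega> z x *v W x) \<bullet> \<phi> x) - (1/2) * (LINT x|M. g x * (z x \<bullet> \<phi> x)))
      + 2 * (LINT x|M. m x * (strain \<Omega> z x \<bullet> jac \<phi> x)) - pr + (LINT x|M. a x * (Z x \<bullet> jac \<phi> x)) = 0"
    if z: "z \<in> vH10 \<Omega>" and e: "momentum_eq \<Omega> dt \<rho> \<rho>' m a v w \<pi> Z z" for z Z
  proof -
    have "(1/dt) * (LINT x|M. (b x *\<^sub>R z x - \<rho> x *\<^sub>R v x) \<bullet> \<phi> x) + B_tilde \<Omega> W z \<phi>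
        + (LINT x|M. ((2 * m x) *\<^sub>R strain \<Omega> z x) \<bullet> jac \<phi> x) - pr = - (LINT x|M. (a x *\<^sub>R Z x) \<bullet> jac \<phi> x)"
      using bspec[OF e[unfolded momentum_eq_def] \<phi>] by (simp add: pr_def b_def W_def[abs_def])
    moreover have "(LINT x|M. (b x *\<^sub>R z x - \<rho> x *\<^sub>R v x) \<bullet> \<phi> x) = (LINT x|M. b x * (z x \<bullet> \<phi> x)) - ov"
      using i1(1)[OF z] i2 by (simp add: inner_diff_left ov_def)
    moreover have "(LINT x|M. ((2 * m x) *\<^sub>R strain \<Omega> z x) \<bullet> jac \<phi> x) = 2 * (LINT x|M. m x * (strain \<Omega> z x \<bullet> jac \<phi> x))"
      by (simp add: mult.assoc)
    ultimately show ?thesis by (simp add: B_tilde_eq[OF W' z \<phi>])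
  qed
  have d1: "(LINT x|M. ((\<rho>' x + \<rho> x) / (2 * dt) - g x / 2) * ((u x - u' x) \<bullet> \<phi> x)) =
      (1/dt) * ((LINT x|M. b x * (u x \<bullet> \<phi> x)) - (LINT x|M. b x * (u' x \<bullet> \<phi> x)))
      - (1/2) * ((LINT x|M. g x * (u x \<bullet> \<phi> x)) - (LINT x|M. g x * (u' x \<bullet> \<phi> x)))"
  proof -
    have "(\<rho>' x + \<rho> x) / (2 * dt) = (1/dt) * b x" for x by (simp add: b_def)
    then have "(LINT x|M. ((\<rho>' x + \<rho> x) / (2 * dt) - g x / 2) * ((u x - u' x) \<bullet> \<phi> x)) =
        (LINT x|M. (1/dt) * (b x * (u x \<bullet> \<phi> x) - b x * (u' x \<bullet> \<phi> x)) - (1/2) * (g x * (u x \<bullet> \<phi> x) - g x * (u' x \<bullet> \<phi> x)))"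
      by (intro Bochner_Integration.integral_cong refl) (simp add: inner_diff_left algebra_simps)
    then show ?thesis using i1[OF u(1)] i1[OF u(2)] by simp
  qed
  have d2: "(LINT x|M. ((wjac \<Omega> u x - wjac \<Omega> u' x) *v (\<rho>' x *\<^sub>R w x)) \<bullet> \<phi> x) =
      (LINT x|M. (wjac \<Omega> u x *v W x) \<bullet> \<phi> x) - (LINT x|M. (wjac \<Omega> u' x *v W x) \<bullet> \<phi> x)"
    using i3[OF u(1)] i3[OF u(2)] by (simp add: matrix_vector_mult_diff_rdistrib inner_diff_left W_def[symmetric])
  have d3: "(LINT x|M. ((2 * m x) *\<^sub>R (strain \<Omega> u x - strain \<Omega> u' x) + a x *\<^sub>R (S x - S' x)) \<bullet> jac \<phi> x) =
      2 * ((LINT x|M. m x * (strain \<Omega> u x \<bullet> jac \<phi> x)) - (LINT x|M. m x * (strain \<Omega> u' x \<bullet> jac \<phi> x)))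
      + ((LINT x|M. a x * (S x \<bullet> jac \<phi> x)) - (LINT x|M. a x * (S' x \<bullet> jac \<phi> x)))"
  proof -
    have "(LINT x|M. ((2 * m x) *\<^sub>R (strain \<Omega> u x - strain \<Omega> u' x) + a x *\<^sub>R (S x - S' x)) \<bullet> jac \<phi> x) =
      (LINT x|M. 2 * (m x * (strain \<Omega> u x \<bullet> jac \<phi> x) - m x * (strain \<Omega> u' x \<bullet> jac \<phi> x))
        + (a x * (S x \<bullet> jac \<phi> x) - a x * (S' x \<bullet> jac \<phi> x)))"
      by (intro Bochner_Integration.integral_cong refl) (simp add: inner_add_left inner_diff_left algebra_simps)
    then show ?thesis using i4[OF u(1)] i4[OF u(2)] i5[OF S(1)] i5[OF S(2)] by simp
  qed
  show ?thesis
    unfolding d1 d2 d3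
    using key[OF u(1) eq(1)] key[OF u(2) eq(2)] by (simp add: algebra_simps)
qed

end

section \<open>The projection\<close>

lemma trace_transpose_mult: "trace (transpose A ** A) = (A :: real^3^3) \<bullet> A"
  unfolding trace_def matrix_matrix_mult_def transpose_def inner_vec_def
  by (simp add: power2_eq_square) (rule sum.swap)

lemma tensor_norm_eq: "tensor_norm A = norm A / sqrt 2"
  by (simp add: tensor_norm_def trace_transpose_mult real_sqrt_divide norm_eq_sqrt_inner)

text \<open>A ball intersected with two subspaces, from which closedness and convexity are read off.
  The radius \<open>sqrt 2\<close> reflects the factor 1/2 in the tensor norm.\<close>

lemma Lam_eq: "Lam = cball 0 (sqrt 2) \<inter> {A. transpose A = A} \<inter> {A. trace A = 0}"
  by (auto simp: Lam_def tensor_norm_eq divide_le_eq)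

lemma closed_Lam: "closed Lam"
proof -
  have "closed {A :: real^3^3. transpose A = A}"
    unfolding transpose_def by (intro closed_Collect_eq continuous_intros)
  moreover have "closed {A :: real^3^3. trace A = 0}"
    unfolding trace_def by (intro closed_Collect_eq continuous_intros)
  ultimately show ?thesis unfolding Lam_eq by (intro closed_Int closed_cball)
qed

lemma convex_Lam: "convex Lam"
proof -
  have "convex {A :: real^3^3. transpose A = A}"
    by (rule convexI) (auto simp: transpose_def vec_eq_iff)
  moreover have "convex {A :: real^3^3. trace A = 0}"
    by (rule convexI) (auto simp: trace_def sum.distrib sum_distrib_left[symmetric])
  ultimately show ?thesis unfolding Lam_eq by (intro convex_Int convex_cball)
qed

lemma proj_Lam_nonexpansive: "norm (proj_Lam A - proj_Lam B) \<le> norm (A - B)"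
proof -
  have "0 \<in> Lam" by (simp add: Lam_eq trace_def transpose_def vec_eq_iff)
  then show ?thesis
    using closest_point_lipschitz[OF convex_Lam closed_Lam, of A B] by (auto simp: proj_Lam_def dist_norm)
qed

section \<open>Contraction of the fixed-point iteration\<close>

context bounded_open
begin

lemma Lam_fieldsD: "S \<in> Lam_fields \<Omega> \<Longrightarrow> S \<in> L2 \<Omega>"
  "S \<in> Lam_fields \<Omega> \<Longrightarrow> AE x in M. transpose (S x) = S x"
  by (auto simp: Lam_fields_def Lam_def elim: eventually_mono)

lemma Linf_mult_integrable:
  assumes "integrable M f" "h \<in> Linf \<Omega>" shows "integrable M (\<lambda>x. h x * f x)"
proof -
  obtain C where "AE x in M. \<bar>h x\<bar> \<le> C" using assms by (auto simp: Linf_def)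
  from integrable_mult_bounded[OF assms(1) _ this] assms(2) show ?thesis by (simp add: Linf_def mult.commute)
qed

text \<open>\<open>momentum_difference\<close> contributes - g / 2 and
  \<open>energy_identity\<close> adds g / 2, so exactly \<open>(\<rho>' + \<rho>) / (2 * dt)\<close>
  is left in front of |e|^2, and this is at least \<open>\<rho>1 / dt\<close>.\<close>

lemma energy_inequality:
  fixes \<rho> \<rho>' m a \<pi> :: "real^3 \<Rightarrow> real" and v w u u' :: "real^3 \<Rightarrow> real^3" and S S' :: "real^3 \<Rightarrow> real^3^3"
  assumes W: "weak_div (\<lambda>x. \<rho>' x *\<^sub>R w x) g" and dt: "dt > 0"
    and \<rho>: "\<rho> \<in> Linf \<Omega>" "\<rho>' \<in> Linf \<Omega>" "m \<in> Linf \<Omega>" "a \<in> Linf \<Omega>" and v: "v \<in> L2 \<Omega>"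
    and low: "AE x in M. \<rho>1 \<le> \<rho> x \<and> \<rho>1 \<le> \<rho>' x"
    and u: "u \<in> vH10 \<Omega>" "u' \<in> vH10 \<Omega>" and S: "S \<in> Lam_fields \<Omega>" "S' \<in> Lam_fields \<Omega>"
    and eq: "momentum_eq \<Omega> dt \<rho> \<rho>' m a v w \<pi> S u" "momentum_eq \<Omega> dt \<rho> \<rho>' m a v w \<pi> S' u'"
  shows "(\<rho>1 / dt) * (LINT x|M. (norm (u x - u' x))\<^sup>2)
      + 2 * (LINT x|M. m x * (norm (strain \<Omega> u x - strain \<Omega> u' x))\<^sup>2)
    \<le> - (LINT x|M. a x * ((S x - S' x) \<bullet> (strain \<Omega> u x - strain \<Omega> u' x)))"
proof -
  define e where "e x = u x - u' x" for x
  define A where "A x = wjac \<Omega> u x - wjac \<Omega> u' x" for x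
  define D where "D x = strain \<Omega> u x - strain \<Omega> u' x" for x
  define E where "E x = S x - S' x" for x
  define c where "c x = (\<rho>' x + \<rho> x) / (2 * dt) - g x / 2" for x
  define P where "P x = (2 * m x) *\<^sub>R D x + a x *\<^sub>R E x" for x
  have g: "g \<in> Linf \<Omega>" using W by (simp add: weak_div_def)
  have eL: "e \<in> L2 \<Omega>" unfolding e_def[abs_def] by (intro L2_diff vH10_L2 u)
  have AL: "A \<in> L2 \<Omega>" unfolding A_def[abs_def] by (intro L2_diff wjac_L2 u)
  have DL: "D \<in> L2 \<Omega>" unfolding D_def[abs_def] by (intro L2_diff strain_L2 u)
  have EL: "E \<in> L2 \<Omega>" unfolding E_def[abs_def] by (intro L2_diff Lam_fieldsD S)
  have cL: "c \<in> Linf \<Omega>"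
  proof -
    have "\<rho> \<in> borel_measurable M" "\<rho>' \<in> borel_measurable M" "g \<in> borel_measurable M"
      using \<rho> g by (simp_all add: Linf_def)
    then have "c \<in> borel_measurable M" unfolding c_def[abs_def] by measurable
    moreover obtain C1 where C1: "AE x in M. \<bar>\<rho> x\<bar> \<le> C1" using \<rho> by (auto simp: Linf_def)
    moreover obtain C2 where C2: "AE x in M. \<bar>\<rho>' x\<bar> \<le> C2" using \<rho> by (auto simp: Linf_def)
    moreover obtain C3 where C3: "AE x in M. \<bar>g x\<bar> \<le> C3" using g by (auto simp: Linf_def)
    have "AE x in M. \<bar>c x\<bar> \<le> (C2 + C1) / (2 * dt) + C3"
      using C1 C2 C3
    proof eventually_elim
      case (elim x)
      have "\<bar>(\<rho>' x + \<rho> x) / (2 * dt)\<bar> \<le> (C2 + C1) / (2 * dt)"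
        using elim dt by (simp add: abs_divide divide_right_mono)
      then show ?case using elim unfolding c_def by linarith
    qed
    ultimately show ?thesis unfolding Linf_def by blast
  qed
  have PL: "P \<in> L2 \<Omega>"
  proof -
    obtain Cm where "AE x in M. \<bar>m x\<bar> \<le> Cm" using \<rho> by (auto simp: Linf_def)
    then have "(\<lambda>x. m x *\<^sub>R D x) \<in> L2 \<Omega>" using \<rho> by (intro L2_scaleR[OF DL]) (auto simp: Linf_def)
    from L2_cmult[OF this, of 2] have 1: "(\<lambda>x. (2 * m x) *\<^sub>R D x) \<in> L2 \<Omega>" by simp
    obtain Ca where "AE x in M. \<bar>a x\<bar> \<le> Ca" using \<rho> by (auto simp: Linf_def)
    then have 2: "(\<lambda>x. a x *\<^sub>R E x) \<in> L2 \<Omega>" using \<rho> by (intro L2_scaleR[OF EL]) (auto simp: Linf_def)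
    show ?thesis unfolding P_def[abs_def] by (rule L2_add[OF 1 2])
  qed
  obtain \<phi>1 s1 where ap1: "approximable u (wjac \<Omega> u) \<phi>1 s1" using vH10_approximable[OF u(1)] by blast
  obtain \<phi>2 s2 where ap2: "approximable u' (wjac \<Omega> u') \<phi>2 s2" using vH10_approximable[OF u(2)] by blast
  have ap: "approximable e A (\<lambda>j x. \<phi>1 j x - \<phi>2 j x) (\<lambda>x. 2 * s1 x + 2 * s2 x)"
    using approximable_diff[OF ap1 ap2] by (simp add: e_def[abs_def] A_def[abs_def])
  have id: "(LINT x|M. (c x + g x / 2) * (e x \<bullet> e x)) + (LINT x|M. P x \<bullet> A x) = 0"
  proof (rule energy_identity[OF ap W cL PL])
    fix \<psi> assume "\<psi> \<in> vtest_fun \<Omega>"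
    from momentum_difference[OF W \<rho> v u Lam_fieldsD(1)[OF S(1)] Lam_fieldsD(1)[OF S(2)] eq this]
    show "(LINT x|M. c x * (e x \<bullet> \<psi> x)) + (LINT x|M. (A x *v (\<rho>' x *\<^sub>R w x)) \<bullet> \<psi> x) + (LINT x|M. P x \<bullet> jac \<psi> x) = 0"
      by (simp add: c_def e_def A_def P_def D_def E_def)
  qed
  have sq: "integrable M (\<lambda>x. (norm (e x))\<^sup>2)" "integrable M (\<lambda>x. (norm (D x))\<^sup>2)"
    using L2_sq[OF eL] L2_sq[OF DL] .
  have iD: "integrable M (\<lambda>x. m x * (norm (D x))\<^sup>2)" by (rule Linf_mult_integrable[OF sq(2) \<rho>(3)])
  have iE: "integrable M (\<lambda>x. a x * (E x \<bullet> D x))"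
    by (rule Linf_mult_integrable[OF L2_inner_integrable[OF EL DL] \<rho>(4)])
  \<comment> \<open>D is symmetric, and so is E almost everywhere because stresses take values in
    \<open>Lam\<close>. Against symmetric tensors the Jacobian A may be replaced by its symmetric
    part, which is D.\<close>
  have "(LINT x|M. P x \<bullet> A x) = (LINT x|M. 2 * (m x * (norm (D x))\<^sup>2) + a x * (E x \<bullet> D x))"
  proof (rule integral_cong_AE)
    show "AE x in M. P x \<bullet> A x = 2 * (m x * (norm (D x))\<^sup>2) + a x * (E x \<bullet> D x)"
      using Lam_fieldsD(2)[OF S(1)] Lam_fieldsD(2)[OF S(2)]
    proof eventually_elim
      case (elim x)
      have DA: "D x = (1/2) *\<^sub>R (A x + transpose (A x))"
        by (simp add: D_def A_def strain_def transpose_def vec_eq_iff algebra_simps)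
      have "transpose (D x) = D x" unfolding DA by (simp add: transpose_def vec_eq_iff add.commute)
      then have 1: "D x \<bullet> A x = (norm (D x))\<^sup>2"
        using inner_symmetric_part[of "D x" "A x"] by (simp add: DA[symmetric] dot_square_norm)
      have "transpose (E x) = E x" using elim by (simp add: E_def transpose_def vec_eq_iff)
      then have 2: "E x \<bullet> A x = E x \<bullet> D x"
        using inner_symmetric_part[of "E x" "A x"] by (simp add: DA[symmetric])
      show ?case by (simp add: P_def inner_add_left 1 2)
    qed
    show "(\<lambda>x. P x \<bullet> A x) \<in> borel_measurable M" using L2_inner_integrable[OF PL AL] by simp
    show "(\<lambda>x. 2 * (m x * (norm (D x))\<^sup>2) + a x * (E x \<bullet> D x)) \<in> borel_measurable M"
      using iD iE by (intro borel_measurable_integrable) simp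
  qed
  also have "\<dots> = 2 * (LINT x|M. m x * (norm (D x))\<^sup>2) + (LINT x|M. a x * (E x \<bullet> D x))"
    using iD iE by simp
  finally have PA: "(LINT x|M. P x \<bullet> A x) = 2 * (LINT x|M. m x * (norm (D x))\<^sup>2) + (LINT x|M. a x * (E x \<bullet> D x))" .
  have "(\<rho>1 / dt) * (LINT x|M. (norm (e x))\<^sup>2) = (LINT x|M. (\<rho>1 / dt) * (norm (e x))\<^sup>2)" by simp
  also have "\<dots> \<le> (LINT x|M. (c x + g x / 2) * (e x \<bullet> e x))"
  proof (rule integral_mono_AE)
    have "integrable M (\<lambda>x. c x * (e x \<bullet> e x) + (1/2) * (g x * (e x \<bullet> e x)))"
      using Linf_mult_integrable[OF L2_inner_integrable[OF eL eL] cL] Linf_mult_integrable[OF L2_inner_integrable[OF eL eL] g]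
      by simp
    then show "integrable M (\<lambda>x. (c x + g x / 2) * (e x \<bullet> e x))" by (simp add: distrib_right)
    show "AE x in M. (\<rho>1 / dt) * (norm (e x))\<^sup>2 \<le> (c x + g x / 2) * (e x \<bullet> e x)"
      using low
    proof eventually_elim
      case (elim x)
      have "\<rho>1 / dt = (\<rho>1 + \<rho>1) / (2 * dt)" by simp
      also have "\<dots> \<le> (\<rho>' x + \<rho> x) / (2 * dt)" using elim dt by (intro divide_right_mono add_mono) auto
      finally have "\<rho>1 / dt \<le> c x + g x / 2" by (simp add: c_def)
      then show ?case unfolding dot_square_norm by (rule mult_right_mono) simp
    qed
  qed (use sq in simp)
  finally show ?thesis using id PA by (simp add: e_def D_def E_def)
qed

text \<open>After the projection is removed, the square of (1 - \<theta>) E + r a D is expanded and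
  the energy inequality is added with weight 2 (1 - \<theta>) r, which is nonnegative as \<theta>
  \<le> 1. K and Y stand for \<open>\<rho>1 / dt\<close> and the squared velocity error, whose
  contribution survives on the left.\<close>

lemma stress_contraction:
  fixes S S' S1 S1' S0 :: "real^3 \<Rightarrow> real^3^3"
  assumes S: "S \<in> L2 \<Omega>" "S' \<in> L2 \<Omega>" "S1 \<in> L2 \<Omega>" "S1' \<in> L2 \<Omega>" and u: "u \<in> vH10 \<Omega>" "u' \<in> vH10 \<Omega>"
    and upd: "AE x in M. S1 x = stress_update \<Omega> r \<theta> a u S0 S x"
      "AE x in M. S1' x = stress_update \<Omega> r \<theta> a u' S0 S' x"
    and a: "a \<in> Linf \<Omega>" "m \<in> Linf \<Omega>" and bd: "AE x in M. 0 \<le> a x \<and> a x \<le> \<alpha>2 \<and> \<mu>1 \<le> m x"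
    and pos: "r > 0" "\<mu>1 > 0" and small: "4 * \<theta> + r * (\<alpha>2\<^sup>2 / \<mu>1) \<le> 4"
    and energy: "K * Y + 2 * (LINT x|M. m x * (norm (strain \<Omega> u x - strain \<Omega> u' x))\<^sup>2)
      \<le> - (LINT x|M. a x * ((S x - S' x) \<bullet> (strain \<Omega> u x - strain \<Omega> u' x)))"
  shows "(LINT x|M. (norm (S1 x - S1' x))\<^sup>2) + 2 * (1 - \<theta>) * r * K * Y
    \<le> (1 - \<theta>)\<^sup>2 * (LINT x|M. (norm (S x - S' x))\<^sup>2)"
proof -
  define D where "D x = strain \<Omega> u x - strain \<Omega> u' x" for x
  define E where "E x = S x - S' x" for x
  have DL: "D \<in> L2 \<Omega>" unfolding D_def[abs_def] by (intro L2_diff strain_L2 u)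
  have EL: "E \<in> L2 \<Omega>" unfolding E_def[abs_def] by (intro L2_diff S)
  have "0 \<le> r * (\<alpha>2\<^sup>2 / \<mu>1)" using pos by simp
  then have th: "\<theta> \<le> 1" using small by linarith
  \<comment> \<open>The smallness condition in the form in which it absorbs the quadratic strain
    term into the viscous dissipation.\<close>
  have r\<alpha>: "r * \<alpha>2\<^sup>2 \<le> 4 * (1 - \<theta>) * \<mu>1"
  proof -
    have "r * \<alpha>2\<^sup>2 = r * (\<alpha>2\<^sup>2 / \<mu>1) * \<mu>1" using pos by simp
    also have "\<dots> \<le> (4 * (1 - \<theta>)) * \<mu>1" using small pos by (intro mult_right_mono) auto
    finally show ?thesis .
  qed
  have iE2: "integrable M (\<lambda>x. (norm (E x))\<^sup>2)" by (rule L2_sq[OF EL])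
  have iD: "integrable M (\<lambda>x. m x * (norm (D x))\<^sup>2)" by (rule Linf_mult_integrable[OF L2_sq[OF DL] a(2)])
  have iE: "integrable M (\<lambda>x. a x * (E x \<bullet> D x))"
    by (rule Linf_mult_integrable[OF L2_inner_integrable[OF EL DL] a(1)])
  have "(LINT x|M. (norm (S1 x - S1' x))\<^sup>2) \<le>
      (LINT x|M. (1 - \<theta>)\<^sup>2 * (norm (E x))\<^sup>2 + 2 * (1 - \<theta>) * r * (a x * (E x \<bullet> D x))
         + 4 * r * (1 - \<theta>) * (m x * (norm (D x))\<^sup>2))"
  proof (rule integral_mono_AE)
    show "integrable M (\<lambda>x. (norm (S1 x - S1' x))\<^sup>2)" by (rule L2_sq[OF L2_diff[OF S(3,4)]])
    show "integrable M (\<lambda>x. (1 - \<theta>)\<^sup>2 * (norm (E x))\<^sup>2 + 2 * (1 - \<theta>) * r * (a x * (E x \<bullet> D x))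
         + 4 * r * (1 - \<theta>) * (m x * (norm (D x))\<^sup>2))"
      using iE2 iD iE by (intro Bochner_Integration.integrable_add integrable_mult_right)
    show "AE x in M. (norm (S1 x - S1' x))\<^sup>2 \<le> (1 - \<theta>)\<^sup>2 * (norm (E x))\<^sup>2 + 2 * (1 - \<theta>) * r * (a x * (E x \<bullet> D x))
         + 4 * r * (1 - \<theta>) * (m x * (norm (D x))\<^sup>2)"
      using upd bd
    proof eventually_elim
      case (elim x)
      define F where "F = (1 - \<theta>) *\<^sub>R E x + (r * a x) *\<^sub>R D x"
      have "norm (S1 x - S1' x) \<le> norm ((S x + (r * a x) *\<^sub>R strain \<Omega> u x + \<theta> *\<^sub>R (S0 x - S x))
          - (S' x + (r * a x) *\<^sub>R strain \<Omega> u' x + \<theta> *\<^sub>R (S0 x - S' x)))"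
        unfolding elim(1,2) stress_update_def by (rule proj_Lam_nonexpansive)
      also have "\<dots> = norm F"
        by (rule arg_cong[of _ _ norm]) (simp add: F_def E_def D_def algebra_simps)
      finally have "(norm (S1 x - S1' x))\<^sup>2 \<le> (norm F)\<^sup>2" by (rule power_mono) simp
      also have "\<dots> = (1 - \<theta>)\<^sup>2 * (norm (E x))\<^sup>2 + 2 * (1 - \<theta>) * r * (a x * (E x \<bullet> D x)) + r * (r * (a x)\<^sup>2) * (norm (D x))\<^sup>2"
        unfolding dot_square_norm[symmetric] F_def
        using inner_commute[of "D x" "E x"]
        by (simp add: inner_add_left inner_add_right power2_eq_square algebra_simps)
      also have "r * (r * (a x)\<^sup>2) * (norm (D x))\<^sup>2 \<le> r * (4 * (1 - \<theta>) * m x) * (norm (D x))\<^sup>2"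
      proof (intro mult_right_mono mult_left_mono)
        have "(a x)\<^sup>2 \<le> \<alpha>2\<^sup>2" using elim by (intro power_mono) auto
        then have "r * (a x)\<^sup>2 \<le> r * \<alpha>2\<^sup>2" using pos by simp
        also have "\<dots> \<le> 4 * (1 - \<theta>) * \<mu>1" by (rule r\<alpha>)
        also have "\<dots> \<le> 4 * (1 - \<theta>) * m x" using elim th by (intro mult_left_mono) auto
        finally show "r * (a x)\<^sup>2 \<le> 4 * (1 - \<theta>) * m x" .
      qed (use pos in auto)
      finally show ?case by (simp add: mult_ac)
    qed
  qed
  also have "\<dots> = (1 - \<theta>)\<^sup>2 * (LINT x|M. (norm (E x))\<^sup>2) + 2 * (1 - \<theta>) * r * (LINT x|M. a x * (E x \<bullet> D x))
         + 4 * r * (1 - \<theta>) * (LINT x|M. m x * (norm (D x))\<^sup>2)"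
    using iE2 iD iE by simp
  finally have 1: "(LINT x|M. (norm (S1 x - S1' x))\<^sup>2) \<le> (1 - \<theta>)\<^sup>2 * (LINT x|M. (norm (E x))\<^sup>2)
      + (2 * (1 - \<theta>) * r) * ((LINT x|M. a x * (E x \<bullet> D x)) + 2 * (LINT x|M. m x * (norm (D x))\<^sup>2))"
    by (simp add: algebra_simps)
  have "(LINT x|M. a x * (E x \<bullet> D x)) + 2 * (LINT x|M. m x * (norm (D x))\<^sup>2) \<le> - (K * Y)"
    using energy by (simp add: D_def E_def)
  then have "(2 * (1 - \<theta>) * r) * ((LINT x|M. a x * (E x \<bullet> D x)) + 2 * (LINT x|M. m x * (norm (D x))\<^sup>2))
      \<le> (2 * (1 - \<theta>) * r) * - (K * Y)"
    using th pos by (intro mult_left_mono) auto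
  with 1 show ?thesis by (simp add: E_def mult.assoc)
qed

text \<open>f is controlled on the positive reals only. Cut off at 0 it is Borel measurable, and the
  composition agrees almost everywhere with the wanted one because the density is at least a >
  0.\<close>

lemma compose_density_Linf:
  assumes f: "\<forall>s>0. f differentiable (at s)" and b: "\<forall>s\<in>{a..b}. l \<le> f s \<and> f s \<le> h"
    and \<rho>: "\<rho> \<in> borel_measurable M" "AE x in M. a \<le> \<rho> x \<and> \<rho> x \<le> b" and a: "(a::real) > 0"
  shows "(\<lambda>x. f (\<rho> x)) \<in> Linf \<Omega>"
proof -
  have "continuous_on {0<..} f"
    using f by (auto simp: continuous_on_eq_continuous_at intro: differentiable_imp_continuous_within)
  then have "(\<lambda>s. indicator {0<..} s *\<^sub>R f s) \<in> borel_measurable borel"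
    by (intro borel_measurable_continuous_on_indicator) auto
  then have m: "(\<lambda>x. indicator {0<..} (\<rho> x) *\<^sub>R f (\<rho> x)) \<in> borel_measurable M"
    using \<rho>(1) by (rule measurable_compose[rotated])
  have "(\<lambda>x. f (\<rho> x)) \<in> borel_measurable M"
  proof (rule AE_measurable[OF m])
    show "AE x in M. indicator {0<..} (\<rho> x) *\<^sub>R f (\<rho> x) = f (\<rho> x)"
      using \<rho>(2) by eventually_elim (use a in auto)
  qed
  moreover have "AE x in M. \<bar>f (\<rho> x)\<bar> \<le> \<bar>l\<bar> + \<bar>h\<bar>"
    using \<rho>(2)
  proof eventually_elim
    case (elim x)
    then have "l \<le> f (\<rho> x) \<and> f (\<rho> x) \<le> h" using b by simp
    then show ?case by linarith
  qed
  ultimately show ?thesis unfolding Linf_def by blast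
qed

lemma bounded_Linf:
  assumes "\<rho> \<in> borel_measurable M" "AE x in M. a \<le> \<rho> x \<and> \<rho> x \<le> b"
  shows "\<rho> \<in> Linf \<Omega>"
proof -
  have "AE x in M. \<bar>\<rho> x\<bar> \<le> \<bar>a\<bar> + \<bar>b\<bar>" using assms(2) by eventually_elim auto
  with assms(1) show ?thesis unfolding Linf_def by blast
qed

lemma density_step_weak_div:
  assumes w: "solenoidal w" and st: "density_step \<Omega> dt w \<rho> \<rho>'" and dt: "dt > 0"
    and \<rho>: "\<rho> \<in> Linf \<Omega>" "\<rho>' \<in> Linf \<Omega>"
  shows "weak_div (\<lambda>x. \<rho>' x *\<^sub>R w x) (\<lambda>x. (1/dt) * (\<rho>' x - \<rho> x))"
  unfolding weak_div_def
proof (intro conjI ballI)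
  obtain C' where C': "AE x in M. \<bar>\<rho>' x\<bar> \<le> C'" using \<rho> by (auto simp: Linf_def)
  obtain C where C: "AE x in M. \<bar>\<rho> x\<bar> \<le> C" using \<rho> by (auto simp: Linf_def)
  have m: "\<rho> \<in> borel_measurable M" "\<rho>' \<in> borel_measurable M" using \<rho> by (simp_all add: Linf_def)
  show "(\<lambda>x. \<rho>' x *\<^sub>R w x) \<in> L2 \<Omega>"
    using w m C' by (intro L2_scaleR) (auto simp: solenoidal_def)
  have "AE x in M. \<bar>(1/dt) * (\<rho>' x - \<rho> x)\<bar> \<le> (1/dt) * (C' + C)"
    using C C'
  proof eventually_elim
    case (elim x)
    have "\<bar>\<rho>' x - \<rho> x\<bar> \<le> C' + C" using elim by linarith
    then show ?case using dt by (simp add: abs_mult divide_right_mono)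
  qed
  moreover have "(\<lambda>x. (1/dt) * (\<rho>' x - \<rho> x)) \<in> borel_measurable M" using m by measurable
  ultimately show "(\<lambda>x. (1/dt) * (\<rho>' x - \<rho> x)) \<in> Linf \<Omega>" unfolding Linf_def by blast
  fix \<psi> assume "\<psi> \<in> test_fun \<Omega>"
  from density_step_divergence[OF w st dt Linf_L2[OF \<rho>(1)] this]
  show "(LINT x|M. (\<rho>' x *\<^sub>R w x) \<bullet> grad \<psi> x) = (LINT x|M. (1/dt) * (\<rho>' x - \<rho> x) * \<psi> x)"
    by (simp add: mult.assoc)
qed

text \<open>The solution of the implicit step reproduces itself under the update, so
  \<open>stress_contraction\<close> compares the k-th iterate with this constant pair. The stress
  error contracts by the factor 1 - \<theta>, and the velocity error at stage k is controlled by the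
  stress error at the same stage.\<close>

lemma iteration_convergence:
  fixes \<rho> \<rho>' m a \<pi> :: "real^3 \<Rightarrow> real" and v w u' :: "real^3 \<Rightarrow> real^3" and S0 S' :: "real^3 \<Rightarrow> real^3^3"
  assumes w: "solenoidal w" and st: "density_step \<Omega> dt w \<rho> \<rho>'" and dt: "dt > 0" "\<rho>1 > 0" "r > 0" "\<theta> > 0" "\<mu>1 > 0"
    and \<rho>: "\<rho> \<in> Linf \<Omega>" "\<rho>' \<in> Linf \<Omega>" "m \<in> Linf \<Omega>" "a \<in> Linf \<Omega>" and v: "v \<in> L2 \<Omega>"
    and low: "AE x in M. \<rho>1 \<le> \<rho> x \<and> \<rho>1 \<le> \<rho>' x"
    and bd: "AE x in M. 0 \<le> a x \<and> a x \<le> \<alpha>2 \<and> \<mu>1 \<le> m x" and small: "4 * \<theta> + r * (\<alpha>2\<^sup>2 / \<mu>1) \<le> 4"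
    and u': "u' \<in> vH10 \<Omega>" and S': "S' \<in> Lam_fields \<Omega>" and eq: "momentum_eq \<Omega> dt \<rho> \<rho>' m a v w \<pi> S' u'"
    and upd: "AE x in M. S' x = stress_update \<Omega> r \<theta> a u' S0 S' x"
    and it: "fixed_point_iterates \<Omega> dt r \<theta> \<rho> \<rho>' m a v w \<pi> S0 uk Sk"
  shows "\<exists>C. \<forall>k. L2_norm \<Omega> (\<lambda>x. uk k x - u' x) \<le> C * (1 - \<theta>) ^ k \<and>
               tensor_L2_norm \<Omega> (\<lambda>x. Sk k x - S' x) \<le> C * (1 - \<theta>) ^ k"
proof -
  have Sk: "Sk k \<in> Lam_fields \<Omega>" and uk: "uk k \<in> vH10 \<Omega>"
    and eqk: "momentum_eq \<Omega> dt \<rho> \<rho>' m a v w \<pi> (Sk k) (uk k)"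
    and updk: "AE x in M. Sk (Suc k) x = stress_update \<Omega> r \<theta> a (uk k) S0 (Sk k) x" for k
    using it by (auto simp: fixed_point_iterates_def)
  define X where "X k = (LINT x|M. (norm (Sk k x - S' x))\<^sup>2)" for k
  define Y where "Y k = (LINT x|M. (norm (uk k x - u' x))\<^sup>2)" for k
  have X0: "0 \<le> X k" and Y0: "0 \<le> Y k" for k by (simp_all add: X_def Y_def)
  have "0 \<le> r * (\<alpha>2\<^sup>2 / \<mu>1)" using dt by simp
  then have th: "\<theta> \<le> 1" using small by linarith
  have K: "\<rho>1 / dt > 0" using dt by simp
  note W = density_step_weak_div[OF w st dt(1) \<rho>(1,2)]
  note en = energy_inequality[OF W dt(1) \<rho> v low uk u' Sk S' eqk eq]
  have step: "X (Suc k) + 2 * (1 - \<theta>) * r * (\<rho>1 / dt) * Y k \<le> (1 - \<theta>)\<^sup>2 * X k" for k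
    unfolding X_def Y_def
    by (rule stress_contraction[OF Lam_fieldsD(1)[OF Sk] Lam_fieldsD(1)[OF S'] Lam_fieldsD(1)[OF Sk]
        Lam_fieldsD(1)[OF S'] uk u' updk upd \<rho>(4,3) bd dt(3,5) small en])
  have Xle: "X k \<le> ((1 - \<theta>) ^ k)\<^sup>2 * X 0" for k
  proof (induction k)
    case (Suc k)
    have "0 \<le> 2 * (1 - \<theta>) * r * (\<rho>1 / dt) * Y k" using th dt K Y0[of k] by (intro mult_nonneg_nonneg) auto
    then have "X (Suc k) \<le> (1 - \<theta>)\<^sup>2 * X k" using step[of k] by linarith
    also have "\<dots> \<le> (1 - \<theta>)\<^sup>2 * (((1 - \<theta>) ^ k)\<^sup>2 * X 0)" by (intro mult_left_mono Suc) simp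
    finally show ?case by (simp add: power_mult_distrib mult.assoc)
  qed simp
  \<comment> \<open>For \<theta> = 1 the coefficient of \<open>Y k\<close> in \<open>step\<close>
    vanishes. But then smallness forces \<open>\<alpha>2 = 0\<close>, the stress drops out of the
    energy inequality, and every velocity error is zero, so B = 0 works.\<close>
  obtain B where B: "B \<ge> 0" "\<And>k. Y k \<le> ((1 - \<theta>) ^ k)\<^sup>2 * B"
  proof (cases "\<theta> = 1")
    case True
    have "r * (\<alpha>2\<^sup>2 / \<mu>1) \<le> 0" using small True by simp
    then have \<alpha>2: "\<alpha>2 = 0" using dt by (auto simp: mult_le_0_iff divide_le_0_iff)
    have a0: "AE x in M. a x = 0" using bd by eventually_elim (use \<alpha>2 in auto)
    have "Y k \<le> 0" for k
    proof -
      have "(LINT x|M. a x * ((Sk k x - S' x) \<bullet> (strain \<Omega> (uk k) x - strain \<Omega> u' x))) = 0"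
        by (rule integral_eq_zero_AE) (use a0 in \<open>auto elim: eventually_mono\<close>)
      moreover have "0 \<le> (LINT x|M. m x * (norm (strain \<Omega> (uk k) x - strain \<Omega> u' x))\<^sup>2)"
      proof (rule integral_nonneg_AE)
        show "AE x in M. 0 \<le> m x * (norm (strain \<Omega> (uk k) x - strain \<Omega> u' x))\<^sup>2"
          using bd by eventually_elim (use dt in auto)
      qed
      ultimately have "(\<rho>1 / dt) * Y k \<le> 0" using en[of k] by (simp add: Y_def)
      then show ?thesis using mult_le_cancel_left_pos[OF K, of "Y k" 0] by simp
    qed
    then show thesis using that[of 0] by simp
  next
    case False
    define L where "L = 2 * (1 - \<theta>) * r * (\<rho>1 / dt)"
    have L: "L > 0" using False th dt K by (simp add: L_def)
    have "Y k \<le> ((1 - \<theta>) ^ k)\<^sup>2 * (X 0 / L)" for k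
    proof -
      \<comment> \<open>The stress error at stage k + 1 is dropped. The spare factor
        \<open>(1 - \<theta>)^2\<close> is then bounded by 1, which keeps the power k in the
        rate.\<close>
      have "L * Y k \<le> (1 - \<theta>)\<^sup>2 * X k" using step[of k] X0[of "Suc k"] by (simp add: L_def)
      also have "\<dots> \<le> 1 * X k" using th dt X0 by (intro mult_right_mono) (auto simp: power_le_one)
      also have "\<dots> \<le> ((1 - \<theta>) ^ k)\<^sup>2 * X 0" using Xle by simp
      finally show ?thesis using L by (simp add: field_simps)
    qed
    then show thesis using that[of "X 0 / L"] X0 L by simp
  qed
  have th0: "0 \<le> (1 - \<theta>) ^ k" for k using th by simp
  have "L2_norm \<Omega> (\<lambda>x. uk k x - u' x) \<le> sqrt B * (1 - \<theta>) ^ k" for k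
  proof -
    have "L2_norm \<Omega> (\<lambda>x. uk k x - u' x) = sqrt (Y k)" by (simp add: L2_norm_def Y_def)
    also have "\<dots> \<le> sqrt (((1 - \<theta>) ^ k)\<^sup>2 * B)" using B by (intro real_sqrt_le_mono)
    also have "\<dots> = sqrt B * (1 - \<theta>) ^ k" using th0[of k] by (simp add: real_sqrt_mult)
    finally show ?thesis .
  qed
  moreover have "tensor_L2_norm \<Omega> (\<lambda>x. Sk k x - S' x) \<le> sqrt (X 0) * (1 - \<theta>) ^ k" for k
  proof -
    have "tensor_L2_norm \<Omega> (\<lambda>x. Sk k x - S' x) = sqrt (X k / 2)"
      by (simp add: tensor_L2_norm_def X_def tensor_norm_eq power_divide)
    also have "\<dots> \<le> sqrt (((1 - \<theta>) ^ k)\<^sup>2 * X 0)" using Xle[of k] X0[of k] by (intro real_sqrt_le_mono) linarith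
    also have "\<dots> = sqrt (X 0) * (1 - \<theta>) ^ k" using th0[of k] by (simp add: real_sqrt_mult)
    finally show ?thesis .
  qed
  moreover have "sqrt B * (1 - \<theta>) ^ k \<le> (sqrt B + sqrt (X 0)) * (1 - \<theta>) ^ k"
    "sqrt (X 0) * (1 - \<theta>) ^ k \<le> (sqrt B + sqrt (X 0)) * (1 - \<theta>) ^ k" for k
    using B(1) X0[of 0] th0[of k] by (auto intro!: mult_right_mono)
  ultimately show ?thesis by (intro exI[of _ "sqrt B + sqrt (X 0)"]) (meson order_trans)
qed

end

text \<open>An induction over the time steps carries solenoidality of the projected velocity and the
  density bounds through the scheme; each single step is then an instance of
  \<open>iteration_convergence\<close>.\<close>

theorem theorem2:
  fixes \<Omega> :: "(real^3) set" and T r \<theta> :: real and N :: nat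
    and \<rho>1 \<rho>2 \<mu>1 \<mu>2 \<alpha>1 \<alpha>2 :: real
    and \<mu> \<alpha> :: "real \<Rightarrow> real"
    and \<rho>0 :: "real^3 \<Rightarrow> real" and u0 :: "real^3 \<Rightarrow> real^3"
    and \<rho> q p :: "nat \<Rightarrow> real^3 \<Rightarrow> real"
    and u uh :: "nat \<Rightarrow> real^3 \<Rightarrow> real^3"
    and S :: "nat \<Rightarrow> real^3 \<Rightarrow> real^3^3"
    and uk :: "nat \<Rightarrow> nat \<Rightarrow> real^3 \<Rightarrow> real^3"
    and Sk :: "nat \<Rightarrow> nat \<Rightarrow> real^3 \<Rightarrow> real^3^3"
  assumes domain: "open \<Omega>" "connected \<Omega>" "bounded \<Omega>" "\<Omega> \<noteq> {}"
    and params: "T > 0" "N > 0" "r > 0" "\<theta> > 0"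
    and mu_C1: "\<forall>s>0. \<mu> differentiable (at s)" "continuous_on {0<..} (deriv \<mu>)"
    and mu_pos: "\<forall>s>0. \<mu> s > 0"
    and alpha_C1: "\<forall>s>0. \<alpha> differentiable (at s)" "continuous_on {0<..} (deriv \<alpha>)"
    and alpha_nonneg: "\<forall>s>0. \<alpha> s \<ge> 0"
    and bound_consts: "\<mu>1 > 0" "\<mu>2 > 0" "\<alpha>1 \<ge> 0" "\<alpha>2 \<ge> 0"
    and mu_bounds: "\<forall>s\<in>{\<rho>1..\<rho>2}. \<mu>1 \<le> \<mu> s \<and> \<mu> s \<le> \<mu>2"
    and alpha_bounds: "\<forall>s\<in>{\<rho>1..\<rho>2}. \<alpha>1 \<le> \<alpha> s \<and> \<alpha> s \<le> \<alpha>2"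
    and rho0: "\<rho>0 \<in> borel_measurable (lebesgue_on \<Omega>)" "0 < \<rho>1"
      "AE x in lebesgue_on \<Omega>. \<rho>1 \<le> \<rho>0 x \<and> \<rho>0 x \<le> \<rho>2"
    and u0: "u0 \<in> vH10 \<Omega>" "AE x in lebesgue_on \<Omega>. wdiv \<Omega> u0 x = 0"
    and scheme: "bi_projection_scheme \<Omega> T N r \<theta> \<rho>1 \<mu> \<alpha> \<rho>0 u0 \<rho> u uh q p S"
    and iterates: "\<forall>n<N. fixed_point_iterates \<Omega> (T / real N) r \<theta> (\<rho> n) (\<rho> (Suc n))
        (\<lambda>x. \<mu> (\<rho> (Suc n) x)) (\<lambda>x. \<alpha> (\<rho> (Suc n) x)) (u n) (uh n) (\<lambda>x. p n x + q n x) (S n)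
        (uk n) (Sk n)"
    and small: "4 * \<theta> + r * (\<alpha>2\<^sup>2 / \<mu>1) \<le> 4"
  shows "\<forall>n<N.
      ((\<lambda>k. L2_norm \<Omega> (\<lambda>x. uk n k x - u (Suc n) x)) \<longlonglongrightarrow> 0) \<and>
      ((\<lambda>k. tensor_L2_norm \<Omega> (\<lambda>x. Sk n k x - S (Suc n) x)) \<longlonglongrightarrow> 0) \<and>
      (\<exists>C. \<forall>k. L2_norm \<Omega> (\<lambda>x. uk n k x - u (Suc n) x) \<le> C * (1 - \<theta>) ^ k \<and>
               tensor_L2_norm \<Omega> (\<lambda>x. Sk n k x - S (Suc n) x) \<le> C * (1 - \<theta>) ^ k)"
proof -
  interpret bounded_open \<Omega> by unfold_locales (use domain in auto)
  define dt where "dt = T / real N"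
  have dt: "dt > 0" using params by (simp add: dt_def)
  have init: "\<rho> 0 = \<rho>0" "u 0 = u0" "uh 0 = u0" "S 0 \<in> Lam_fields \<Omega>"
    using scheme by (auto simp: bi_projection_scheme_def Let_def)
  have step: "density_step \<Omega> dt (uh n) (\<rho> n) (\<rho> (Suc n))"
      "u (Suc n) \<in> vH10 \<Omega>" "S (Suc n) \<in> Lam_fields \<Omega>"
      "momentum_eq \<Omega> dt (\<rho> n) (\<rho> (Suc n)) (\<lambda>x. \<mu> (\<rho> (Suc n) x)) (\<lambda>x. \<alpha> (\<rho> (Suc n) x))
            (u n) (uh n) (\<lambda>x. p n x + q n x) (S (Suc n)) (u (Suc n))"
      "AE x in lebesgue_on \<Omega>. S (Suc n) x =
             stress_update \<Omega> r \<theta> (\<lambda>x. \<alpha> (\<rho> (Suc n) x)) (u (Suc n)) (S n) (S (Suc n)) x"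
      "pressure_step \<Omega> dt \<rho>1 (u (Suc n)) (q (Suc n))"
      "AE x in lebesgue_on \<Omega>. uh (Suc n) x = u (Suc n) x - (dt / \<rho>1) *\<^sub>R wgrad \<Omega> (q (Suc n)) x"
    if "n < N" for n
    using scheme that by (auto simp: bi_projection_scheme_def Let_def dt_def)
  \<comment> \<open>This comes from the bounds on the initial density: a nonempty open set is not
    null, so at some point of \<Omega> the density lies between \<open>\<rho>1\<close> and
    \<open>\<rho>2\<close>.\<close>
  have "\<rho>1 \<le> \<rho>2"
  proof (rule ccontr)
    assume "\<not> \<rho>1 \<le> \<rho>2"
    then have "AE x in lebesgue_on \<Omega>. False" using rho0(3) by (auto elim: eventually_mono)
    then have "\<Omega> \<in> null_sets lebesgue"
      unfolding AE_restrict_space_iff[OF dom_lebesgue] using dom_lebesgue by (simp add: AE_iff_null_sets)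
    then show False
      using open_not_negligible[OF domain(1,4)] by (simp add: negligible_iff_null_sets)
  qed
  \<comment> \<open>The density bounds at step n + 1 use solenoidality of \<open>uh n\<close>, and
    \<open>uh (Suc n)\<close> is solenoidal by the pressure step, so both have to be carried along
    together.\<close>
  have inv: "solenoidal (uh n) \<and> u n \<in> vH10 \<Omega> \<and> \<rho> n \<in> borel_measurable (lebesgue_on \<Omega>) \<and>
      (AE x in lebesgue_on \<Omega>. \<rho>1 \<le> \<rho> n x \<and> \<rho> n x \<le> \<rho>2)" if "n \<le> N" for n
    using that
  proof (induction n)
    case 0
    then show ?case using init u0 rho0 solenoidal_initial[OF u0] by simp
  next
    case (Suc n)
    then have n: "n < N" by simp
    note IH = Suc.IH[OF less_imp_le[OF n]]
    show ?case
      using solenoidal_projection[OF step(2,6)[OF n] dt rho0(2) step(7)[OF n]] step(2)[OF n]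
        density_step_bounds[OF _ step(1)[OF n] dt _ _ \<open>\<rho>1 \<le> \<rho>2\<close>] IH by blast
  qed
  have conv: "\<exists>C. \<forall>k. L2_norm \<Omega> (\<lambda>x. uk n k x - u (Suc n) x) \<le> C * (1 - \<theta>) ^ k \<and>
               tensor_L2_norm \<Omega> (\<lambda>x. Sk n k x - S (Suc n) x) \<le> C * (1 - \<theta>) ^ k" if n: "n < N" for n
  proof -
    have i0: "solenoidal (uh n)" "u n \<in> vH10 \<Omega>" "\<rho> n \<in> borel_measurable (lebesgue_on \<Omega>)"
      "AE x in lebesgue_on \<Omega>. \<rho>1 \<le> \<rho> n x \<and> \<rho> n x \<le> \<rho>2" using inv[of n] n by auto
    have i1: "\<rho> (Suc n) \<in> borel_measurable (lebesgue_on \<Omega>)"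
      "AE x in lebesgue_on \<Omega>. \<rho>1 \<le> \<rho> (Suc n) x \<and> \<rho> (Suc n) x \<le> \<rho>2" using inv[of "Suc n"] n by auto
    show ?thesis
    proof (rule iteration_convergence[OF i0(1) step(1)[OF n] dt rho0(2) params(3,4) bound_consts(1)
          bounded_Linf[OF i0(3,4)] bounded_Linf[OF i1] compose_density_Linf[OF mu_C1(1) mu_bounds i1 rho0(2)]
          compose_density_Linf[OF alpha_C1(1) alpha_bounds i1 rho0(2)] vH10_L2[OF i0(2)] _ _ small
          step(2,3,4,5)[OF n]])
      show "AE x in lebesgue_on \<Omega>. \<rho>1 \<le> \<rho> n x \<and> \<rho>1 \<le> \<rho> (Suc n) x"
        using i0(4) i1(2) by eventually_elim auto
      show "AE x in lebesgue_on \<Omega>. 0 \<le> \<alpha> (\<rho> (Suc n) x) \<and> \<alpha> (\<rho> (Suc n) x) \<le> \<alpha>2 \<and> \<mu>1 \<le> \<mu> (\<rho> (Suc n) x)"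
        using i1(2) by eventually_elim (use alpha_nonneg alpha_bounds mu_bounds rho0(2) in auto)
      show "fixed_point_iterates \<Omega> dt r \<theta> (\<rho> n) (\<rho> (Suc n))
        (\<lambda>x. \<mu> (\<rho> (Suc n) x)) (\<lambda>x. \<alpha> (\<rho> (Suc n) x)) (u n) (uh n) (\<lambda>x. p n x + q n x) (S n)
        (uk n) (Sk n)" using iterates n by (simp add: dt_def)
    qed
  qed
  have "0 \<le> r * (\<alpha>2\<^sup>2 / \<mu>1)" using params(3) bound_consts(1) by simp
  \<comment> \<open>Smallness gives \<theta> \<le> 1 since the second summand is nonnegative; with
    \<theta> > 0 the ratio lies in [0, 1), so the geometric bound also yields convergence to
    0.\<close>
  then have th: "\<bar>1 - \<theta>\<bar> < 1" using small params(4) by linarith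
  show ?thesis
  proof (intro allI impI)
    fix n assume "n < N"
    from conv[OF this] obtain C where C: "\<And>k. L2_norm \<Omega> (\<lambda>x. uk n k x - u (Suc n) x) \<le> C * (1 - \<theta>) ^ k"
      "\<And>k. tensor_L2_norm \<Omega> (\<lambda>x. Sk n k x - S (Suc n) x) \<le> C * (1 - \<theta>) ^ k" by blast
    have "(\<lambda>k. (1 - \<theta>) ^ k) \<longlonglongrightarrow> 0" by (rule LIMSEQ_power_zero) (use th in simp)
    then have lim: "(\<lambda>k. C * (1 - \<theta>) ^ k) \<longlonglongrightarrow> 0" by (rule tendsto_mult_right_zero)
    have "(\<lambda>k. L2_norm \<Omega> (\<lambda>x. uk n k x - u (Suc n) x)) \<longlonglongrightarrow> 0"
      by (rule tendsto_sandwich[OF _ _ tendsto_const lim]) (use C(1) in \<open>auto simp: L2_norm_def\<close>)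
    moreover have "(\<lambda>k. tensor_L2_norm \<Omega> (\<lambda>x. Sk n k x - S (Suc n) x)) \<longlonglongrightarrow> 0"
      by (rule tendsto_sandwich[OF _ _ tendsto_const lim]) (use C(2) in \<open>auto simp: tensor_L2_norm_def\<close>)
    ultimately show "((\<lambda>k. L2_norm \<Omega> (\<lambda>x. uk n k x - u (Suc n) x)) \<longlonglongrightarrow> 0) \<and>
      ((\<lambda>k. tensor_L2_norm \<Omega> (\<lambda>x. Sk n k x - S (Suc n) x)) \<longlonglongrightarrow> 0) \<and>
      (\<exists>C. \<forall>k. L2_norm \<Omega> (\<lambda>x. uk n k x - u (Suc n) x) \<le> C * (1 - \<theta>) ^ k \<and>
               tensor_L2_norm \<Omega> (\<lambda>x. Sk n k x - S (Suc n) x) \<le> C * (1 - \<theta>) ^ k)"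
      using C by blast
  qed
qed

end
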